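(* Let $X=IG_\omega(m,\mathbb{C}^N)$ be a Grassmannian of type $B$, $C$, or $D$, and let $T\preceq P$ be Schubert symbols in $\Omega(X)$. Then there exists a Schubert symbol $\tilde P\in\Omega(X)$ such that: (1) $T\preceq\tilde P\preceq P$; (2) $Z_{\tilde P,T}=Z_{P,T}$; and (3) $\tilde P\to T$.
   Context: Setting. Let $N\ge 2$, and let $\omega$ be a nondegenerate bilinear form on $\mathbb{C}^N$, symmetric or skew-symmetric, with a fixed basis $\mathbf e_1,\dots,\mathbf e_N$ such that $\omega(\mathbf e_i,\mathbf e_j)=\delta_{i+j,N+1}$ for $i\le j$. For a positive integer $m\le N/2$, $X=IG_\omega(m,\mathbb{C}^N)$ is the projective variety of isotropic $m$-dimensional subspaces of $\mathbb{C}^N$. Type $C$: $\omega$ skew-symmetric, $N=2n$. Type $B$: $\omega$ symmetric, $N=2n+1$. Type $D$: $\omega$ symmetric, $N=2n+2$. $[a,b]$ denotes an integer interval. Schubert symbols. A Schubert symbol is a subset $P=\{p_1<\dots<p_m\}\subset[1,N]$ of cardinality $m$ with $c+d\ne N+1$ for all $c,d\in P$ (including $c=d$). $\Omega(X)$ is the set of all of them. Convention: $p_0=0$, $p_{m+1}=N+1$ (not elements of $P$). Put $\bar P=\{c: N+1-c\in P\}$, $[P]=P\cup\bar P$. In type $D$, $\mathfrak t(P)\in\{0,1,2\}$: if $n+1\in[P]$, $\mathfrak t(P)\in\{0,1\}$ is the parity of $\#([1,n+1]\setminus P)$; otherwise $\mathfrak t(P)=2$. $X_P$ is the closure in $X$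 of $\{\Sigma\in X:\ \{c:\Sigma\cap\langle\mathbf e_1,\dots,\mathbf e_c\rangle\supsetneq\Sigma\cap\langle\mathbf e_1,\dots,\mathbf e_{c-1}\rangle\}=P\}$. $T\preceq P$ means $X_T\subset X_P$; $T\le P$ means $t_i\le p_i$ for all $i$. In types $B,C$, $T\preceq P\iff T\le P$. In type $D$, $T\preceq P$ iff $T\le P$ and, whenever $c\in[0,n]$ satisfies $[c+1,n+1]\subset[P]\cap[T]$ and $\#(P\cap[1,c])=\#(T\cap[1,c])$, one has $\mathfrak t(P)=\mathfrak t(T)$. Cuts. Let $T\le P$. A visible cut (of the pair $P,T$) is $c\in[0,N]$ with $p_i\le c<t_{i+1}$ for some $i\in[0,m]$. An apparent cut is $c\in[0,N]$ such that $c$ or $N-c$ is a visible cut. In types $B,C$ the cuts are the apparent cuts. In type $D$ the cuts are the apparent cuts together with the exceptional cuts: (1) $n+1$ is a cut if for some $i\in[1,m]$ either $p_i=n+2\le t_{i+1}$ or $t_i=n+1\ge p_{i-1}$; (2) if $\mathfrak t(T)\ne\mathfrak t(P)$, then for each $c\in[1,n]$ with $[c+1,n+1]\subset[P]\cap[T]$ and $\#(T\cap[1,c])=\#(P\cap[1,c])+1$, both $c$ and $N-c$ are cuts. $\mathcal C_{P,T}$ is the set of cuts. Equations. $c$ is a zero column if $p_j<c<t_{j+1}$ for some $j\in[0,m]$. Column $c$ contains a lone star if ($c\in T$ and $c\in\mathcal C_{P,T}$) or ($c\in P$ and $c-1\in\mathcal C_{P,T}$). $\mathcal L_{P,T}$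 is the set of $c\in[1,N]$ such that $c$ is a zero column or column $N+1-c$ contains a lone star. $\mathcal Q_{P,T}=[0,n]\cap\mathcal C_{P,T}$ in type $C$, and $\mathcal Q_{P,T}=([0,n]\cap\mathcal C_{P,T})\cup\{n+1\}$ in types $B,D$. Let $x_1,\dots,x_N$ be the coordinates dual to $\mathbf e_1,\dots,\mathbf e_N$; $f_0=0$, $f_c=\sum_{i=1}^c x_ix_{N+1-i}$ for $1\le c\le n$; in type $B$, $f_{n+1}=\sum_{i=1}^n x_ix_{N+1-i}+\frac12x_{n+1}^2$; in type $D$, $f_{n+1}=\sum_{i=1}^{n+1}x_ix_{N+1-i}$. $Z_{P,T}\subset\mathbb{P}^{N-1}$ is the subvariety defined by $\{f_c: c\in\mathcal Q_{P,T}\}\cup\{x_c: c\in\mathcal L_{P,T}\}$. The relation $P\to T$ means: (i) $T\preceq P$; (ii) $p_i\le t_{i+1}$ for all $i\in[1,m-1]$, except that in type $D$ the case $p_i=n+2$, $t_{i+1}=n+1$ is also permitted; (iii) if $p_i=t_{i+1}$ then $p_i\notin\mathcal C_{P,T}$. *)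

theory Defs
  imports "HOL-Analysis.Analysis" "Jordan_Normal_Form.Determinant"
begin

section \<open>The ambient space and the isotropic Grassmannian\<close>

datatype grass_type = Type_B | Type_C | Type_D

fun ambient_dim :: "grass_type \<Rightarrow> nat \<Rightarrow> nat" where
  "ambient_dim Type_B n = 2 * n + 1"
| "ambient_dim Type_C n = 2 * n"
| "ambient_dim Type_D n = 2 * n + 2"

text \<open>The basis vectors \<open>e 1, \<dots>, e N\<close> are indexed from 1, as in the source; \<open>e c\<close> is irrelevant
  for other \<open>c\<close>. The linear structure is the complex one, hence \<open>vec.span\<close>, \<open>vec.dim\<close>, etc.,
  rather than the real notions \<open>span\<close>, \<open>dim\<close>.\<close>

locale isotropic_setting =
  fixes ty :: grass_type and n :: nat
    and \<omega> :: "complex ^ 'n \<Rightarrow> complex ^ 'n \<Rightarrow> complex"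
    and e :: "nat \<Rightarrow> complex ^ 'n"
  assumes ambient_dim_ge_2: "2 \<le> ambient_dim ty n"
    and card_index: "CARD('n) = ambient_dim ty n"
    and linear_left: "\<And>y. Vector_Spaces.linear (*s) (*) (\<lambda>x. \<omega> x y)"
    and linear_right: "\<And>x. Vector_Spaces.linear (*s) (*) (\<lambda>y. \<omega> x y)"
    and symmetry: "\<And>x y. \<omega> y x = (if ty = Type_C then - \<omega> x y else \<omega> x y)"
    and nondegenerate: "\<And>x. (\<And>y. \<omega> x y = 0) \<Longrightarrow> x = 0"
    and basis_inj: "inj_on e {1..ambient_dim ty n}"
    and basis_independent: "vec.independent (e ` {1..ambient_dim ty n})"
    and basis_span: "vec.span (e ` {1..ambient_dim ty n}) = UNIV"
    and form_basis: "\<And>i j. 1 \<le> i \<Longrightarrow> i \<le> j \<Longrightarrow> j \<le> ambient_dim ty n \<Longrightarrow>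
          \<omega> (e i) (e j) = (if i + j = ambient_dim ty n + 1 then 1 else 0)"

definition isotropic_grassmannian ::
  "nat \<Rightarrow> (complex ^ 'n \<Rightarrow> complex ^ 'n \<Rightarrow> complex) \<Rightarrow> (complex ^ 'n) set set" where
  "isotropic_grassmannian m \<omega> =
     {\<Sigma>. vec.subspace \<Sigma> \<and> vec.dim \<Sigma> = m \<and> (\<forall>u\<in>\<Sigma>. \<forall>v\<in>\<Sigma>. \<omega> u v = 0)}"

definition basis_coord :: "nat \<Rightarrow> (nat \<Rightarrow> complex ^ 'n) \<Rightarrow> nat \<Rightarrow> complex ^ 'n \<Rightarrow> complex" where
  "basis_coord N e c v = vec.representation (e ` {1..N}) v (e c)"


section \<open>The Zariski topology on the isotropic Grassmannian\<close>

text \<open>\<open>hom_poly_fun A d F\<close>: \<open>F\<close> is given by a homogeneous polynomial of degree \<open>d\<close> in the variables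
  \<open>z i\<close>, \<open>i \<in> A\<close> (possibly the zero polynomial).\<close>

inductive hom_poly_fun :: "'i set \<Rightarrow> nat \<Rightarrow> (('i \<Rightarrow> complex) \<Rightarrow> complex) \<Rightarrow> bool"
  for A :: "'i set" where
  const: "hom_poly_fun A 0 (\<lambda>z. a)"
| var: "i \<in> A \<Longrightarrow> hom_poly_fun A 1 (\<lambda>z. z i)"
| add: "hom_poly_fun A d F \<Longrightarrow> hom_poly_fun A d G \<Longrightarrow> hom_poly_fun A d (\<lambda>z. F z + G z)"
| mult: "hom_poly_fun A d F \<Longrightarrow> hom_poly_fun A d' G \<Longrightarrow> hom_poly_fun A (d + d') (\<lambda>z. F z * G z)"

definition is_frame :: "nat \<Rightarrow> (nat \<Rightarrow> complex ^ 'n) \<Rightarrow> (complex ^ 'n) set \<Rightarrow> bool" where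
  "is_frame m b \<Sigma> \<longleftrightarrow>
     inj_on b {..<m} \<and> vec.independent (b ` {..<m}) \<and> vec.span (b ` {..<m}) = \<Sigma>"

definition pluecker ::
  "nat \<Rightarrow> nat \<Rightarrow> (nat \<Rightarrow> complex ^ 'n) \<Rightarrow> (nat \<Rightarrow> complex ^ 'n) \<Rightarrow> nat set \<Rightarrow> complex" where
  "pluecker N m e b I =
     Determinant.det (Matrix.mat m m (\<lambda>(i, j). basis_coord N e (sorted_list_of_set I ! i) (b j)))"

text \<open>The topology induced from the Zariski topology of projective space by the Pluecker embedding:
  it is generated by the nonvanishing loci of homogeneous polynomials in the Pluecker coordinates.
  Changing the frame multiplies all Pluecker coordinates by the same nonzero scalar, so the
  choice of \<open>b\<close> does not matter.\<close>

definition zariski_topology ::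
  "nat \<Rightarrow> nat \<Rightarrow> (complex ^ 'n \<Rightarrow> complex ^ 'n \<Rightarrow> complex) \<Rightarrow> (nat \<Rightarrow> complex ^ 'n) \<Rightarrow>
     (complex ^ 'n) set topology" where
  "zariski_topology N m \<omega> e = topology_generated_by
     {{\<Sigma> \<in> isotropic_grassmannian m \<omega>. \<exists>b. is_frame m b \<Sigma> \<and> F (pluecker N m e b) \<noteq> 0} | F d.
        hom_poly_fun {I. I \<subseteq> {1..N} \<and> card I = m} d F}"


section \<open>Schubert symbols and Schubert varieties\<close>

definition schubert_symbols :: "nat \<Rightarrow> nat \<Rightarrow> nat set set" where
  "schubert_symbols N m =
     {P. P \<subseteq> {1..N} \<and> card P = m \<and> (\<forall>c\<in>P. \<forall>d\<in>P. c + d \<noteq> N + 1)}"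

text \<open>\<open>entry N P i\<close> is \<open>p\<^sub>i\<close>, with the conventions \<open>p\<^sub>0 = 0\<close> and \<open>p\<^sub>m\<^sub>+\<^sub>1 = N + 1\<close>.\<close>

definition entry :: "nat \<Rightarrow> nat set \<Rightarrow> nat \<Rightarrow> nat" where
  "entry N P i =
     (if i = 0 then 0 else if i \<le> card P then sorted_list_of_set P ! (i - 1) else N + 1)"

definition sym_closure :: "nat \<Rightarrow> nat set \<Rightarrow> nat set" where
  "sym_closure N P = P \<union> {c \<in> {1..N}. N + 1 - c \<in> P}"

definition symbol_type :: "nat \<Rightarrow> nat set \<Rightarrow> nat" where
  "symbol_type n P =
     (if n + 1 \<in> sym_closure (ambient_dim Type_D n) P then card ({1..n + 1} - P) mod 2 else 2)"

definition jump_set :: "nat \<Rightarrow> (nat \<Rightarrow> complex ^ 'n) \<Rightarrow> (complex ^ 'n) set \<Rightarrow> nat set" where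
  "jump_set N e \<Sigma> =
     {c \<in> {1..N}. \<Sigma> \<inter> vec.span (e ` {1..c - 1}) \<subset> \<Sigma> \<inter> vec.span (e ` {1..c})}"

definition schubert_variety ::
  "nat \<Rightarrow> nat \<Rightarrow> (complex ^ 'n \<Rightarrow> complex ^ 'n \<Rightarrow> complex) \<Rightarrow> (nat \<Rightarrow> complex ^ 'n) \<Rightarrow>
     nat set \<Rightarrow> (complex ^ 'n) set set" where
  "schubert_variety N m \<omega> e P =
     zariski_topology N m \<omega> e closure_of {\<Sigma> \<in> isotropic_grassmannian m \<omega>. jump_set N e \<Sigma> = P}"

text \<open>The Bruhat order \<open>T \<preceq> P\<close>.\<close>

definition bruhat_le ::
  "nat \<Rightarrow> nat \<Rightarrow> (complex ^ 'n \<Rightarrow> complex ^ 'n \<Rightarrow> complex) \<Rightarrow> (nat \<Rightarrow> complex ^ 'n) \<Rightarrow>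
     nat set \<Rightarrow> nat set \<Rightarrow> bool" where
  "bruhat_le N m \<omega> e T P \<longleftrightarrow> schubert_variety N m \<omega> e T \<subseteq> schubert_variety N m \<omega> e P"


section \<open>Cuts\<close>

definition visible_cut :: "nat \<Rightarrow> nat \<Rightarrow> nat set \<Rightarrow> nat set \<Rightarrow> nat \<Rightarrow> bool" where
  "visible_cut N m P T c \<longleftrightarrow> c \<le> N \<and> (\<exists>i\<in>{0..m}. entry N P i \<le> c \<and> c < entry N T (i + 1))"

definition apparent_cut :: "nat \<Rightarrow> nat \<Rightarrow> nat set \<Rightarrow> nat set \<Rightarrow> nat \<Rightarrow> bool" where
  "apparent_cut N m P T c \<longleftrightarrow> c \<le> N \<and> (visible_cut N m P T c \<or> visible_cut N m P T (N - c))"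

text \<open>The two kinds of exceptional cuts in type D, where \<open>N = 2 * n + 2\<close>.\<close>

definition exceptional_cut1 :: "nat \<Rightarrow> nat \<Rightarrow> nat set \<Rightarrow> nat set \<Rightarrow> nat \<Rightarrow> bool" where
  "exceptional_cut1 n m P T c \<longleftrightarrow> (let N = ambient_dim Type_D n in
     c = n + 1 \<and>
     (\<exists>i\<in>{1..m}. (entry N P i = n + 2 \<and> n + 2 \<le> entry N T (i + 1)) \<or>
                 (entry N T i = n + 1 \<and> n + 1 \<ge> entry N P (i - 1))))"

definition exceptional_cut2 :: "nat \<Rightarrow> nat set \<Rightarrow> nat set \<Rightarrow> nat \<Rightarrow> bool" where
  "exceptional_cut2 n P T c \<longleftrightarrow> (let N = ambient_dim Type_D n in
     symbol_type n T \<noteq> symbol_type n P \<and>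
     (\<exists>a\<in>{1..n}. {a + 1..n + 1} \<subseteq> sym_closure N P \<inter> sym_closure N T \<and>
        card (T \<inter> {1..a}) = card (P \<inter> {1..a}) + 1 \<and> (c = a \<or> c = N - a)))"

definition cuts :: "grass_type \<Rightarrow> nat \<Rightarrow> nat \<Rightarrow> nat set \<Rightarrow> nat set \<Rightarrow> nat set" where
  "cuts ty n m P T =
     {c. apparent_cut (ambient_dim ty n) m P T c \<or>
         (ty = Type_D \<and> (exceptional_cut1 n m P T c \<or> exceptional_cut2 n P T c))}"


section \<open>The projective varieties Z and the relation P to T\<close>

definition zero_column :: "nat \<Rightarrow> nat \<Rightarrow> nat set \<Rightarrow> nat set \<Rightarrow> nat \<Rightarrow> bool" where
  "zero_column N m P T c \<longleftrightarrow> (\<exists>j\<in>{0..m}. entry N P j < c \<and> c < entry N T (j + 1))"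

definition lone_star :: "grass_type \<Rightarrow> nat \<Rightarrow> nat \<Rightarrow> nat set \<Rightarrow> nat set \<Rightarrow> nat \<Rightarrow> bool" where
  "lone_star ty n m P T c \<longleftrightarrow>
     (c \<in> T \<and> c \<in> cuts ty n m P T) \<or> (c \<in> P \<and> c - 1 \<in> cuts ty n m P T)"

definition linear_eqs :: "grass_type \<Rightarrow> nat \<Rightarrow> nat \<Rightarrow> nat set \<Rightarrow> nat set \<Rightarrow> nat set" where
  "linear_eqs ty n m P T = (let N = ambient_dim ty n in
     {c \<in> {1..N}. zero_column N m P T c \<or> lone_star ty n m P T (N + 1 - c)})"

definition quadratic_eqs :: "grass_type \<Rightarrow> nat \<Rightarrow> nat \<Rightarrow> nat set \<Rightarrow> nat set \<Rightarrow> nat set" where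
  "quadratic_eqs ty n m P T =
     ({0..n} \<inter> cuts ty n m P T) \<union> (if ty = Type_C then {} else {n + 1})"

text \<open>The quadric \<open>f\<^sub>c\<close>; it is used only for \<open>c \<le> n\<close>, and for \<open>c = n + 1\<close> in types B and D.\<close>

definition quadric ::
  "grass_type \<Rightarrow> nat \<Rightarrow> (nat \<Rightarrow> complex ^ 'n) \<Rightarrow> nat \<Rightarrow> complex ^ 'n \<Rightarrow> complex" where
  "quadric ty n e c v =
     (let N = ambient_dim ty n; x = (\<lambda>i. basis_coord N e i v) in
      if ty = Type_B \<and> c = n + 1
      then (\<Sum>i=1..n. x i * x (N + 1 - i)) + 1 / 2 * (x (n + 1))\<^sup>2
      else (\<Sum>i=1..c. x i * x (N + 1 - i)))"

text \<open>Points of projective space are one-dimensional subspaces.\<close>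

definition Z_variety ::
  "grass_type \<Rightarrow> nat \<Rightarrow> nat \<Rightarrow> (nat \<Rightarrow> complex ^ 'n) \<Rightarrow> nat set \<Rightarrow> nat set \<Rightarrow>
     (complex ^ 'n) set set" where
  "Z_variety ty n m e P T =
     {l. vec.subspace l \<and> vec.dim l = 1 \<and>
         (\<forall>v\<in>l. (\<forall>c\<in>quadratic_eqs ty n m P T. quadric ty n e c v = 0) \<and>
                (\<forall>c\<in>linear_eqs ty n m P T. basis_coord (ambient_dim ty n) e c v = 0))}"

definition arrow ::
  "grass_type \<Rightarrow> nat \<Rightarrow> nat \<Rightarrow> (complex ^ 'n \<Rightarrow> complex ^ 'n \<Rightarrow> complex) \<Rightarrow>
     (nat \<Rightarrow> complex ^ 'n) \<Rightarrow> nat set \<Rightarrow> nat set \<Rightarrow> bool" where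
  "arrow ty n m \<omega> e P T \<longleftrightarrow> (let N = ambient_dim ty n in
     bruhat_le N m \<omega> e T P \<and>
     (\<forall>i\<in>{1..m - 1}. entry N P i \<le> entry N T (i + 1) \<or>
        (ty = Type_D \<and> entry N P i = n + 2 \<and> entry N T (i + 1) = n + 1)) \<and>
     (\<forall>i\<in>{1..m - 1}. entry N P i = entry N T (i + 1) \<longrightarrow> entry N P i \<notin> cuts ty n m P T))"

end

theory Submission
  imports Defs
begin

text \<open>Put \<open>D(c) = #(T \<inter> [1,c]) - #(P \<inter> [1,c])\<close>. Then \<open>T \<le> P\<close> means \<open>D \<ge> 0\<close>, the visible cuts are the zeros of
  \<open>D\<close>, and \<open>P \<rightarrow> T\<close> essentially means that \<open>D \<le> 1\<close> and that no common element of \<open>P\<close> and \<open>T\<close> with \<open>D = 1\<close> is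
  a cut. In type D the same holds after lowering \<open>D\<close> by one where a parity obstruction is present. As
  long as \<open>P \<rightarrow> T\<close> fails, some reflection lowers \<open>P\<close> to a symbol which is still above \<open>T\<close> and has the same
  equations \<open>Z\<close>; induction on the sum of the elements of \<open>P\<close> gives the symbol that is sought. The same
  lowering step, with the cuts disregarded, joins any two comparable symbols by a chain of reflections.

  The geometric order agrees with the combinatorial one: a reflection is realised by a curve of
  isotropic subspaces which starts at an arbitrary point of the smaller cell, in coordinates adapted to
  that point; conversely, if \<open>X\<^sub>T \<subseteq> X\<^sub>P\<close> then the Pluecker coordinate \<open>p\<^sub>T\<close> does not vanish identically on
  the cell of \<open>P\<close>.\<close>

section \<open>The excess of a pair of Schubert symbols\<close>

text \<open>Cuts are symmetric under c -> N - c, and the equation at column c is read off at the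
  mirror column N + 1 - c, so lowering P affects a point and its mirror together and room is needed
  at both. The room comes from the difference D c - D (N - c): it changes only at columns lying in
  exactly one of [P] and [T], and it cannot increase across columns of [P]. An interval inside [P]
  therefore admits a reflection next to its right end, where D and its mirror value drop together; a
  column outside [P] admits an exchange of a single element, which alters D on [a, b) only. An
  exchange may destroy a parity defect. Then the loss of one in D is offset by the loss of the
  defect, so that the set of cuts stays the same. Likewise D c = 1 may drop to 0 without harm where
  D (N - c) = 0, since c is a cut already. In type D the point n + 1 is left out of the order: the
  exact value of D there depends on which of two central columns a symbol uses, and only its parity
  enters the order.\<close>

definition count_upto :: "nat set \<Rightarrow> nat \<Rightarrow> nat" where
  "count_upto S c = card (S \<inter> {1..c})"

definition excess :: "nat set \<Rightarrow> nat set \<Rightarrow> nat \<Rightarrow> int" where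
  "excess P T c = int (count_upto T c) - int (count_upto P c)"

lemma count_upto_0 [simp]: "count_upto S 0 = 0"
  by (simp add: count_upto_def)

lemma count_upto_step: "1 \<le> c \<Longrightarrow> count_upto S c = count_upto S (c - 1) + of_bool (c \<in> S)"
proof -
  assume c: "1 \<le> c"
  have "S \<inter> {1..c} = S \<inter> {1..c - 1} \<union> (if c \<in> S then {c} else {})"
    using c by (auto simp: le_less)
  then show ?thesis
    using c by (auto simp: count_upto_def card_insert_if)
qed

lemma count_upto_mono: "c \<le> d \<Longrightarrow> count_upto S c \<le> count_upto S d"
  unfolding count_upto_def by (rule card_mono) auto

lemma count_upto_full: "S \<subseteq> {1..N} \<Longrightarrow> count_upto S N = card S"
  unfolding count_upto_def by (simp add: inf.absorb1)

lemma excess_step: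
  "1 \<le> c \<Longrightarrow> excess P T c = excess P T (c - 1) + of_bool (c \<in> T) - of_bool (c \<in> P)"
  by (simp add: excess_def count_upto_step[of c])

lemma count_upto_exchange:
  assumes "finite P" "a \<notin> P" "b \<in> P" "1 \<le> a" "a < b"
  shows "count_upto (insert a (P - {b})) c = count_upto P c + of_bool (a \<le> c \<and> c < b)"
proof -
  have "insert a (P - {b}) \<inter> {1..c} =
      (if a \<le> c then insert a (P \<inter> {1..c} - {b}) else P \<inter> {1..c} - {b})"
    using assms by auto
  moreover have "b \<le> c \<Longrightarrow> card (P \<inter> {1..c}) > 0"
    using assms by (auto simp: card_gt_0_iff)
  ultimately show ?thesis
    using assms by (auto simp: count_upto_def card_Diff_singleton_if card_insert_if)
qed

lemma excess_exchange:
  assumes "finite P" "a \<notin> P" "b \<in> P" "1 \<le> a" "a < b"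
  shows "excess (insert a (P - {b})) T c = excess P T c - of_bool (a \<le> c \<and> c < b)"
  using count_upto_exchange[OF assms] by (simp add: excess_def)

lemma sum_exchange_less:
  fixes P :: "nat set"
  assumes "finite P" "a \<notin> P" "b \<in> P" "a < b"
  shows "\<Sum>(insert a (P - {b})) < \<Sum>P"
  using assms by (simp add: sum.remove[of P b])

section \<open>Entries of a symbol expressed by the counting function\<close>

lemma sorted_nth_le_iff:
  assumes "finite S" "i < card S"
  shows "sorted_list_of_set S ! i \<le> c \<longleftrightarrow> i < card (S \<inter> {..c})"
proof -
  let ?xs = "sorted_list_of_set S"
  have len: "length ?xs = card S" and set: "set ?xs = S" and d: "distinct ?xs" and s: "sorted ?xs"
    using assms by auto
  show ?thesis
  proof
    assume le: "?xs ! i \<le> c"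
    have "(\<lambda>j. ?xs ! j) ` {..i} \<subseteq> S \<inter> {..c}"
    proof
      fix y assume "y \<in> (\<lambda>j. ?xs ! j) ` {..i}"
      then obtain j where j: "j \<le> i" "y = ?xs ! j" by auto
      then have "y \<in> S" using len assms set nth_mem[of j ?xs] by auto
      moreover have "y \<le> ?xs ! i" using j s len assms by (simp add: sorted_nth_mono)
      ultimately show "y \<in> S \<inter> {..c}" using le by auto
    qed
    moreover have "card ((\<lambda>j. ?xs ! j) ` {..i}) = Suc i"
      using d len assms by (subst card_image) (auto simp: inj_on_def nth_eq_iff_index_eq)
    ultimately show "i < card (S \<inter> {..c})"
      using card_mono[of "S \<inter> {..c}" "(\<lambda>j. ?xs ! j) ` {..i}"] assms by auto
  next
    assume lt: "i < card (S \<inter> {..c})"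
    show "?xs ! i \<le> c"
    proof (rule ccontr)
      assume gt: "\<not> ?xs ! i \<le> c"
      have "S \<inter> {..c} \<subseteq> (\<lambda>j. ?xs ! j) ` {..<i}"
      proof
        fix x assume x: "x \<in> S \<inter> {..c}"
        then obtain j where j: "j < length ?xs" "?xs ! j = x"
          using set by (metis IntD1 in_set_conv_nth)
        have "j < i"
          using gt x j s assms len by (metis IntD2 atMost_iff leI order_trans sorted_nth_mono)
        then show "x \<in> (\<lambda>j. ?xs ! j) ` {..<i}"
          using j by auto
      qed
      then have "card (S \<inter> {..c}) \<le> i"
        using surj_card_le[of "{..<i}"] by fastforce
      then show False using lt by simp
    qed
  qed
qed

text \<open>The range of i includes card S + 1, so the convention p_(m+1) = N + 1 is covered: that
  entry exceeds every c \<le> N.\<close>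

lemma entry_le_iff:
  assumes "S \<subseteq> {1..N}" "i \<le> card S + 1" "c \<le> N"
  shows "entry N S i \<le> c \<longleftrightarrow> i \<le> count_upto S c"
proof -
  have fin: "finite S" using assms finite_subset by blast
  have eq: "S \<inter> {..c} = S \<inter> {1..c}" using assms by fastforce
  consider "i = 0" | "1 \<le> i" "i \<le> card S" | "i = card S + 1" using assms by linarith
  then show ?thesis
  proof cases
    case 2
    then show ?thesis
      using sorted_nth_le_iff[OF fin, of "i - 1" c] eq by (auto simp: entry_def count_upto_def)
  next
    case 3
    have "count_upto S c \<le> card S" unfolding count_upto_def by (rule card_mono) (use fin in auto)
    then show ?thesis using 3 assms by (simp add: entry_def)
  qed (simp add: entry_def)
qed

lemma entry_eq_iff:
  assumes "S \<subseteq> {1..N}" "1 \<le> i" "i \<le> card S" "1 \<le> c" "c \<le> N"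
  shows "entry N S i = c \<longleftrightarrow> c \<in> S \<and> count_upto S c = i"
proof -
  have "entry N S i = c \<longleftrightarrow> entry N S i \<le> c \<and> \<not> entry N S i \<le> c - 1"
    using assms by linarith
  also have "\<dots> \<longleftrightarrow> i \<le> count_upto S c \<and> \<not> i \<le> count_upto S (c - 1)"
    using assms entry_le_iff[of S N i c] entry_le_iff[of S N i "c - 1"] by simp
  also have "\<dots> \<longleftrightarrow> c \<in> S \<and> count_upto S c = i"
    using count_upto_step[of c S] assms by (auto split: if_splits simp: of_bool_def)
  finally show ?thesis .
qed

text \<open>For a subspace \<open>\<Sigma>\<close> in the cell of \<open>P\<close>, \<open>\<Sigma>\<close> induces a maximal isotropic subspace of
  \<open>F\<^sub>c\<^sup>\<bottom> / F\<^sub>c\<close> as soon as \<open>[c + 1, n + 1] \<subseteq> [P]\<close>. A parity defect at \<open>c\<close> (or \<open>N - c\<close>) says that the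
  two maximal isotropic subspaces obtained from \<open>P\<close> and \<open>T\<close> belong to opposite families.\<close>

definition parity_defect :: "grass_type \<Rightarrow> nat \<Rightarrow> nat set \<Rightarrow> nat set \<Rightarrow> nat \<Rightarrow> bool" where
  "parity_defect ty n P T c \<longleftrightarrow> ty = Type_D \<and> c \<noteq> n + 1 \<and> odd (excess P T (n + 1)) \<and>
     {min c (2 * n + 2 - c) + 1..n + 1} \<subseteq>
       sym_closure (2 * n + 2) P \<inter> sym_closure (2 * n + 2) T"

definition reduced_excess :: "grass_type \<Rightarrow> nat \<Rightarrow> nat set \<Rightarrow> nat set \<Rightarrow> nat \<Rightarrow> int" where
  "reduced_excess ty n P T c = excess P T c - of_bool (parity_defect ty n P T c)"

text \<open>In type D the points \<open>n\<close> and \<open>n + 2\<close> are treated as neighbours: the two central columns count as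
  a single step, because \<open>e\<^sub>1, \<dots>, e\<^sub>n\<close> extends to a maximal isotropic subspace in two ways.\<close>

definition regular_point :: "grass_type \<Rightarrow> nat \<Rightarrow> nat \<Rightarrow> bool" where
  "regular_point ty n c \<longleftrightarrow> c \<le> ambient_dim ty n \<and> (ty = Type_D \<longrightarrow> c \<noteq> n + 1)"

text \<open>Bruhat order in numerical form: nonnegative excess is the entrywise order, and
  subtracting the defect forbids excess 0 where the induced maximal isotropic subspaces belong to
  opposite families.\<close>

definition comb_le :: "grass_type \<Rightarrow> nat \<Rightarrow> nat set \<Rightarrow> nat set \<Rightarrow> bool" where
  "comb_le ty n T P \<longleftrightarrow> (\<forall>c. regular_point ty n c \<longrightarrow> 0 \<le> reduced_excess ty n P T c)"

text \<open>For ordered pairs and regular c this is membership in \<open>cuts\<close>: a zero of the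
  reduced excess is a visible cut, or an exceptional cut coming from a parity defect.\<close>

definition symmetric_cut :: "grass_type \<Rightarrow> nat \<Rightarrow> nat set \<Rightarrow> nat set \<Rightarrow> nat \<Rightarrow> bool" where
  "symmetric_cut ty n P T c \<longleftrightarrow>
     reduced_excess ty n P T c = 0 \<or> reduced_excess ty n P T (ambient_dim ty n - c) = 0"

definition central_column :: "grass_type \<Rightarrow> nat \<Rightarrow> nat \<Rightarrow> bool" where
  "central_column ty n c \<longleftrightarrow> (ty = Type_B \<and> c = n + 1) \<or> (ty = Type_D \<and> (c = n + 1 \<or> c = n + 2))"

section \<open>Symmetry of the excess under c -> N - c\<close>

locale symbol_pair =
  fixes ty :: grass_type and n m :: nat and P T :: "nat set"
  assumes P_symbol: "P \<in> schubert_symbols (ambient_dim ty n) m"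
    and T_symbol: "T \<in> schubert_symbols (ambient_dim ty n) m"
begin

abbreviation "N \<equiv> ambient_dim ty n"
abbreviation "D \<equiv> excess P T"
abbreviation "full \<equiv> parity_defect ty n P T"
abbreviation "R \<equiv> reduced_excess ty n P T"
abbreviation "K \<equiv> symmetric_cut ty n P T"
abbreviation "clP \<equiv> sym_closure N P"
abbreviation "clT \<equiv> sym_closure N T"

lemma P_sub: "P \<subseteq> {1..N}" and T_sub: "T \<subseteq> {1..N}"
  and card_P: "card P = m" and card_T: "card T = m"
  using P_symbol T_symbol by (auto simp: schubert_symbols_def)

lemma finite_P: "finite P" and finite_T: "finite T"
  using P_sub T_sub finite_subset by blast+

lemma P_bar: "c \<in> P \<Longrightarrow> N + 1 - c \<notin> P" and T_bar: "c \<in> T \<Longrightarrow> N + 1 - c \<notin> T"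
proof -
  show "c \<in> P \<Longrightarrow> N + 1 - c \<notin> P"
    using P_symbol P_sub by (fastforce simp: schubert_symbols_def)
  show "c \<in> T \<Longrightarrow> N + 1 - c \<notin> T"
    using T_symbol T_sub by (fastforce simp: schubert_symbols_def)
qed

lemma N_D: "ty = Type_D \<Longrightarrow> N = 2 * n + 2"
  by simp

lemma in_clP: "c \<in> clP \<longleftrightarrow> c \<in> P \<or> 1 \<le> c \<and> c \<le> N \<and> N + 1 - c \<in> P"
  and in_clT: "c \<in> clT \<longleftrightarrow> c \<in> T \<or> 1 \<le> c \<and> c \<le> N \<and> N + 1 - c \<in> T"
  by (auto simp: sym_closure_def)

lemma D_0 [simp]: "D 0 = 0" by (simp add: excess_def)
lemma D_N [simp]: "D N = 0"
  using count_upto_full[OF P_sub] count_upto_full[OF T_sub] card_P card_T by (simp add: excess_def)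

lemma D_step: "1 \<le> c \<Longrightarrow> D c = D (c - 1) + of_bool (c \<in> T) - of_bool (c \<in> P)"
  by (rule excess_step)

lemma E_step:
  assumes "1 \<le> c" "c \<le> N"
  shows "D (N - (c - 1)) = D (N - c) + of_bool (N + 1 - c \<in> T) - of_bool (N + 1 - c \<in> P)"
proof -
  have "N - (c - 1) = N + 1 - c" "N + 1 - c - 1 = N - c" using assms by auto
  then show ?thesis using D_step[of "N + 1 - c"] assms by simp
qed

text \<open>The mirror column is crossed in the opposite direction, so the contributions of c and N
  + 1 - c add up. A symbol never contains both, hence only the closures [P] and [T] are
  seen.\<close>

lemma DE_step:
  assumes "1 \<le> c" "c \<le> N"
  shows "D c - D (N - c) = D (c - 1) - D (N - (c - 1)) + of_bool (c \<in> clT) - of_bool (c \<in> clP)"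
  using D_step[of c] E_step[OF assms] P_bar[of c] T_bar[of c] assms
  by (auto simp: in_clP in_clT of_bool_def)

lemma mid_notin: "ty = Type_B \<Longrightarrow> n + 1 \<notin> P \<and> n + 1 \<notin> T \<and> n + 1 \<notin> clP \<and> n + 1 \<notin> clT"
  using P_bar[of "n+1"] T_bar[of "n+1"] by (auto simp: sym_closure_def)

lemma full_sym: "c \<le> N \<Longrightarrow> full (N - c) \<longleftrightarrow> full c"
  by (auto simp: parity_defect_def min.commute)

lemma K_sym: "c \<le> N \<Longrightarrow> K (N - c) \<longleftrightarrow> K c"
  by (auto simp: symmetric_cut_def)

lemma DE_const:
  assumes "\<And>x. u < x \<Longrightarrow> x \<le> v \<Longrightarrow> x \<in> clP \<and> x \<in> clT" "u \<le> v" "v \<le> N"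
  shows "D v - D (N - v) = D u - D (N - u)"
  using assms(2,1,3)
proof (induction v rule: dec_induct)
  case (step i)
  then show ?case using DE_step[of "Suc i"] by auto
qed simp

text \<open>The difference D c - D (N - c) vanishes at c = n + 1, where N - c = c, and it is
  constant along the columns common to both closures that a defect provides.\<close>

lemma full_eq:
  assumes "full c" "c \<le> N"
  shows "D (N - c) = D c"
proof -
  note f = assms(1)[unfolded parity_defect_def]
  have N: "N = 2 * n + 2" using f by auto
  have *: "D d = D (N - d)" if "d \<le> n + 1" "{d + 1..n + 1} \<subseteq> clP \<inter> clT" for d
    using DE_const[of d "n + 1"] that N by (auto simp: subset_iff)
  show ?thesis
  proof (cases "c \<le> n + 1")
    case True
    then show ?thesis using *[of c] f N by (simp add: min_def split: if_splits)
  next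
    case False
    then show ?thesis using *[of "N - c"] f N assms(2) by (simp add: min_def split: if_splits)
  qed
qed

text \<open>Moving towards the centre shrinks the interval of columns that a defect
  requires.\<close>

lemma full_mono:
  assumes "full c" "ty = Type_D" "min c (N - c) \<le> min d (N - d)" "d \<noteq> n + 1"
  shows "full d"
proof -
  have "{min d (2 * n + 2 - d) + 1..n + 1} \<subseteq> {min c (2 * n + 2 - c) + 1..n + 1}"
    using assms by auto
  then show ?thesis using assms unfolding parity_defect_def by blast
qed

end

text \<open>Here p1, p2, t1, t2 stand for the membership of n + 1, n + 2 in P and T, and d0, d1, d2
  for the excess at n, n + 1, n + 2. The left-hand sides are the equations at the two central
  columns; on the right d1 survives only through the cut condition k, which lowering steps
  preserve.\<close>

lemma center_arith:
  fixes d0 d1 d2 :: int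
  assumes d1: "d1 = d0 + of_bool t1 - of_bool p1" and d2: "d2 = d1 + of_bool t2 - of_bool p2"
    and excl: "\<not> (p1 \<and> p2)" "\<not> (t1 \<and> t2)"
    and f: "f \<longleftrightarrow> odd d1 \<and> (p1 \<or> p2) \<and> (t1 \<or> t2)"
    and nonneg: "0 \<le> d0" "0 \<le> d1" "0 \<le> d2"
    and pos: "f \<Longrightarrow> 1 \<le> d0" "f \<Longrightarrow> 1 \<le> d2"
    and k: "k \<longleftrightarrow> d0 - of_bool f = 0 \<or> d2 - of_bool f = 0"
  shows "(\<not> p1 \<and> \<not> t1 \<and> d0 = 0 \<and> d1 = 0) \<or> t2 \<and> k \<or> p2 \<and> (d1 = 0 \<or> d1 \<le> 1 \<and> (p2 \<or> t1)) \<longleftrightarrow>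
      k \<and> ((t2 \<or> p2) \<or> \<not> ((p1 \<or> p2) \<or> (t1 \<or> t2)))" (is ?A)
    and "(\<not> p2 \<and> \<not> t2 \<and> d1 = 0 \<and> d2 = 0) \<or> t1 \<and> (d1 = 0 \<or> d1 \<le> 1 \<and> (p2 \<or> t1)) \<or> p1 \<and> k \<longleftrightarrow>
      k \<and> ((t1 \<or> p1) \<or> \<not> ((p1 \<or> p2) \<or> (t1 \<or> t2)))" (is ?B)
proof -
  define x1 x2 y1 y2 :: int where xy: "x1 = of_bool t1" "x2 = of_bool t2" "y1 = of_bool p1" "y2 = of_bool p2"
  have b: "t1 \<longrightarrow> x1 = 1" "\<not> t1 \<longrightarrow> x1 = 0" "t2 \<longrightarrow> x2 = 1" "\<not> t2 \<longrightarrow> x2 = 0"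
    "p1 \<longrightarrow> y1 = 1" "\<not> p1 \<longrightarrow> y1 = 0" "p2 \<longrightarrow> y2 = 1" "\<not> p2 \<longrightarrow> y2 = 0"
    by (auto simp: xy)
  \<comment> \<open>Parity enters the case split as a plain Boolean, with its values at 0, 1, 2
    supplied.\<close>
  define o1 where "o1 = odd d1"
  have o: "d1 = 0 \<longrightarrow> \<not> o1" "d1 = 1 \<longrightarrow> o1" "d1 = 2 \<longrightarrow> \<not> o1" by (auto simp: o1_def)
  have k': "f \<longrightarrow> (k \<longleftrightarrow> d0 = 1 \<or> d2 = 1)" "\<not> f \<longrightarrow> (k \<longleftrightarrow> d0 = 0 \<or> d2 = 0)"
    using k by auto
  have f': "f \<longleftrightarrow> o1 \<and> (p1 \<or> p2) \<and> (t1 \<or> t2)" using f by (simp add: o1_def)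
  have d: "d1 = d0 + x1 - y1" "d2 = d1 + x2 - y2" using d1 d2 by (simp_all add: xy)
  consider "p1" "t1" | "p1" "t2" | "p1" "\<not> t1" "\<not> t2" | "p2" "t1" | "p2" "t2" | "p2" "\<not> t1" "\<not> t2"
    | "\<not> p1" "\<not> p2" "t1" | "\<not> p1" "\<not> p2" "t2" | "\<not> p1" "\<not> p2" "\<not> t1" "\<not> t2"
    by fast
  then have "?A \<and> ?B"
    by cases (use d b o k' f' excl nonneg pos in \<open>cases o1; auto\<close>)+
  then show ?A and ?B by (rule conjunct1, rule conjunct2)
qed

locale ordered_pair = symbol_pair +
  assumes le: "comb_le ty n T P"
begin

lemma R_nonneg: "regular_point ty n c \<Longrightarrow> 0 \<le> R c"
  using le by (auto simp: comb_le_def)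

lemma D_nonneg:
  assumes "c \<le> N"
  shows "0 \<le> D c"
proof (cases "regular_point ty n c")
  case True
  then show ?thesis using R_nonneg[of c] by (auto simp: reduced_excess_def of_bool_def split: if_splits)
next
  case False
  then have ty: "ty = Type_D" and c: "c = n + 1" using assms by (auto simp: regular_point_def)
  have N: "N = 2 * n + 2" using ty by simp
  have n: "0 \<le> R n" "0 \<le> R (n + 2)" using R_nonneg[of n] R_nonneg[of "n+2"] ty by (auto simp: regular_point_def)
  then have n': "0 \<le> D n" "0 \<le> D (n + 2)" by (auto simp: reduced_excess_def of_bool_def split: if_splits)
  show ?thesis
  proof (rule ccontr)
    assume neg: "\<not> 0 \<le> D c"
    have s1: "D (n + 1) = D n + of_bool (n + 1 \<in> T) - of_bool (n + 1 \<in> P)"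
      using D_step[of "n + 1"] by simp
    have s2: "D (n + 2) = D (n + 1) + of_bool (n + 2 \<in> T) - of_bool (n + 2 \<in> P)"
      using D_step[of "n + 2"] by simp
    \<comment> \<open>A negative value at the skipped point forces one central column into P and the
      other into T while D n = 0: a parity defect without any excess to pay for it.\<close>
    have "D (n + 1) = -1" "D n = 0" "n + 1 \<in> P" "n + 2 \<in> T"
      using s1 s2 n' neg c by (auto simp: of_bool_def split: if_splits)
    then have "full n"
      using ty N by (auto simp: parity_defect_def sym_closure_def atLeastAtMost_singleton')
    then show False using n(1) \<open>D n = 0\<close> by (simp add: reduced_excess_def)
  qed
qed

lemma full_pos: "full c \<Longrightarrow> c \<le> N \<Longrightarrow> 1 \<le> D c"
proof -
  assume f: "full c" and c: "c \<le> N"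
  then have "regular_point ty n c" by (auto simp: regular_point_def parity_defect_def)
  then show "1 \<le> D c" using R_nonneg[of c] f by (simp add: reduced_excess_def)
qed

lemma full_center: "full c \<Longrightarrow> c \<le> N \<Longrightarrow> full n \<and> full (n + 2)"
proof -
  assume f: "full c" and c: "c \<le> N"
  have "ty = Type_D" "c \<noteq> n + 1" using f by (auto simp: parity_defect_def)
  then show ?thesis
    using full_mono[OF f, of n] full_mono[OF f, of "n + 2"] c by auto
qed

section \<open>Cuts and linear equations in terms of the excess\<close>

lemma visible_cut_iff: "c \<le> N \<Longrightarrow> visible_cut N m P T c \<longleftrightarrow> D c = 0"
proof -
  assume c: "c \<le> N"
  have "count_upto P c \<le> m" using count_upto_mono[OF c, of P] count_upto_full[OF P_sub] card_P by simp
  have "entry N P i \<le> c \<and> c < entry N T (i + 1) \<longleftrightarrow> i \<le> count_upto P c \<and> \<not> i + 1 \<le> count_upto T c"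
    if "i \<in> {0..m}" for i
    using entry_le_iff[OF P_sub, of i c] entry_le_iff[OF T_sub, of "i + 1" c] card_P card_T c that
    by auto
  then have "visible_cut N m P T c \<longleftrightarrow> (\<exists>i\<in>{0..m}. i \<le> count_upto P c \<and> \<not> i + 1 \<le> count_upto T c)"
    unfolding visible_cut_def using c by blast
  \<comment> \<open>If any index i works, so does the largest admissible one, the number of elements
    of P up to c.\<close>
  also have "\<dots> \<longleftrightarrow> count_upto T c \<le> count_upto P c"
    using \<open>count_upto P c \<le> m\<close> by (auto intro!: bexI[of _ "count_upto P c"])
  also have "\<dots> \<longleftrightarrow> D c = 0" using D_nonneg[OF c] by (auto simp: excess_def)
  finally show ?thesis .
qed

lemma apparent_cut_iff: "apparent_cut N m P T c \<longleftrightarrow> c \<le> N \<and> (D c = 0 \<or> D (N - c) = 0)"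
  unfolding apparent_cut_def using visible_cut_iff[of c] visible_cut_iff[of "N - c"] by auto

lemma symbol_type_neq_iff:
  assumes "ty = Type_D" "n + 1 \<in> clP" "n + 1 \<in> clT"
  shows "symbol_type n T \<noteq> symbol_type n P \<longleftrightarrow> odd (D (n + 1))"
proof -
  have *: "card ({1..n + 1} - S) = n + 1 - count_upto S (n + 1) \<and> count_upto S (n + 1) \<le> n + 1" for S
  proof -
    have "card ({1..n + 1} - (S \<inter> {1..n + 1})) = n + 1 - count_upto S (n + 1)"
      unfolding count_upto_def by (subst card_Diff_subset) auto
    moreover have "{1..n + 1} - (S \<inter> {1..n + 1}) = {1..n + 1} - S" by auto
    moreover have "count_upto S (n + 1) \<le> card {1..n + 1}" unfolding count_upto_def by (rule card_mono) auto
    ultimately show ?thesis by simp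
  qed
  have "symbol_type n T \<noteq> symbol_type n P \<longleftrightarrow>
     (n + 1 - count_upto T (n + 1)) mod 2 \<noteq> (n + 1 - count_upto P (n + 1)) mod 2"
    using assms * by (simp add: symbol_type_def)
  also have "\<dots> \<longleftrightarrow> odd (int (count_upto T (n + 1)) - int (count_upto P (n + 1)))"
    using *[of P] *[of T] by (auto simp: mod2_eq_if even_diff_nat)
  finally show ?thesis by (simp add: excess_def)
qed

lemma exceptional_cut2_iff:
  assumes "ty = Type_D"
  shows "exceptional_cut2 n P T c \<longleftrightarrow>
    (\<exists>a\<in>{1..n}. full a \<and> D a = 1 \<and> (c = a \<or> c = N - a))"
proof -
  have "card (T \<inter> {1..a}) = card (P \<inter> {1..a}) + 1 \<longleftrightarrow> D a = 1" for a
    by (auto simp: excess_def count_upto_def)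
  moreover have "symbol_type n T \<noteq> symbol_type n P \<and> {a + 1..n + 1} \<subseteq> clP \<inter> clT \<longleftrightarrow> full a"
    if "a \<in> {1..n}" for a
  proof -
    have "n + 1 \<in> {a + 1..n + 1}" using that by auto
    then have "{a + 1..n + 1} \<subseteq> clP \<inter> clT \<Longrightarrow> n + 1 \<in> clP \<and> n + 1 \<in> clT" by blast
    moreover have "min a (2 * n + 2 - a) = a" "a \<noteq> n + 1" using that by auto
    moreover have "2 * n + 2 = N" using assms by simp
    ultimately show ?thesis
      using symbol_type_neq_iff[OF assms] assms unfolding parity_defect_def by metis
  qed
  moreover have "exceptional_cut2 n P T c \<longleftrightarrow> symbol_type n T \<noteq> symbol_type n P \<and>
     (\<exists>a\<in>{1..n}. {a + 1..n + 1} \<subseteq> clP \<inter> clT \<and>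
        card (T \<inter> {1..a}) = card (P \<inter> {1..a}) + 1 \<and> (c = a \<or> c = N - a))"
    unfolding exceptional_cut2_def Let_def using assms by simp
  ultimately show ?thesis by blast
qed

lemma exceptional_cut1_iff:
  assumes "ty = Type_D"
  shows "exceptional_cut1 n m P T c \<longleftrightarrow>
    c = n + 1 \<and> D (n + 1) \<le> 1 \<and> (n + 2 \<in> P \<or> n + 1 \<in> T)"
proof -
  have N: "N = 2 * n + 2" using assms by simp
  have 1: "entry N P i = n + 2 \<and> n + 2 \<le> entry N T (i + 1) \<longleftrightarrow>
      n + 2 \<in> P \<and> count_upto P (n + 1) + 1 = i \<and> count_upto T (n + 1) \<le> i" if "i \<in> {1..m}" for i
  proof -
    have "n + 2 \<le> entry N T (i + 1) \<longleftrightarrow> \<not> entry N T (i + 1) \<le> n + 1" by auto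
    also have "\<dots> \<longleftrightarrow> count_upto T (n + 1) \<le> i"
      using entry_le_iff[OF T_sub, of "i + 1" "n + 1"] that card_T N by auto
    finally show ?thesis
      using entry_eq_iff[OF P_sub, of i "n + 2"] that card_P N count_upto_step[of "n + 2" P] by auto
  qed
  have 2: "entry N T i = n + 1 \<and> n + 1 \<ge> entry N P (i - 1) \<longleftrightarrow>
      n + 1 \<in> T \<and> count_upto T (n + 1) = i \<and> i - 1 \<le> count_upto P (n + 1)" if "i \<in> {1..m}" for i
    using entry_eq_iff[OF T_sub, of i "n + 1"] entry_le_iff[OF P_sub, of "i - 1" "n + 1"]
      that card_T card_P N by auto
  have le: "count_upto P (n + 2) \<le> m" "count_upto T (n + 1) \<le> m"
    using count_upto_mono[of "n + 2" N P] count_upto_mono[of "n + 1" N T] count_upto_full[OF P_sub] count_upto_full[OF T_sub]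
      card_P card_T N by simp_all
  have "(\<exists>i\<in>{1..m}. n + 2 \<in> P \<and> count_upto P (n + 1) + 1 = i \<and> count_upto T (n + 1) \<le> i) \<longleftrightarrow>
      n + 2 \<in> P \<and> D (n + 1) \<le> 1"
    using le(1) count_upto_step[of "n + 2" P] by (auto simp: excess_def)
  moreover have "(\<exists>i\<in>{1..m}. n + 1 \<in> T \<and> count_upto T (n + 1) = i \<and> i - 1 \<le> count_upto P (n + 1)) \<longleftrightarrow>
      n + 1 \<in> T \<and> D (n + 1) \<le> 1"
    using le(2) count_upto_step[of "n + 1" T] by (auto simp: excess_def)
  moreover have "exceptional_cut1 n m P T c \<longleftrightarrow> c = n + 1 \<and>
     ((\<exists>i\<in>{1..m}. n + 2 \<in> P \<and> count_upto P (n + 1) + 1 = i \<and> count_upto T (n + 1) \<le> i) \<or>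
      (\<exists>i\<in>{1..m}. n + 1 \<in> T \<and> count_upto T (n + 1) = i \<and> i - 1 \<le> count_upto P (n + 1)))"
  proof -
    have "ambient_dim Type_D n = N" using assms by simp
    then have "exceptional_cut1 n m P T c \<longleftrightarrow> c = n + 1 \<and>
       (\<exists>i\<in>{1..m}. (entry N P i = n + 2 \<and> n + 2 \<le> entry N T (i + 1)) \<or>
          (entry N T i = n + 1 \<and> n + 1 \<ge> entry N P (i - 1)))"
      unfolding exceptional_cut1_def Let_def by simp
    then show ?thesis using 1 2 by blast
  qed
  ultimately show ?thesis by blast
qed

text \<open>Without a defect, a zero of the reduced excess is a zero of D, that is, an apparent cut.
  With a defect, D c = D (N - c) \<ge> 1 and the zero means excess 1, the second exceptional kind.
  The first kind occurs only at n + 1, which is not regular in type D.\<close>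

lemma cuts_iff:
  assumes "regular_point ty n c"
  shows "c \<in> cuts ty n m P T \<longleftrightarrow> K c"
proof -
  have c: "c \<le> N" using assms by (simp add: regular_point_def)
  have e1: "\<not> (ty = Type_D \<and> exceptional_cut1 n m P T c)"
    using assms exceptional_cut1_iff by (auto simp: regular_point_def)
  have "K c \<longleftrightarrow> D c = 0 \<or> D (N - c) = 0 \<or> (ty = Type_D \<and> exceptional_cut2 n P T c)"
  proof
    assume k: "K c"
    show "D c = 0 \<or> D (N - c) = 0 \<or> (ty = Type_D \<and> exceptional_cut2 n P T c)"
    proof (rule ccontr)
      assume neg: "\<not> ?thesis"
      then have f: "full c" and d: "D c = 1"
        using k full_sym[OF c] full_eq[of c] c
        by (auto simp: symmetric_cut_def reduced_excess_def of_bool_def split: if_splits)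
      have ty: "ty = Type_D" and cn: "c \<noteq> n + 1" using f by (auto simp: parity_defect_def)
      define a where "a = min c (N - c)"
      have "a \<in> {1..n}" using neg c cn ty D_0 D_N by (cases "c = 0"; cases "c = N") (auto simp: a_def min_def)
      moreover have "full a" "D a = 1"
        using f d full_sym[OF c] full_eq[OF f c] by (auto simp: a_def min_def)
      moreover have "c = a \<or> c = N - a" using c by (auto simp: a_def min_def)
      ultimately show False using neg exceptional_cut2_iff[OF ty] ty by blast
    qed
  next
    assume r: "D c = 0 \<or> D (N - c) = 0 \<or> (ty = Type_D \<and> exceptional_cut2 n P T c)"
    show "K c"
    proof (cases "ty = Type_D \<and> exceptional_cut2 n P T c")
      case True
      then obtain a where "a \<in> {1..n}" "full a" "D a = 1" "c = a \<or> c = N - a"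
        using exceptional_cut2_iff by blast
      then show ?thesis using True by (auto simp: symmetric_cut_def reduced_excess_def)
    next
      case False
      have "regular_point ty n (N - c)" using assms by (auto simp: regular_point_def)
      have "D c = 0 \<Longrightarrow> \<not> full c" "D (N - c) = 0 \<Longrightarrow> \<not> full (N - c)"
        using full_pos[of c] full_pos[of "N - c"] c by auto
      then show ?thesis using False r by (auto simp: symmetric_cut_def reduced_excess_def)
    qed
  qed
  then show ?thesis
    using e1 c unfolding cuts_def mem_Collect_eq apparent_cut_iff by blast
qed

lemma center_cut_iff:
  assumes "ty = Type_D"
  shows "n + 1 \<in> cuts ty n m P T \<longleftrightarrow> D (n + 1) = 0 \<or> D (n + 1) \<le> 1 \<and> (n + 2 \<in> P \<or> n + 1 \<in> T)"
proof -
  have "\<not> exceptional_cut2 n P T (n + 1)"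
    using exceptional_cut2_iff[OF assms] assms by auto
  then show ?thesis
    using exceptional_cut1_iff[OF assms, of "n + 1"] apparent_cut_iff[of "n + 1"] assms
    by (auto simp: cuts_def)
qed

lemma zero_column_iff:
  assumes "1 \<le> c" "c \<le> N"
  shows "zero_column N m P T c \<longleftrightarrow> c \<notin> P \<and> c \<notin> T \<and> D (c - 1) = 0 \<and> D c = 0"
proof -
  have cm: "count_upto P (c - 1) \<le> m"
    using count_upto_mono[of "c - 1" N P] count_upto_full[OF P_sub] card_P assms by simp
  have "entry N P j < c \<and> c < entry N T (j + 1) \<longleftrightarrow> j \<le> count_upto P (c - 1) \<and> \<not> j + 1 \<le> count_upto T c"
    if "j \<in> {0..m}" for j
  proof -
    have "entry N P j < c \<longleftrightarrow> entry N P j \<le> c - 1" using assms by auto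
    then show ?thesis
      using entry_le_iff[OF P_sub, of j "c - 1"] entry_le_iff[OF T_sub, of "j + 1" c]
        card_P card_T that assms by auto
  qed
  then have "zero_column N m P T c \<longleftrightarrow> (\<exists>j\<in>{0..m}. j \<le> count_upto P (c - 1) \<and> \<not> j + 1 \<le> count_upto T c)"
    unfolding zero_column_def by blast
  also have "\<dots> \<longleftrightarrow> count_upto T c \<le> count_upto P (c - 1)"
    using cm by (auto intro!: bexI[of _ "count_upto P (c - 1)"])
  also have "\<dots> \<longleftrightarrow> c \<notin> P \<and> c \<notin> T \<and> D (c - 1) = 0 \<and> D c = 0"
  proof -
    have "0 \<le> D c" "0 \<le> D (c - 1)" using D_nonneg[of c] D_nonneg[of "c - 1"] assms by auto
    then show ?thesis
      using count_upto_step[OF assms(1), of P] count_upto_step[OF assms(1), of T]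
      by (cases "c \<in> P"; cases "c \<in> T") (auto simp: excess_def)
  qed
  finally show ?thesis .
qed

text \<open>A lone star in the mirror column asks for cuts at N + 1 - c and N - c; by the symmetry
  of cuts these are conditions at c - 1 and c. For the central columns of type D one of these points
  would be n + 1.\<close>

lemma linear_eqs_iff:
  assumes "1 \<le> c" "c \<le> N" "ty = Type_D \<Longrightarrow> c \<noteq> n + 1 \<and> c \<noteq> n + 2"
  shows "c \<in> linear_eqs ty n m P T \<longleftrightarrow>
    N + 1 - c \<in> T \<and> K (c - 1) \<or> N + 1 - c \<in> P \<and> K c \<or>
    c \<notin> P \<and> c \<notin> T \<and> D (c - 1) = 0 \<and> D c = 0"
proof -
  have 1: "N + 1 - c = N - (c - 1)" "N + 1 - c - 1 = N - c" using assms by auto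
  have "regular_point ty n (N - (c - 1))" "regular_point ty n (N - c)"
    using assms N_D by (auto simp: regular_point_def)
  then have "N + 1 - c \<in> cuts ty n m P T \<longleftrightarrow> K (c - 1)" "N + 1 - c - 1 \<in> cuts ty n m P T \<longleftrightarrow> K c"
    unfolding 1 using cuts_iff K_sym[of c] K_sym[of "c - 1"] assms by auto
  then show ?thesis
    using assms zero_column_iff[OF assms(1,2)]
    unfolding linear_eqs_def Let_def lone_star_def by auto
qed

lemma linear_eqs_center:
  assumes ty: "ty = Type_D"
  shows "n + 1 \<in> linear_eqs ty n m P T \<longleftrightarrow> K n \<and> (n + 2 \<in> T \<union> P \<or> n + 1 \<notin> clP \<union> clT)"
    and "n + 2 \<in> linear_eqs ty n m P T \<longleftrightarrow> K n \<and> (n + 1 \<in> T \<union> P \<or> n + 1 \<notin> clP \<union> clT)"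
proof -
  have N: "N = 2 * n + 2" using ty by simp
  have s1: "D (n + 1) = D n + of_bool (n + 1 \<in> T) - of_bool (n + 1 \<in> P)"
    using D_step[of "n + 1"] by simp
  have s2: "D (n + 2) = D (n + 1) + of_bool (n + 2 \<in> T) - of_bool (n + 2 \<in> P)"
    using D_step[of "n + 2"] by simp
  have excl: "\<not> (n + 1 \<in> P \<and> n + 2 \<in> P)" "\<not> (n + 1 \<in> T \<and> n + 2 \<in> T)"
    using P_bar[of "n + 1"] T_bar[of "n + 1"] N by auto
  have cl: "n + 1 \<in> clP \<longleftrightarrow> n + 1 \<in> P \<or> n + 2 \<in> P" "n + 1 \<in> clT \<longleftrightarrow> n + 1 \<in> T \<or> n + 2 \<in> T"
    unfolding in_clP in_clT using N by auto
  have fl: "full n \<longleftrightarrow> odd (D (n + 1)) \<and> n + 1 \<in> clP \<and> n + 1 \<in> clT"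
    using ty N by (auto simp: parity_defect_def atLeastAtMost_singleton')
  have fl2: "full (n + 2) \<longleftrightarrow> full n" using full_sym[of n] N by simp
  have Kn: "K n \<longleftrightarrow> R n = 0 \<or> R (n + 2) = 0" using N by (simp add: symmetric_cut_def)
  have pos: "0 \<le> R n" "0 \<le> R (n + 2)" "0 \<le> D n" "0 \<le> D (n + 1)" "0 \<le> D (n + 2)"
    using R_nonneg[of n] R_nonneg[of "n + 2"] D_nonneg[of n] D_nonneg[of "n + 1"]
      D_nonneg[of "n + 2"] ty N by (auto simp: regular_point_def)
  have c2: "n + 2 \<in> cuts ty n m P T \<longleftrightarrow> K n" "n \<in> cuts ty n m P T \<longleftrightarrow> K n"
    using cuts_iff[of "n + 2"] cuts_iff[of n] K_sym[of n] ty N by (auto simp: regular_point_def)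
  have z1: "zero_column N m P T (n + 1) \<longleftrightarrow> n + 1 \<notin> P \<and> n + 1 \<notin> T \<and> D n = 0 \<and> D (n + 1) = 0"
    and z2: "zero_column N m P T (n + 2) \<longleftrightarrow> n + 2 \<notin> P \<and> n + 2 \<notin> T \<and> D (n + 1) = 0 \<and> D (n + 2) = 0"
    using zero_column_iff[of "n + 1"] zero_column_iff[of "n + 2"] N by auto
  have f1: "full n \<Longrightarrow> 1 \<le> D n" "full n \<Longrightarrow> 1 \<le> D (n + 2)"
    using full_pos[of n] full_pos[of "n + 2"] fl2 N by auto
  have Kn': "K n \<longleftrightarrow> D n - of_bool (full n) = 0 \<or> D (n + 2) - of_bool (full n) = 0"
    using Kn fl2 by (simp add: reduced_excess_def)
  have b: "N + 1 - (n + 1) = n + 2" "N + 1 - (n + 2) = n + 1" "n + 2 - 1 = n + 1" "n + 1 - 1 = n"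
    "n + 1 \<in> {1..N}" "n + 2 \<in> {1..N}"
    using N by auto
  note aux = center_arith[OF s1 s2 excl fl[unfolded cl] pos(3-5) f1 Kn']
  have "n + 1 \<in> linear_eqs ty n m P T \<longleftrightarrow>
      zero_column N m P T (n + 1) \<or> n + 2 \<in> T \<and> K n \<or> n + 2 \<in> P \<and> n + 1 \<in> cuts ty n m P T"
    unfolding linear_eqs_def Let_def lone_star_def mem_Collect_eq b c2 using b(5,6) by blast
  then show "n + 1 \<in> linear_eqs ty n m P T \<longleftrightarrow> K n \<and> (n + 2 \<in> T \<union> P \<or> n + 1 \<notin> clP \<union> clT)"
    unfolding z1 center_cut_iff[OF ty] Un_iff cl by (rule trans[OF _ aux(1)])
  have "n + 2 \<in> linear_eqs ty n m P T \<longleftrightarrow>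
      zero_column N m P T (n + 2) \<or> n + 1 \<in> T \<and> n + 1 \<in> cuts ty n m P T \<or> n + 1 \<in> P \<and> K n"
    unfolding linear_eqs_def Let_def lone_star_def mem_Collect_eq b c2 using b(5,6) by blast
  then show "n + 2 \<in> linear_eqs ty n m P T \<longleftrightarrow> K n \<and> (n + 1 \<in> T \<union> P \<or> n + 1 \<notin> clP \<union> clT)"
    unfolding z2 center_cut_iff[OF ty] Un_iff cl by (rule trans[OF _ aux(2)])
qed

end

section \<open>Lowering a Schubert symbol\<close>

text \<open>The regular points on either side of column b; in type D both central columns lie
  between n and n + 2.\<close>

definition point_before :: "grass_type \<Rightarrow> nat \<Rightarrow> nat \<Rightarrow> nat" where
  "point_before ty n b = (if ty = Type_D \<and> b = n + 2 then n else b - 1)"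

definition point_after :: "grass_type \<Rightarrow> nat \<Rightarrow> nat \<Rightarrow> nat" where
  "point_after ty n b = (if ty = Type_D \<and> b = n + 1 then n + 2 else b)"

definition exchange :: "nat \<Rightarrow> nat \<Rightarrow> nat set \<Rightarrow> nat set" where
  "exchange a b P = insert a (P - {b})"

text \<open>A reflection exchanges x with b and, at the same time, their mirrors. For x = N + 1 - b
  the two exchanges are one.\<close>

definition reflect :: "nat \<Rightarrow> nat \<Rightarrow> nat \<Rightarrow> nat set \<Rightarrow> nat set" where
  "reflect N x b P = insert x (insert (N + 1 - b) (P - {b, N + 1 - x}))"

text \<open>The condition on a keeps out the self-dual middle column of type B. In type D a single
  entry jumping to its own mirror is not a reflection of the Weyl group.\<close>

definition lowers :: "grass_type \<Rightarrow> nat \<Rightarrow> nat \<Rightarrow> nat set \<Rightarrow> nat set \<Rightarrow> bool" where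
  "lowers ty n m P Q \<longleftrightarrow> (let N = ambient_dim ty n in
     P \<in> schubert_symbols N m \<and> Q \<in> schubert_symbols N m \<and>
     ((\<exists>a b. 1 \<le> a \<and> a < b \<and> b \<in> P \<and> a \<notin> sym_closure N P \<and> a \<noteq> N + 1 - a \<and> Q = exchange a b P) \<or>
     (\<exists>x b. 1 \<le> x \<and> x < b \<and> b \<in> P \<and> x \<notin> P \<and> N + 1 - x \<in> P \<and> (x = N + 1 - b \<longrightarrow> ty \<noteq> Type_D) \<and>
        Q = reflect N x b P)))"

context ordered_pair
begin

text \<open>Where [T] is contained in [P], each column either keeps the difference or lowers it by
  one.\<close>

lemma DE_mono:
  assumes "\<And>x. u < x \<Longrightarrow> x \<le> v \<Longrightarrow> x \<in> clP \<or> x \<notin> clT" "u \<le> v" "v \<le> N"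
  shows "D v - D (N - v) \<le> D u - D (N - u)"
  using assms(2,1,3)
proof (induction v rule: dec_induct)
  case (step i)
  have "of_bool (Suc i \<in> clT) \<le> (of_bool (Suc i \<in> clP) :: int)" using step.prems(1)[of "Suc i"] step.hyps by auto
  then show ?case using DE_step[of "Suc i"] step by auto
qed simp

lemma DE_strict:
  assumes "\<And>x. u < x \<Longrightarrow> x \<le> v \<Longrightarrow> x \<in> clP \<or> x \<notin> clT" "u < x" "x \<le> v" "v \<le> N"
    and "x \<in> clP" "x \<notin> clT"
  shows "D v - D (N - v) < D u - D (N - u)"
proof -
  have "D v - D (N - v) \<le> D x - D (N - x)" by (rule DE_mono) (use assms in auto)
  moreover have "D (x - 1) - D (N - (x - 1)) \<le> D u - D (N - u)" by (rule DE_mono) (use assms in auto)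
  ultimately show ?thesis using DE_step[of x] assms by auto
qed

end

text \<open>\<open>A c\<close> means that the excess may be lowered by one at \<open>c\<close>. This is used twice: with \<open>A c\<close> saying
  \<open>D c \<ge> 1\<close>, which keeps the Bruhat order, and with \<open>A c\<close> saying in addition that no new cut arises.\<close>

locale slack_pair = ordered_pair +
  fixes A :: "nat \<Rightarrow> bool" and r :: int
  assumes A_pos: "regular_point ty n c \<Longrightarrow> A c \<Longrightarrow> 1 \<le> D c"
    and A_full: "c \<le> N \<Longrightarrow> full c \<Longrightarrow> A c"
    and not_A: "regular_point ty n c \<Longrightarrow> \<not> A c \<Longrightarrow> D c \<le> D (N - c)"
    and A_center: "ty = Type_D \<Longrightarrow> A (n + 1)"
    and A_mid: "ty = Type_B \<Longrightarrow> A (n + 1) \<Longrightarrow> A n"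
    and A_back: "c \<in> P \<Longrightarrow> A (point_after ty n c) \<Longrightarrow> A (point_before ty n c)"
    and r_le: "r \<le> 1"
begin

text \<open>The threshold r is 0 when only the order matters and 1 when cuts are to be kept; in the
  second case the point after b must have positive excess.\<close>

definition bad :: "nat \<Rightarrow> bool" where
  "bad b \<longleftrightarrow> b \<in> P \<and> A (point_before ty n b) \<and> r \<le> D (point_after ty n b)"

text \<open>The mirrors of the columns strictly between a and b lie in P, so a zero column created
  there is already recorded by a lone star. In type D the two final clauses keep the move on one
  side of the centre and, when a is a central column met by [T], choose it so that the new excess at
  n + 1 is even, which excludes a new defect.\<close>

definition exchangeable :: "nat \<Rightarrow> nat \<Rightarrow> bool" where
  "exchangeable a b \<longleftrightarrow> 1 \<le> a \<and> a < b \<and> b \<in> P \<and> a \<notin> clP \<and> \<not> (ty = Type_B \<and> a = n + 1) \<and>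
     r \<le> D (point_after ty n b) \<and>
     (\<forall>c. a \<le> c \<and> c < b \<and> regular_point ty n c \<longrightarrow> A c) \<and>
     (\<forall>c. a < c \<and> c < b \<and> \<not> central_column ty n c \<longrightarrow> N + 1 - c \<in> P) \<and>
     (ty = Type_D \<longrightarrow> b \<le> n + 2 \<and> a \<le> n \<or> n + 3 \<le> b \<and> n + 1 \<le> a \<and> (\<forall>c\<le>N. \<not> full c)) \<and>
     (ty = Type_D \<and> n + 1 \<le> a \<and> a \<le> n + 2 \<and> n + 1 \<in> clT \<longrightarrow> (a = n + 1 \<longleftrightarrow> odd (D (n + 1))))"

text \<open>The comparisons with N - x and N - (x - 1) transfer room at x and x - 1 to the mirror
  points, since the reflection lowers D there too. The jump from n + 2 to n passes over a central
  column.\<close>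

definition reflectable :: "nat \<Rightarrow> nat \<Rightarrow> bool" where
  "reflectable x b \<longleftrightarrow> 1 \<le> x \<and> x < b \<and> b \<in> P \<and> x \<notin> P \<and> N + 1 - x \<in> P \<and> \<not> central_column ty n x \<and>
     (b = x + 1 \<or> x = n \<and> b = n + 2 \<and> ty \<noteq> Type_C) \<and>
     A x \<and> D x \<le> D (N - x) \<and> D (x - 1) \<le> D (N - (x - 1)) \<and>
     \<not> full x \<and> \<not> full (x - 1) \<and> \<not> full (point_after ty n b) \<and> r \<le> D (point_after ty n b)"

lemma bad_D:
  assumes "bad b"
  shows "b \<in> P" "A (point_before ty n b)" "r \<le> D (point_after ty n b)" "1 \<le> b" "b \<le> N" "point_before ty n b < b"
    "regular_point ty n (point_before ty n b)" "regular_point ty n (point_after ty n b)"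
proof -
  show "b \<in> P" "A (point_before ty n b)" "r \<le> D (point_after ty n b)" using assms by (auto simp: bad_def)
  show "1 \<le> b" "b \<le> N" using \<open>b \<in> P\<close> P_sub by auto
  then show "point_before ty n b < b"  "regular_point ty n (point_before ty n b)" "regular_point ty n (point_after ty n b)"
    by (auto simp: point_before_def regular_point_def point_after_def)
qed

section \<open>Finding a move\<close>

lemma not_A_0: "\<not> A 0"
  using A_pos[of 0] by (auto simp: regular_point_def)

text \<open>Let \<open>b\<close> be the first bad element and let \<open>]w, p]\<close> be the maximal interval of points before \<open>b\<close> where
  \<open>A\<close> holds. By minimality of \<open>b\<close>, \<open>P\<close> has no element in this interval. If some column of the interval is
  not in \<open>[P]\<close>, then \<open>b\<close> can be moved to the last one. Otherwise \<open>D c - D (N - c)\<close> decreases weakly along the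
  interval and is nonpositive at its left end, so that the reflection at \<open>b\<close> and its left neighbour
  leaves both \<open>D\<close> and its mirror image large enough.\<close>

lemma move_exists:
  assumes "bad b0"
  shows "(\<exists>a b. exchangeable a b) \<or> (\<exists>x b. reflectable x b)"
proof -
  define b where "b = (LEAST b. bad b)"
  have b: "bad b" unfolding b_def using assms by (rule LeastI)
  have b_min: "\<not> bad c" if "c < b" for c using that unfolding b_def by (rule not_less_Least)
  define p where "p = point_before ty n b"
  note bD = bad_D[OF b, folded p_def]
  have "p > 0" using bD(2) not_A_0 by (cases "p = 0") auto
  define w where "w = Max {c. c < p \<and> \<not> A c}"
  have "w \<in> {c. c < p \<and> \<not> A c}" unfolding w_def
    by (rule Max_in) (use \<open>p > 0\<close> not_A_0 in auto)
  then have w: "w < p" "\<not> A w" by auto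
  have wA: "A c" if "w < c" "c \<le> p" for c
  proof (rule ccontr)
    assume "\<not> A c"
    then have "c < p" using that bD(2) by (cases "c = p") auto
    then have "c \<le> w" unfolding w_def using \<open>\<not> A c\<close> by (intro Max_ge) auto
    then show False using that by simp
  qed
  have wN: "w \<le> N" "p < N" using w bD by auto
  have w_pt: "regular_point ty n w" using w A_center wN by (auto simp: regular_point_def)
  have w_full: "\<not> full w" using A_full w wN by blast
  have w_le: "D w \<le> D (N - w)" using not_A w w_pt by blast
  have no_P: "c \<notin> P" if "w < point_after ty n c" "point_after ty n c \<le> p" "c < b" for c
  proof
    assume c: "c \<in> P"
    have "A (point_after ty n c)" using wA that by blast
    moreover from this have "A (point_before ty n c)" using A_back c by blast
    moreover have "regular_point ty n (point_after ty n c)" using c P_sub by (auto simp: point_after_def regular_point_def)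
    ultimately have "bad c" using A_pos[of "point_after ty n c"] r_le c unfolding bad_def by auto
    then show False using b_min that by blast
  qed
  have p_center: "ty = Type_D \<Longrightarrow> p \<noteq> n + 1" and w_center: "ty = Type_D \<Longrightarrow> w \<noteq> n + 1"
    using bD(7) w_pt by (auto simp: regular_point_def)
  have p_b: "p = b - 1 \<or> ty = Type_D \<and> b = n + 2 \<and> p = n" by (auto simp: p_def point_before_def)
  \<comment> \<open>Both central columns have n + 2 as the point after them, and n + 2 lies in the
    slack interval, so neither column can be in P.\<close>
  have center_notin: "n + 1 \<notin> clP" if "ty = Type_D" "n + 2 \<le> p" "w \<le> n"
  proof
    assume "n + 1 \<in> clP"
    then have "n + 1 \<in> P \<or> n + 2 \<in> P" unfolding in_clP using that by auto
    then show False using no_P[of "n + 1"] no_P[of "n + 2"] that bD(6) by (auto simp: point_after_def)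
  qed
  show ?thesis
  proof (cases "\<exists>x. w < x \<and> x \<le> p \<and> x \<notin> clP \<and> \<not> (ty = Type_B \<and> x = n + 1)")
    case True
    define S where "S = {x. w < x \<and> x \<le> p \<and> x \<notin> clP \<and> \<not> (ty = Type_B \<and> x = n + 1)}"
    define a where "a = Max S"
    have finS: "finite S" unfolding S_def by (rule finite_subset[of _ "{..p}"]) auto
    have "a \<in> S" unfolding a_def by (rule Max_in[OF finS]) (use True S_def in blast)
    then have a: "w < a" "a \<le> p" "a \<notin> clP" "\<not> (ty = Type_B \<and> a = n + 1)" by (auto simp: S_def)
    have a_max: "c \<in> clP \<or> ty = Type_B \<and> c = n + 1" if "a < c" "c \<le> p" for c
    proof (rule ccontr)
      assume "\<not> ?thesis"
      then have "c \<in> S" using that a by (auto simp: S_def)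
      then have "c \<le> a" unfolding a_def using finS by simp
      then show False using that by simp
    qed
    have A_reg: "\<forall>c. a \<le> c \<and> c < b \<and> regular_point ty n c \<longrightarrow> A c"
      using wA a p_b by (auto simp: regular_point_def)
    have cols: "\<forall>c. a < c \<and> c < b \<and> \<not> central_column ty n c \<longrightarrow> N + 1 - c \<in> P"
    proof (intro allI impI)
      fix c assume c: "a < c \<and> c < b \<and> \<not> central_column ty n c"
      have cp: "c \<le> p" using c p_b by (auto simp: central_column_def)
      have "point_after ty n c = c" using c by (auto simp: point_after_def central_column_def)
      then have "c \<notin> P" using no_P[of c] c cp a by auto
      then show "N + 1 - c \<in> P" using a_max[of c] c cp by (auto simp: central_column_def in_clP)
    qed
    have D_side: "b \<le> n + 2 \<and> a \<le> n \<or> n + 3 \<le> b \<and> n + 1 \<le> a \<and> (\<forall>c\<le>N. \<not> full c)" if ty: "ty = Type_D"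
    proof (cases "b \<le> n + 2")
      case True
      then have "p \<le> n" using ty by (auto simp: p_def point_before_def)
      then show ?thesis using True a by auto
    next
      case False
      then have p: "p = b - 1" "n + 2 \<le> p" using p_b by auto
      have "n + 1 \<le> a"
      proof (rule ccontr)
        assume "\<not> n + 1 \<le> a"
        then have "n + 1 \<in> clP" "w \<le> n" using a_max[of "n + 1"] p ty a by auto
        then show False using center_notin p ty by auto
      qed
      \<comment> \<open>A defect puts an element of P into the centre; the slack that a defect
        carries would make it bad although it precedes b.\<close>
      moreover have "\<not> full c" if "c \<le> N" for c
      proof
        assume "full c"
        then have f: "full n" "full (n + 2)" using full_center that by auto
        have "n + 1 \<in> clP" using f(1) ty by (auto simp: parity_defect_def)
        then obtain d where d: "d \<in> P" "d = n + 1 \<or> d = n + 2" unfolding in_clP using ty by auto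
        have "point_before ty n d = n" "point_after ty n d = n + 2" using d ty by (auto simp: point_before_def point_after_def)
        moreover have "A n" "1 \<le> D (n + 2)" using A_full[of n] full_pos[of "n + 2"] f ty by auto
        ultimately have "bad d" using d(1) r_le by (simp add: bad_def)
        then show False using b_min[of d] d False by auto
      qed
      ultimately show ?thesis using False by auto
    qed
    have a1: "1 \<le> a" "a < b" using a bD(6) by auto
    show ?thesis
    proof (cases "ty = Type_D \<and> n + 1 \<le> a \<and> a \<le> n + 2")
      case False
      have "exchangeable a b"
        unfolding exchangeable_def using a1 bD a A_reg cols D_side False by auto
      then show ?thesis by blast
    next
      case True
      \<comment> \<open>Both central columns are free; this choice makes the excess at n + 1 even
        after the move.\<close>
      define a' where "a' = (if odd (D (n + 1)) then n + 1 else n + 2)"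
      have b3: "n + 3 \<le> b" and nf: "\<forall>c\<le>N. \<not> full c" using D_side True by auto
      have wn: "w \<le> n" using True w_center a by auto
      have pn: "n + 2 \<le> p" using b3 p_b by auto
      have cn: "n + 1 \<notin> clP" "n + 2 \<notin> clP" using center_notin[OF _ pn wn] True unfolding in_clP by auto
      have "exchangeable a' b"
        unfolding exchangeable_def
      proof (intro conjI)
        show "1 \<le> a'" "a' < b" "b \<in> P" "a' \<notin> clP" "\<not> (ty = Type_B \<and> a' = n + 1)"
          "r \<le> D (point_after ty n b)"
          using b3 bD cn True by (auto simp: a'_def)
        show "\<forall>c. a' \<le> c \<and> c < b \<and> regular_point ty n c \<longrightarrow> A c"
        proof (intro allI impI)
          fix c assume c: "a' \<le> c \<and> c < b \<and> regular_point ty n c"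
          then have "n + 2 \<le> c" using True by (auto simp: a'_def regular_point_def split: if_splits)
          then show "A c" using wA[of c] wn c p_b b3 by auto
        qed
        show "\<forall>c. a' < c \<and> c < b \<and> \<not> central_column ty n c \<longrightarrow> N + 1 - c \<in> P"
        proof (intro allI impI)
          fix c assume c: "a' < c \<and> c < b \<and> \<not> central_column ty n c"
          then have "a < c" using True by (auto simp: a'_def central_column_def split: if_splits)
          then show "N + 1 - c \<in> P" using cols c by blast
        qed
        show "ty = Type_D \<longrightarrow> b \<le> n + 2 \<and> a' \<le> n \<or> n + 3 \<le> b \<and> n + 1 \<le> a' \<and> (\<forall>c\<le>N. \<not> full c)"
          using b3 nf by (auto simp: a'_def)
        show "ty = Type_D \<and> n + 1 \<le> a' \<and> a' \<le> n + 2 \<and> n + 1 \<in> clT \<longrightarrow> (a' = n + 1) = odd (D (n + 1))"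
          by (auto simp: a'_def)
      qed
      then show ?thesis by blast
    qed
  next
    case False
    then have reg: "c \<in> clP \<or> ty = Type_B \<and> c = n + 1" if "w < c" "c \<le> p" for c using that by blast
    have reg': "c \<in> clP \<or> c \<notin> clT" if "w < c" "c \<le> p" for c using reg[OF that] mid_notin by auto
    have le: "D c \<le> D (N - c)" if "w \<le> c" "c \<le> p" for c
    proof -
      have "D c - D (N - c) \<le> D w - D (N - w)"
        by (rule DE_mono) (use reg' that wN in auto)
      then show ?thesis using w_le by simp
    qed
    \<comment> \<open>At a defect D c = D (N - c), so the decreasing difference, nonpositive at w,
      is constant from w to c. Then [T] contains the columns in between as well, and the defect
      extends to w, although points without slack have no defect.\<close>
    have nfull: "\<not> full c" if c: "w \<le> c" "c \<le> p" for c
    proof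
      assume f: "full c"
      then have ty: "ty = Type_D" and cn: "c \<noteq> n + 1" by (auto simp: parity_defect_def)
      have cN: "c \<le> N" using c wN by auto
      have in_both: "x \<in> clP \<and> x \<in> clT" if x: "w < x" "x \<le> c" for x
      proof -
        have "x \<in> clP" using reg[of x] x c ty by auto
        moreover have "x \<in> clT"
        proof (rule ccontr)
          assume "x \<notin> clT"
          then have "D c - D (N - c) < D w - D (N - w)"
            by (intro DE_strict[of w c x]) (use reg' x c cN \<open>x \<in> clP\<close> in auto)
          then show False using full_eq[OF f cN] w_le by simp
        qed
        ultimately show ?thesis by simp
      qed
      have "full w"
      proof (cases "w \<le> n")
        case True
        have "x \<in> clP \<inter> clT" if x: "x \<in> {w + 1..n + 1}" for x
        proof (cases "x \<le> c")
          case True then show ?thesis using in_both x by auto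
        next
          case False
          then have "x \<in> {min c (2 * n + 2 - c) + 1..n + 1}" using x by auto
          then show ?thesis using f ty by (auto simp: parity_defect_def)
        qed
        moreover have "min w (2 * n + 2 - w) = w" using True by auto
        ultimately show ?thesis using f True ty unfolding parity_defect_def by auto
      next
        case False
        then show ?thesis using full_mono[OF f ty, of w] w_center ty c cN by auto
      qed
      then show False using w_full by simp
    qed
    \<comment> \<open>In type B the column n + 1 belongs to no symbol, so the usable left neighbour
      of n + 2 is n.\<close>
    define x where "x = (if ty = Type_B \<and> p = n + 1 then n else p)"
    have Ax: "A x" using A_mid bD(2) by (auto simp: x_def)
    have xw: "w < x"
    proof -
      have "w \<noteq> n" if "ty = Type_B" "p = n + 1" using A_mid bD(2) w that by auto
      then show ?thesis using w by (auto simp: x_def)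
    qed
    have pD: "p \<noteq> n + 2" if "ty = Type_D"
    proof
      assume p: "p = n + 2"
      then have "w \<le> n" using w w_center that by auto
      moreover have "n + 1 \<in> clP" using reg[of "n + 1"] \<open>w \<le> n\<close> p that by auto
      ultimately show False using center_notin that p by auto
    qed
    have x_mid: "\<not> central_column ty n x" using pD p_center by (auto simp: x_def central_column_def)
    have xp: "x \<le> p" by (auto simp: x_def)
    have xb: "x < b" using xp bD(6) by simp
    have nx: "point_after ty n x = x" using x_mid by (auto simp: point_after_def central_column_def)
    have "x \<notin> P" using no_P[of x] nx xw xp xb by auto
    have "x \<in> clP" using reg[of x] xw xp x_mid by (auto simp: central_column_def)
    then have "N + 1 - x \<in> P" using \<open>x \<notin> P\<close> by (auto simp: in_clP)
    have adj: "b = x + 1 \<or> x = n \<and> b = n + 2 \<and> ty \<noteq> Type_C"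
      using p_b bD(4) by (auto simp: x_def)
    have "\<not> full (point_after ty n b)"
    proof
      assume f: "full (point_after ty n b)"
      then have ty: "ty = Type_D" by (auto simp: parity_defect_def)
      have xp: "x = p" using ty by (simp add: x_def)
      have N: "N = 2 * n + 2" using ty by simp
      consider "b \<le> n" | "b = n + 1 \<or> b = n + 2" | "b \<ge> n + 3" by linarith
      then show False
      proof cases
        case 1
        have q: "point_after ty n b = b" "p = b - 1" using 1 p_b by (auto simp: point_after_def)
        \<comment> \<open>Equality at b and D (b - 1) \<le> D (N - (b - 1)) force b into [T]; the
          defect would then already be present at b - 1.\<close>
        have "D b = D (N - b)" using full_eq[of b] f q bD by simp
        moreover have "b \<in> clP" using bD by (simp add: in_clP)
        ultimately have bT: "b \<in> clT"
          using DE_step[of b] le[of p] w q bD by (cases "b \<in> clT") auto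
        have "{min (b - 1) (2 * n + 2 - (b - 1)) + 1..n + 1} = insert b {min b (2 * n + 2 - b) + 1..n + 1}"
          using 1 bD by auto
        then have "full (b - 1)"
          using f q bT \<open>b \<in> clP\<close> 1 ty N unfolding parity_defect_def by auto
        then show False using nfull[of p] w q by auto
      next
        case 2
        then have "point_after ty n b = n + 2" "p = n" using ty by (auto simp: point_after_def p_def point_before_def)
        then show False using full_mono[OF f ty, of n] nfull[of p] w N by auto
      next
        case 3
        then have "point_after ty n b = b" "p = b - 1" using p_b by (auto simp: point_after_def)
        then show False using full_mono[OF f ty, of p] nfull[of p] w 3 bD N by auto
      qed
    qed
    moreover have "D x \<le> D (N - x)" "\<not> full x" "D (x - 1) \<le> D (N - (x - 1))" "\<not> full (x - 1)"
      using le[of x] nfull[of x] le[of "x - 1"] nfull[of "x - 1"] xw xp by auto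
    ultimately have "reflectable x b"
      unfolding reflectable_def using xw xb bD Ax adj x_mid \<open>x \<notin> P\<close> \<open>N + 1 - x \<in> P\<close> by auto
    then show ?thesis by blast
  qed
qed

section \<open>Effect of an exchange on excess, closure and parity defects\<close>

lemma exch_basic:
  assumes "exchangeable a b"
  shows "1 \<le> a" "a < b" "b \<in> P" "b \<le> N" "a \<notin> clP" "a \<notin> P" "N + 1 - a \<notin> P" "N + 1 - b \<notin> P"
    "a \<noteq> N + 1 - b" "a \<noteq> N + 1 - a" "b \<noteq> N + 1 - b"
    "excess (exchange a b P) T c = D c - of_bool (a \<le> c \<and> c < b)"
    "c \<in> exchange a b P \<longleftrightarrow> c = a \<or> c \<in> P \<and> c \<noteq> b"
proof -
  show ab: "1 \<le> a" "a < b" "b \<in> P" "a \<notin> clP" using assms by (auto simp: exchangeable_def)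
  show "b \<le> N" using ab P_sub by auto
  show "a \<notin> P" "N + 1 - a \<notin> P" using ab \<open>b \<le> N\<close> by (auto simp: in_clP)
  show "N + 1 - b \<notin> P" "b \<noteq> N + 1 - b" using P_bar[of b] ab by auto
  show "a \<noteq> N + 1 - b" using ab \<open>b \<le> N\<close> by (auto simp: in_clP)
  have "\<not> (ty = Type_B \<and> a = n + 1)" using assms by (auto simp: exchangeable_def)
  then have "N + 1 \<noteq> 2 * a" by (cases ty; simp; presburger)
  then show "a \<noteq> N + 1 - a" using ab by linarith
  show "excess (exchange a b P) T c = D c - of_bool (a \<le> c \<and> c < b)"
    unfolding exchange_def by (rule excess_exchange) (use finite_P ab \<open>a \<notin> P\<close> in auto)
  show "c \<in> exchange a b P \<longleftrightarrow> c = a \<or> c \<in> P \<and> c \<noteq> b" using ab by (auto simp: exchange_def)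
qed

lemma exch_symbol:
  assumes "exchangeable a b"
  shows "exchange a b P \<in> schubert_symbols N m"
proof -
  note e = exch_basic[OF assms]
  have "exchange a b P \<subseteq> {1..N}" using P_sub e by (auto simp: exchange_def)
  moreover have "card (exchange a b P) = m"
    using card_P finite_P e(3,6) card_Suc_Diff1[of P b] by (simp add: exchange_def)
  moreover have "c + d \<noteq> N + 1" if "c \<in> exchange a b P" "d \<in> exchange a b P" for c d
  proof
    assume "c + d = N + 1"
    then have "d = N + 1 - c" "c = N + 1 - d" by auto
    then show False using that e(7,10) P_bar[of c] unfolding e(13) by metis
  qed
  ultimately show ?thesis unfolding schubert_symbols_def by blast
qed

lemma exch_lowers: "exchangeable a b \<Longrightarrow> lowers ty n m P (exchange a b P)"
  unfolding lowers_def Let_def using exch_basic[of a b] exch_symbol[of a b] P_symbol by blast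

lemma exch_sum: "exchangeable a b \<Longrightarrow> \<Sum>(exchange a b P) < \<Sum>P"
  unfolding exchange_def by (rule sum_exchange_less) (use finite_P exch_basic[of a b] in auto)

lemma exch_A:
  "exchangeable a b \<Longrightarrow> a \<le> c \<Longrightarrow> c < b \<Longrightarrow> regular_point ty n c \<Longrightarrow> A c"
  "exchangeable a b \<Longrightarrow> a \<le> c \<Longrightarrow> c < b \<Longrightarrow> regular_point ty n c \<Longrightarrow> 1 \<le> D c"
  using A_pos by (auto simp: exchangeable_def)

lemma exch_closure:
  assumes "exchangeable a b"
  shows "c \<in> sym_closure N (exchange a b P) \<longleftrightarrow>
    c = a \<or> c = N + 1 - a \<or> c \<in> clP \<and> c \<noteq> b \<and> c \<noteq> N + 1 - b"
proof (cases "1 \<le> c \<and> c \<le> N")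
  case True
  have a: "1 \<le> a" "a \<le> N" and b: "1 \<le> b" "b \<le> N" using exch_basic(1-4)[OF assms] by auto
  have "N + 1 - c = a \<longleftrightarrow> c = N + 1 - a" "N + 1 - c \<noteq> b \<longleftrightarrow> c \<noteq> N + 1 - b"
    using True a b by auto
  moreover have "c \<in> sym_closure N (exchange a b P) \<longleftrightarrow> c \<in> exchange a b P \<or> N + 1 - c \<in> exchange a b P"
    using True by (auto simp: sym_closure_def)
  moreover have "c \<in> clP \<longleftrightarrow> c \<in> P \<or> N + 1 - c \<in> P"
    using True by (auto simp: in_clP)
  moreover have "c = N + 1 - b \<Longrightarrow> c \<notin> P" "N + 1 - c = N + 1 - b \<Longrightarrow> c = b"
    using exch_basic(8)[OF assms] True b by auto
  moreover have "c = b \<Longrightarrow> N + 1 - c \<notin> P" using exch_basic(8)[OF assms] by auto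
  ultimately show ?thesis unfolding exch_basic(13)[OF assms] by blast
next
  case False
  have "c \<notin> exchange a b P" using False P_sub exch_basic(1-4,13)[OF assms] by auto
  then show ?thesis
    using False P_sub exch_basic(1-4)[OF assms] by (auto simp: sym_closure_def)
qed

text \<open>If b \<le> n, column b leaves the closure, so a defect must start beyond it. A central b
  takes n + 1 out of the closure. For a move right of the centre, a defect of the new symbol would
  give an old one at c or at the mirror of a, and there was none. A move into the centre leaves even
  excess at n + 1 if [T] meets the centre.\<close>

lemma exch_full:
  assumes ex: "exchangeable a b" and c: "c \<le> N"
    and f: "parity_defect ty n (exchange a b P) T c"
  shows "full c \<and> \<not> (a \<le> c \<and> c < b) \<and> \<not> (a \<le> N - c \<and> N - c < b)"
proof -
  note e = exch_basic[OF ex]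
  have ty: "ty = Type_D" and cn: "c \<noteq> n + 1" and N: "N = 2 * n + 2"
    using f by (auto simp: parity_defect_def)
  define d where "d = min c (N - c)"
  have d: "d \<le> n" "c = d \<or> c = N - d" using cn N c by (auto simp: d_def)
  have odd: "odd (excess (exchange a b P) T (n + 1))"
    using f by (auto simp: parity_defect_def)
  have sub: "x \<in> sym_closure N (exchange a b P) \<and> x \<in> clT" if "d < x" "x \<le> n + 1" for x
  proof -
    have "x \<in> {min c (2 * n + 2 - c) + 1..n + 1}" using that N by (auto simp: d_def)
    then show ?thesis using f N unfolding parity_defect_def by auto
  qed
  have fullI: "full c" if "odd (D (n + 1))" "\<And>x. d < x \<Longrightarrow> x \<le> n + 1 \<Longrightarrow> x \<in> clP"
  proof -
    have "x \<in> clP \<inter> clT" if "x \<in> {min c (2 * n + 2 - c) + 1..n + 1}" for x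
      using sub[of x] \<open>\<And>x. d < x \<Longrightarrow> x \<le> n + 1 \<Longrightarrow> x \<in> clP\<close>[of x] that N by (auto simp: d_def)
    then show ?thesis using that(1) ty cn N unfolding parity_defect_def by auto
  qed
  have side: "b \<le> n + 2 \<and> a \<le> n \<or> n + 3 \<le> b \<and> n + 1 \<le> a \<and> (\<forall>c\<le>N. \<not> full c)"
    and par: "n + 1 \<le> a \<Longrightarrow> a \<le> n + 2 \<Longrightarrow> n + 1 \<in> clT \<Longrightarrow> (a = n + 1 \<longleftrightarrow> odd (D (n + 1)))"
    using ex[unfolded exchangeable_def] ty by auto
  consider "b \<le> n" "a \<le> n" | "b = n + 1 \<or> b = n + 2" "a \<le> n" | "n + 3 \<le> b" "n + 3 \<le> a" "\<forall>c\<le>N. \<not> full c"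
    | "n + 3 \<le> b" "a = n + 1 \<or> a = n + 2"
    using side by (cases "b \<le> n"; cases "a \<le> n + 2"; fastforce)
  then show ?thesis
  proof cases
    case 1
    have bnot: "b \<notin> sym_closure N (exchange a b P)" using exch_closure[OF ex] 1 e N by auto
    have db: "b \<le> d" using sub[of b] bnot 1 by linarith
    have "x \<in> clP" if "d < x" "x \<le> n + 1" for x
      using sub[OF that] exch_closure[OF ex, of x] db that 1 e N by auto
    moreover have "odd (D (n + 1))" using odd e(12)[of "n + 1"] 1 by auto
    ultimately have "full c" using fullI by blast
    then show ?thesis using db d N by auto
  next
    case 2
    have "n + 1 \<notin> sym_closure N (exchange a b P)" using exch_closure[OF ex, of "n + 1"] 2 N by auto
    then show ?thesis using sub[of "n + 1"] d by auto
  next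
    case 3
    have "odd (D (n + 1))" using odd e(12)[of "n + 1"] 3 by auto
    define a' where "a' = N + 1 - a"
    have a': "a' \<le> n" "1 \<le> a'" using 3 N e by (auto simp: a'_def)
    have cl: "x \<in> clP" if "d < x" "a' < x" "x \<le> n + 1" for x
      using sub[of x] exch_closure[OF ex, of x] that 3 N by (auto simp: a'_def)
    show ?thesis
    proof (cases "a' \<le> d")
      case True
      then have "full c" using fullI cl \<open>odd (D (n + 1))\<close> by auto
      then show ?thesis using 3 c by auto
    next
      case False
      have "{min a' (2 * n + 2 - a') + 1..n + 1} \<subseteq> clP \<inter> clT"
      proof
        fix x assume "x \<in> {min a' (2 * n + 2 - a') + 1..n + 1}"
        then have "a' < x" "x \<le> n + 1" using a' by auto
        then show "x \<in> clP \<inter> clT" using cl[of x] sub[of x] False by auto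
      qed
      then have "full a'" using ty N a' \<open>odd (D (n + 1))\<close> unfolding parity_defect_def by auto
      then show ?thesis using 3 a' N by auto
    qed
  next
    case 4
    have "n + 1 \<in> clT" using sub[of "n + 1"] d by auto
    then have "a = n + 1 \<longleftrightarrow> odd (D (n + 1))" using par 4 by auto
    then have "even (excess (exchange a b P) T (n + 1))" using e(12)[of "n + 1"] 4 by auto
    then show ?thesis using odd by simp
  qed
qed

text \<open>Column a is outside [P], so the columns required by the defect start beyond a, and then
  beyond b because neither c nor N - c is in the moved interval; nothing changes there.\<close>

lemma exch_full_conv:
  assumes ex: "exchangeable a b" and c: "c \<le> N" and f: "full c"
    and no: "\<not> (a \<le> c \<and> c < b)" "\<not> (a \<le> N - c \<and> N - c < b)"
  shows "parity_defect ty n (exchange a b P) T c"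
proof -
  note e = exch_basic[OF ex]
  have ty: "ty = Type_D" and cn: "c \<noteq> n + 1" and N: "N = 2 * n + 2"
    using f by (auto simp: parity_defect_def)
  have side: "b \<le> n + 2" "a \<le> n" using ex[unfolded exchangeable_def] ty f c by auto
  define d where "d = min c (N - c)"
  have d: "d \<le> n" "c = d \<or> c = N - d" using cn N c by (auto simp: d_def)
  have sub: "x \<in> clP \<and> x \<in> clT" if "d < x" "x \<le> n + 1" for x
  proof -
    have "x \<in> {min c (2 * n + 2 - c) + 1..n + 1}" using that N by (auto simp: d_def)
    then show ?thesis using f N unfolding parity_defect_def by auto
  qed
  have "a \<le> d" using sub[of a] e(5) side by (cases "d < a") auto
  then have bd: "b \<le> d" using no d N c by auto
  have "x \<in> sym_closure N (exchange a b P)" if "d < x" "x \<le> n + 1" for x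
    using sub[OF that] exch_closure[OF ex, of x] bd that d N by auto
  then have "{min c (2 * n + 2 - c) + 1..n + 1} \<subseteq> sym_closure N (exchange a b P) \<inter> clT"
    using sub N by (auto simp: d_def)
  moreover have "odd (excess (exchange a b P) T (n + 1))"
    using f e(12)[of "n + 1"] bd d by (auto simp: parity_defect_def)
  ultimately show ?thesis using ty cn N unfolding parity_defect_def by auto
qed

lemma exch_comb_le:
  assumes "exchangeable a b"
  shows "comb_le ty n T (exchange a b P)"
  unfolding comb_le_def
proof (intro allI impI)
  fix c assume c: "regular_point ty n c"
  then have cN: "c \<le> N" by (simp add: regular_point_def)
  show "0 \<le> reduced_excess ty n (exchange a b P) T c"
    using exch_full[OF assms cN] exch_A(2)[OF assms, of c] R_nonneg[OF c] D_nonneg[OF cN] c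
    by (auto simp: reduced_excess_def exch_basic(12)[OF assms])
qed

section \<open>Effect of a reflection on excess, closure and parity defects\<close>

lemma refl_basic:
  assumes "reflectable x b"
  shows "1 \<le> x" "x < b" "b \<in> P" "b \<le> N" "x \<notin> P" "N + 1 - x \<in> P" "N + 1 - b \<notin> P" "x \<le> N"
    "b \<noteq> N + 1 - b" "x = N + 1 - b \<Longrightarrow> ty \<noteq> Type_D" "x \<noteq> N + 1 - x"
    "regular_point ty n x" "1 \<le> D x" "1 \<le> D (N - x)" "regular_point ty n (N - x)"
    "c \<in> reflect N x b P \<longleftrightarrow> c = x \<or> c = N + 1 - b \<or> c \<in> P \<and> c \<noteq> b \<and> c \<noteq> N + 1 - x"
proof -
  show ab: "1 \<le> x" "x < b" "b \<in> P" "x \<notin> P" "N + 1 - x \<in> P" using assms by (auto simp: reflectable_def)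
  show "b \<le> N" using ab P_sub by auto
  then show "x \<le> N" using ab by auto
  show "N + 1 - b \<notin> P" "b \<noteq> N + 1 - b" using P_bar[of b] ab by auto
  show "x \<noteq> N + 1 - x" using ab by auto
  show "ty \<noteq> Type_D" if xb: "x = N + 1 - b"
  proof
    assume ty: "ty = Type_D"
    then have "x + b = 2 * n + 3" using xb \<open>b \<le> N\<close> by auto
    moreover have "b = x + 1 \<or> x = n \<and> b = n + 2" "x \<noteq> n + 1"
      using assms[unfolded reflectable_def] ty by (auto simp: central_column_def)
    ultimately show False by linarith
  qed
  show regular_point: "regular_point ty n x" using assms \<open>x \<le> N\<close> by (auto simp: reflectable_def central_column_def regular_point_def)
  then show D: "1 \<le> D x" using A_pos assms by (auto simp: reflectable_def)
  then show "1 \<le> D (N - x)" using assms by (auto simp: reflectable_def)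
  show "regular_point ty n (N - x)" using regular_point by (auto simp: regular_point_def)
  show "c \<in> reflect N x b P \<longleftrightarrow> c = x \<or> c = N + 1 - b \<or> c \<in> P \<and> c \<noteq> b \<and> c \<noteq> N + 1 - x"
    using ab \<open>N + 1 - b \<notin> P\<close> by (auto simp: reflect_def)
qed

lemma refl_as_exchange:
  assumes "reflectable x b"
  shows "x = N + 1 - b \<Longrightarrow> reflect N x b P = exchange x b P"
    and "x \<noteq> N + 1 - b \<Longrightarrow> reflect N x b P = exchange (N + 1 - b) (N + 1 - x) (exchange x b P)"
  using refl_basic[OF assms] by (auto simp: reflect_def exchange_def)

lemma refl_two:
  assumes "reflectable x b" "x \<noteq> N + 1 - b"
  shows "finite (exchange x b P)" "N + 1 - b \<notin> exchange x b P" "N + 1 - x \<in> exchange x b P"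
    "1 \<le> N + 1 - b" "N + 1 - b < N + 1 - x"
  using refl_basic[OF assms(1)] assms(2) finite_P by (auto simp: exchange_def)

lemma refl_exc_all:
  assumes "reflectable x b"
  shows "excess (reflect N x b P) T c = D c - of_bool (x \<le> c \<and> c < b) -
      of_bool (x \<noteq> N + 1 - b \<and> N + 1 - b \<le> c \<and> c < N + 1 - x)"
proof -
  note e = refl_basic[OF assms]
  have 1: "excess (exchange x b P) T c = D c - of_bool (x \<le> c \<and> c < b)"
    unfolding exchange_def by (rule excess_exchange) (use finite_P e in auto)
  show ?thesis
  proof (cases "x = N + 1 - b")
    case True
    then show ?thesis using refl_as_exchange(1)[OF assms True] 1 by simp
  next
    case False
    have "excess (exchange (N + 1 - b) (N + 1 - x) (exchange x b P)) T c =
        excess (exchange x b P) T c - of_bool (N + 1 - b \<le> c \<and> c < N + 1 - x)"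
      unfolding exchange_def[of "N + 1 - b"] by (rule excess_exchange) (use refl_two[OF assms False] in auto)
    then show ?thesis using refl_as_exchange(2)[OF assms False] 1 False by simp
  qed
qed

text \<open>For adjacent x and b each of the two exchanges lowers D at one point. When x = n and b =
  n + 2 in type D they overlap in n + 1, the point left out, so among regular points again only x
  and N - x are hit.\<close>

lemma refl_exc:
  assumes "reflectable x b" "regular_point ty n c"
  shows "excess (reflect N x b P) T c = D c - of_bool (c = x \<or> c = N - x)"
proof -
  note e = refl_basic[OF assms(1)]
  have adj: "b = x + 1 \<or> x = n \<and> b = n + 2 \<and> ty \<noteq> Type_C" and mid: "\<not> central_column ty n x"
    using assms by (auto simp: reflectable_def)
  have c: "c \<le> N" "ty = Type_D \<Longrightarrow> c \<noteq> n + 1" using assms(2) by (auto simp: regular_point_def)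
  define y where "y = N - x"
  have y: "y + x = N" "N + 1 - x = y + 1" using e(8) by (auto simp: y_def)
  note all = refl_exc_all[OF assms(1), of c, unfolded y(2)]
  show ?thesis
  proof (cases "b = x + 1")
    case True
    then have "N + 1 - b = y" using y by simp
    then show ?thesis using all True unfolding y_def[symmetric] by auto
  next
    case False
    then have xb: "x = n" "b = n + 2" "ty \<noteq> Type_C" using adj by auto
    show ?thesis
    proof (cases "ty = Type_B")
      case True
      then have "N + 1 - b = n" "y = n + 1" using xb y by auto
      then show ?thesis using all xb unfolding y_def[symmetric] by auto
    next
      case False
      then have "ty = Type_D" using xb by (cases ty) auto
      then have "N + 1 - b = n + 1" "y = n + 2" "c \<noteq> n + 1" using xb y c by auto
      then show ?thesis using all xb unfolding y_def[symmetric] by auto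
    qed
  qed
qed

lemma refl_symbol:
  assumes "reflectable x b"
  shows "reflect N x b P \<in> schubert_symbols N m"
proof -
  note e = refl_basic[OF assms]
  have "reflect N x b P \<subseteq> {1..N}" using P_sub e by (auto simp: reflect_def)
  moreover have card: "card (exchange a d S) = card S" if "finite S" "a \<notin> S" "d \<in> S" for a d S
    using that card_Suc_Diff1[of S d] by (simp add: exchange_def)
  have "card (reflect N x b P) = m"
  proof (cases "x = N + 1 - b")
    case True
    then show ?thesis using refl_as_exchange(1)[OF assms] card[of P x b] finite_P e card_P by simp
  next
    case False
    then show ?thesis
      using refl_as_exchange(2)[OF assms False] card[of P x b] card[of "exchange x b P" "N + 1 - b" "N + 1 - x"]
        refl_two[OF assms False] finite_P e card_P by simp
  qed
  moreover have "c + d \<noteq> N + 1" if cd: "c \<in> reflect N x b P" "d \<in> reflect N x b P" for c d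
  proof
    assume s: "c + d = N + 1"
    have k: "u + v = N + 1 \<Longrightarrow> u \<in> P \<Longrightarrow> v \<notin> P" for u v
      using P_bar[of u] by (metis add_diff_cancel_left')
    from cd show False
      unfolding e(16) using s k[of c d] e(2,4,8,9,11) by (elim disjE) auto
  qed
  ultimately show ?thesis unfolding schubert_symbols_def by blast
qed

lemma refl_lowers: "reflectable x b \<Longrightarrow> lowers ty n m P (reflect N x b P)"
  unfolding lowers_def Let_def using refl_basic[of x b] refl_symbol[of x b] P_symbol by blast

lemma refl_sum:
  assumes "reflectable x b"
  shows "\<Sum>(reflect N x b P) < \<Sum>P"
proof -
  have 1: "\<Sum>(exchange x b P) < \<Sum>P"
    unfolding exchange_def by (rule sum_exchange_less) (use finite_P refl_basic[OF assms] in auto)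
  show ?thesis
  proof (cases "x = N + 1 - b")
    case True
    then show ?thesis using refl_as_exchange(1)[OF assms] 1 by simp
  next
    case False
    have "\<Sum>(exchange (N + 1 - b) (N + 1 - x) (exchange x b P)) < \<Sum>(exchange x b P)"
      unfolding exchange_def[of "N + 1 - b"]
      by (rule sum_exchange_less) (use refl_two[OF assms False] in auto)
    then show ?thesis using refl_as_exchange(2)[OF assms False] 1 by simp
  qed
qed

lemma refl_closure:
  assumes "reflectable x b"
  shows "sym_closure N (reflect N x b P) = clP"
proof (rule Set.set_eqI)
  fix c
  note e = refl_basic[OF assms]
  show "c \<in> sym_closure N (reflect N x b P) \<longleftrightarrow> c \<in> clP"
  proof (cases "1 \<le> c \<and> c \<le> N")
    case True
    have x: "1 \<le> x" "x \<le> N" and b: "1 \<le> b" "b \<le> N" using e(1-4,8) by auto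
    have "N + 1 - c = x \<longleftrightarrow> c = N + 1 - x" "N + 1 - c = b \<longleftrightarrow> c = N + 1 - b"
      "N + 1 - c = N + 1 - x \<longleftrightarrow> c = x" "N + 1 - c = N + 1 - b \<longleftrightarrow> c = b"
      using True x b by auto
    moreover have "c \<in> sym_closure N (reflect N x b P) \<longleftrightarrow>
        c \<in> reflect N x b P \<or> N + 1 - c \<in> reflect N x b P"
      using True by (auto simp: sym_closure_def)
    moreover have "c \<in> clP \<longleftrightarrow> c \<in> P \<or> N + 1 - c \<in> P"
      using True by (auto simp: in_clP)
    ultimately show ?thesis unfolding e(16) using e(3,5,6,7) by metis
  next
    case False
    have "c \<notin> reflect N x b P" using False P_sub e(1-4,8) unfolding e(16) by auto
    then show ?thesis using False P_sub by (auto simp: sym_closure_def)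
  qed
qed

text \<open>The closure is the same by \<open>refl_closure\<close>, and the excess at n + 1 changes
  by 0 or 2.\<close>

lemma refl_full:
  assumes "reflectable x b"
  shows "parity_defect ty n (reflect N x b P) T c \<longleftrightarrow> full c"
proof (cases "ty = Type_D")
  case True
  have adj: "b = x + 1 \<or> x = n \<and> b = n + 2 \<and> ty \<noteq> Type_C" and mid: "\<not> central_column ty n x"
    using assms by (auto simp: reflectable_def)
  have "odd (excess (reflect N x b P) T (n + 1)) \<longleftrightarrow> odd (D (n + 1))"
  proof (cases "b = x + 1")
    case b: True
    have "x \<noteq> n + 1" "x \<noteq> n + 2" using mid True by (auto simp: central_column_def)
    then have "excess (reflect N x b P) T (n + 1) = D (n + 1)"
      using refl_exc_all[OF assms, of "n + 1"] b True refl_basic(8)[OF assms] by auto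
    then show ?thesis by simp
  next
    case False
    then have "x = n" "b = n + 2" using adj by auto
    then have "excess (reflect N x b P) T (n + 1) = D (n + 1) - 2"
      using refl_exc_all[OF assms, of "n + 1"] True by auto
    then show ?thesis by simp
  qed
  then show ?thesis using refl_closure[OF assms] True by (auto simp: parity_defect_def)
qed (simp add: parity_defect_def)

lemma refl_comb_le:
  assumes "reflectable x b"
  shows "comb_le ty n T (reflect N x b P)"
  unfolding comb_le_def
proof (intro allI impI)
  fix c assume c: "regular_point ty n c"
  have "\<not> full x" using assms by (simp add: reflectable_def)
  then have "\<not> full (N - x)" using full_sym refl_basic(8)[OF assms] by auto
  then show "0 \<le> reduced_excess ty n (reflect N x b P) T c"
    using R_nonneg[OF c] refl_basic(13,14)[OF assms] \<open>\<not> full x\<close>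
    by (auto simp: reduced_excess_def refl_exc[OF assms c] refl_full[OF assms])
qed

lemma move_down:
  assumes "bad b0"
  shows "\<exists>Q. Q \<in> schubert_symbols N m \<and> lowers ty n m P Q \<and> comb_le ty n T Q \<and> \<Sum>Q < \<Sum>P \<and>
    ((\<exists>a b. exchangeable a b \<and> Q = exchange a b P) \<or> (\<exists>x b. reflectable x b \<and> Q = reflect N x b P))"
  using move_exists[OF assms] exch_symbol exch_lowers exch_comb_le exch_sum
    refl_symbol refl_lowers refl_comb_le refl_sum by blast

end

text \<open>Lowering D at c creates no new cut if D stays positive, if c is a cut already through
  its mirror, or if a defect is lost together with the excess. At the irregular centre of type D
  nothing is required.\<close>

definition cut_slack :: "grass_type \<Rightarrow> nat \<Rightarrow> nat set \<Rightarrow> nat set \<Rightarrow> nat \<Rightarrow> bool" where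
  "cut_slack ty n P T c \<longleftrightarrow> parity_defect ty n P T c \<or> 2 \<le> excess P T c \<or>
     excess P T c = 1 \<and> excess P T (ambient_dim ty n - c) = 0 \<or> ty = Type_D \<and> c = n + 1"

section \<open>The two notions of slack\<close>

context ordered_pair
begin

text \<open>For c \<le> n the required interval grows only by the column c, which lies in both
  closures. Otherwise the point before c is no farther from the centre than the point after
  it.\<close>

lemma full_back:
  assumes "full (point_after ty n c)" "c \<in> P" "c \<in> clT" "c \<le> N"
  shows "full (point_before ty n c)"
proof -
  have ty: "ty = Type_D" using assms(1) by (simp add: parity_defect_def)
  have N: "N = 2 * n + 2" using ty by simp
  have c1: "1 \<le> c" using assms P_sub by auto
  consider "c \<le> n" | "c = n + 1 \<or> c = n + 2" | "n + 3 \<le> c" by linarith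
  then show ?thesis
  proof cases
    case 1
    have "{min (c - 1) (2 * n + 2 - (c - 1)) + 1..n + 1} = insert c {min c (2 * n + 2 - c) + 1..n + 1}"
      using 1 c1 by auto
    moreover have "c \<in> clP" using assms(2) by (simp add: in_clP)
    ultimately show ?thesis using assms 1 ty N unfolding parity_defect_def point_after_def point_before_def by auto
  next
    case 2
    then have "point_after ty n c = n + 2" "point_before ty n c = n" using ty by (auto simp: point_after_def point_before_def)
    then show ?thesis using full_mono[of "n + 2" n] assms(1) ty N by auto
  next
    case 3
    then have "point_after ty n c = c" "point_before ty n c = c - 1" by (auto simp: point_after_def point_before_def)
    then show ?thesis using full_mono[of c "c - 1"] assms ty N 3 by auto
  qed
qed

lemma center_steps:
  assumes "ty = Type_D"
  shows "D (n + 1) = D n + of_bool (n + 1 \<in> T) - of_bool (n + 1 \<in> P)"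
    and "D (n + 2) = D (n + 1) + of_bool (n + 2 \<in> T) - of_bool (n + 2 \<in> P)"
    and "\<not> (n + 1 \<in> P \<and> n + 2 \<in> P)" and "\<not> (n + 1 \<in> T \<and> n + 2 \<in> T)"
  using D_step[of "n + 1"] D_step[of "n + 2"] P_bar[of "n + 1"] T_bar[of "n + 1"] assms by auto

text \<open>Crossing an element of P from right to left raises D unless [T] compensates for it; in
  that case the mirror value does not move either, because no symbol contains a mirror pair.\<close>

lemma back_exc:
  assumes "c \<in> P"
  shows "D (point_after ty n c) < D (point_before ty n c) \<or>
    D (point_after ty n c) = D (point_before ty n c) \<and> D (N - point_after ty n c) = D (N - point_before ty n c) \<and> c \<in> clT"
proof -
  have c: "1 \<le> c" "c \<le> N" using assms P_sub by auto
  show ?thesis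
  proof (cases "ty = Type_D \<and> (c = n + 1 \<or> c = n + 2)")
    case True
    then have q: "point_after ty n c = n + 2" "point_before ty n c = n" and ty: "ty = Type_D" and N: "N = 2 * n + 2"
      by (auto simp: point_after_def point_before_def)
    have cl: "c \<in> clT \<longleftrightarrow> n + 1 \<in> T \<or> n + 2 \<in> T" unfolding in_clT using True by auto
    have r: "N - (n + 2) = n" "N - n = n + 2" using N by auto
    have P: "of_bool (n + 1 \<in> P) + of_bool (n + 2 \<in> P) = (1 :: int)"
      using True assms center_steps(3)[OF ty] by auto
    have T: "of_bool (n + 1 \<in> T) + of_bool (n + 2 \<in> T) = (of_bool (c \<in> clT) :: int)"
      using cl center_steps(4)[OF ty] by auto
    show ?thesis unfolding q r using center_steps(1,2)[OF ty] P T by (cases "c \<in> clT") auto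
  next
    case False
    then have q: "point_after ty n c = c" "point_before ty n c = c - 1" by (auto simp: point_after_def point_before_def)
    show ?thesis unfolding q
      using D_step[OF c(1)] E_step[OF c] P_bar[OF assms] T_bar[of c] assms c by (auto simp: in_clT)
  qed
qed

lemma prev_next_pt:
  assumes "c \<in> P"
  shows "regular_point ty n (point_before ty n c)" "regular_point ty n (point_after ty n c)" "point_before ty n c \<le> N" "point_after ty n c \<le> N"
proof -
  have "1 \<le> c" "c \<le> N" using assms P_sub by auto
  then show "regular_point ty n (point_before ty n c)" "regular_point ty n (point_after ty n c)"
    by (auto simp: regular_point_def point_before_def point_after_def)
  then show "point_before ty n c \<le> N" "point_after ty n c \<le> N" by (auto simp: regular_point_def)
qed

lemma slack_order: "slack_pair ty n m P T (\<lambda>c. 1 \<le> D c \<or> ty = Type_D \<and> c = n + 1) 0"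
proof (unfold_locales)
  fix c
  show "1 \<le> D c" if "regular_point ty n c" "1 \<le> D c \<or> ty = Type_D \<and> c = n + 1"
    using that by (auto simp: regular_point_def)
  show "1 \<le> D c \<or> ty = Type_D \<and> c = n + 1" if "c \<le> N" "full c" using full_pos that by auto
  show "D c \<le> D (N - c)" if "regular_point ty n c" "\<not> (1 \<le> D c \<or> ty = Type_D \<and> c = n + 1)"
    using that D_nonneg[of "N - c"] by auto
  show "1 \<le> D (point_before ty n c) \<or> ty = Type_D \<and> point_before ty n c = n + 1"
    if "c \<in> P" "1 \<le> D (point_after ty n c) \<or> ty = Type_D \<and> point_after ty n c = n + 1"
    using back_exc[OF that(1)] that prev_next_pt(2)[OF that(1)] by (auto simp: regular_point_def)
next
  show "1 \<le> D n \<or> ty = Type_D \<and> n = n + 1" if "ty = Type_B" "1 \<le> D (n + 1) \<or> ty = Type_D \<and> n + 1 = n + 1"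
    using that D_step[of "n + 1"] mid_notin by auto
qed auto

lemma slack_cut: "slack_pair ty n m P T (cut_slack ty n P T) 1"
proof (unfold_locales)
  fix c
  show "1 \<le> D c" if "regular_point ty n c" "cut_slack ty n P T c"
    using that full_pos[of c] by (auto simp: regular_point_def cut_slack_def)
  show "cut_slack ty n P T c" if "c \<le> N" "full c" using that by (simp add: cut_slack_def)
  show "D c \<le> D (N - c)" if "regular_point ty n c" "\<not> cut_slack ty n P T c"
    using that D_nonneg[of "N - c"] by (auto simp: cut_slack_def)
  show "cut_slack ty n P T (point_before ty n c)" if c: "c \<in> P" and A: "cut_slack ty n P T (point_after ty n c)"
  proof -
    note pn = prev_next_pt[OF c]
    have pos: "1 \<le> D (point_after ty n c)" using A full_pos[of "point_after ty n c"] pn by (auto simp: cut_slack_def regular_point_def)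
    show ?thesis
    proof (cases "D (point_after ty n c) < D (point_before ty n c)")
      case True
      then show ?thesis using pos by (auto simp: cut_slack_def)
    next
      case False
      then have eq: "D (point_after ty n c) = D (point_before ty n c)" "D (N - point_after ty n c) = D (N - point_before ty n c)" "c \<in> clT"
        using back_exc[OF c] by auto
      have "c \<le> N" using c P_sub by auto
      then have "full (point_after ty n c) \<Longrightarrow> full (point_before ty n c)" using full_back[OF _ c] eq by auto
      then show ?thesis using A eq pn by (auto simp: cut_slack_def regular_point_def)
    qed
  qed
next
  show "cut_slack ty n P T (n + 1)" if "ty = Type_D" using that by (simp add: cut_slack_def)
  show "cut_slack ty n P T n" if "ty = Type_B" "cut_slack ty n P T (n + 1)"
  proof -
    have "D (n + 1) = D n" using D_step[of "n + 1"] mid_notin that(1) by auto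
    moreover have "N - n = n + 1" "N - (n + 1) = n" using that(1) by auto
    ultimately show ?thesis using that unfolding cut_slack_def by (auto simp: parity_defect_def)
  qed
qed auto

end

section \<open>Existence of bad elements, and the relation P -> T in their absence\<close>

context ordered_pair
begin

interpretation C: slack_pair ty n m P T "cut_slack ty n P T" 1
  by (rule slack_cut)

text \<open>D ends at 0, so there is a last regular point of excess at least t. An element of P
  causes the drop after it, and even across the two central columns D drops by at most one.\<close>

lemma last_large_excess:
  assumes "regular_point ty n c0" "t \<le> D c0" "1 \<le> t"
  obtains b where "b \<in> P" "t \<le> D (point_before ty n b)" "t - 1 \<le> D (point_after ty n b)"
proof -
  define S where "S = {c. regular_point ty n c \<and> t \<le> D c}"
  have fin: "finite S" unfolding S_def by (rule finite_subset[of _ "{..N}"]) (auto simp: regular_point_def)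
  have "S \<noteq> {}" using assms by (auto simp: S_def)
  define v where "v = Max S"
  have "v \<in> S" unfolding v_def by (rule Max_in) fact+
  then have v: "regular_point ty n v" "t \<le> D v" by (auto simp: S_def)
  have small: "D c < t" if "v < c" "regular_point ty n c" for c
  proof (rule ccontr)
    assume "\<not> D c < t"
    then have "c \<le> v" unfolding v_def using that fin by (intro Max_ge) (auto simp: S_def)
    then show False using that by simp
  qed
  have vN: "v < N" using v assms(3) D_N by (cases "v = N") (auto simp: regular_point_def)
  show thesis
  proof (cases "ty = Type_D \<and> v = n")
    case True
    then have s: "D (n + 2) < t" using small[of "n + 2"] by (auto simp: regular_point_def)
    define b where "b = (if n + 1 \<in> P then n + 1 else n + 2)"
    have "b \<in> P"
      using center_steps(1,2) True v(2) s by (auto simp: b_def of_bool_def split: if_splits)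
    moreover have "point_before ty n b = n" "point_after ty n b = n + 2"
      using True by (auto simp: b_def point_before_def point_after_def)
    moreover have "D n - 1 \<le> D (n + 2)"
      using center_steps[of] True by (auto simp: of_bool_def split: if_splits)
    ultimately show thesis using that[of b] v True by auto
  next
    case False
    have "regular_point ty n (v + 1)" using False vN by (auto simp: regular_point_def)
    then have "D (v + 1) < t" using small by simp
    moreover have st: "D (v + 1) = D v + of_bool (v + 1 \<in> T) - of_bool (v + 1 \<in> P)"
      using D_step[of "v + 1"] by simp
    ultimately have "v + 1 \<in> P" using v by (auto simp: of_bool_def split: if_splits)
    moreover have "point_before ty n (v + 1) = v" "point_after ty n (v + 1) = v + 1"
      using False v by (auto simp: point_before_def point_after_def regular_point_def)
    moreover have "D v - 1 \<le> D (v + 1)" using st by (auto simp: of_bool_def)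
    ultimately show thesis using that[of "v + 1"] v by auto
  qed
qed

lemma eq_or_large:
  assumes "P \<noteq> T"
  shows "\<exists>c. regular_point ty n c \<and> 1 \<le> D c"
proof (rule ccontr)
  assume "\<not> ?thesis"
  then have z: "D c = 0" if "regular_point ty n c" for c
    using that D_nonneg[of c] by (force simp: regular_point_def)
  have same: "c \<in> P \<longleftrightarrow> c \<in> T" if "1 \<le> c" "c \<le> N" "ty = Type_D \<Longrightarrow> c \<noteq> n + 1 \<and> c \<noteq> n + 2" for c
  proof -
    have "regular_point ty n c" "regular_point ty n (c - 1)" using that(1,2) that(3) by (cases "ty = Type_D"; force simp: regular_point_def)+
    then have "D c = 0" "D (c - 1) = 0" using z by auto
    then show ?thesis using D_step[OF that(1)] by (auto simp: of_bool_def split: if_splits)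
  qed
  \<comment> \<open>Excess 0 at n and n + 2 would still allow P and T to use different central
    columns; but that is a parity defect at n, which needs positive excess.\<close>
  have center: "(n + 1 \<in> P \<longleftrightarrow> n + 1 \<in> T) \<and> (n + 2 \<in> P \<longleftrightarrow> n + 2 \<in> T)" if ty: "ty = Type_D"
  proof -
    have N: "N = 2 * n + 2" using ty by simp
    have d: "D n = 0" "D (n + 2) = 0" "0 \<le> D (n + 1)"
      using z[of n] z[of "n + 2"] D_nonneg[of "n + 1"] ty by (auto simp: regular_point_def)
    have "\<not> full n" using full_pos[of n] d N by auto
    moreover have "full n \<longleftrightarrow> odd (D (n + 1)) \<and> n + 1 \<in> clP \<and> n + 1 \<in> clT"
      using ty N by (auto simp: parity_defect_def atLeastAtMost_singleton')
    moreover have "n + 1 \<in> clP \<longleftrightarrow> n + 1 \<in> P \<or> n + 2 \<in> P" "n + 1 \<in> clT \<longleftrightarrow> n + 1 \<in> T \<or> n + 2 \<in> T"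
      unfolding in_clP in_clT using N by auto
    ultimately show ?thesis
      using center_steps[OF ty] d
      by (cases "n + 1 \<in> P"; cases "n + 2 \<in> P"; cases "n + 1 \<in> T"; cases "n + 2 \<in> T") auto
  qed
  have "P = T"
  proof (rule Set.set_eqI)
    fix c
    show "c \<in> P \<longleftrightarrow> c \<in> T"
      using same[of c] center P_sub T_sub
      by (cases "1 \<le> c \<and> c \<le> N"; cases "ty = Type_D"; cases "c = n + 1"; cases "c = n + 2") auto
  qed
  then show False using assms by simp
qed

lemma order_step:
  assumes "P \<noteq> T"
  shows "\<exists>Q. Q \<in> schubert_symbols N m \<and> lowers ty n m P Q \<and> comb_le ty n T Q \<and> \<Sum>Q < \<Sum>P"
proof -
  interpret S: slack_pair ty n m P T "\<lambda>c. 1 \<le> D c \<or> ty = Type_D \<and> c = n + 1" 0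
    by (rule slack_order)
  obtain c where "regular_point ty n c" "1 \<le> D c" using eq_or_large[OF assms] by blast
  then obtain b where "b \<in> P" "1 \<le> D (point_before ty n b)" "1 - 1 \<le> D (point_after ty n b)"
    by (rule last_large_excess) auto
  then have "S.bad b" unfolding S.bad_def by auto
  then show ?thesis using S.move_down by blast
qed

text \<open>In the centre of type D, excess 1 at n + 1 is odd and yields a defect at n. Elsewhere
  the cut comes from a defect at c, which extends back across c, or from a zero of D at N - c;
  either gives slack at c - 1.\<close>

lemma cut_slack_common:
  assumes "c \<in> P" "c \<in> T" "D c = 1" "c \<in> cuts ty n m P T"
  shows "C.bad c"
proof (cases "ty = Type_D \<and> (c = n + 1 \<or> c = n + 2)")
  case True
  then have ty: "ty = Type_D" and N: "N = 2 * n + 2" by auto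
  have q: "point_before ty n c = n" "point_after ty n c = n + 2" using True by (auto simp: point_before_def point_after_def)
  have d: "D n = 1" "D (n + 1) = 1" "D (n + 2) = 1"
    using center_steps[OF ty] assms(1-3) True by auto
  have "n + 1 \<in> clP" "n + 1 \<in> clT" unfolding in_clP in_clT using assms(1,2) True by auto
  then have "full n" using ty N d by (auto simp: parity_defect_def atLeastAtMost_singleton')
  then show ?thesis using assms(1) q d unfolding C.bad_def cut_slack_def by auto
next
  case False
  have c: "1 \<le> c" "c \<le> N" using assms(1) P_sub by auto
  have q: "point_before ty n c = c - 1" "point_after ty n c = c" using False by (auto simp: point_before_def point_after_def)
  have "regular_point ty n c" using False c by (auto simp: regular_point_def)
  then have "K c" using cuts_iff assms(4) by blast
  have d: "D (c - 1) = 1" "D (N - (c - 1)) = D (N - c)"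
    using D_step[OF c(1)] E_step[OF c] P_bar[OF assms(1)] T_bar[OF assms(2)] assms by auto
  have "cut_slack ty n P T (c - 1)"
  proof (cases "full c")
    case True
    then show ?thesis using full_back[of c] assms q c by (auto simp: cut_slack_def in_clT)
  next
    case False
    then have "D (N - c) = 0" using \<open>K c\<close> full_sym[OF c(2)] assms(3) by (auto simp: symmetric_cut_def reduced_excess_def)
    then show ?thesis using d by (auto simp: cut_slack_def)
  qed
  then show ?thesis using assms q unfolding C.bad_def by auto
qed

lemma arrow_if_not_bad:
  assumes nb: "\<And>b. \<not> C.bad b" and i: "i \<in> {1..m - 1}"
  shows "entry N P i \<le> entry N T (i + 1) \<or>
      ty = Type_D \<and> entry N P i = n + 2 \<and> entry N T (i + 1) = n + 1"
    and "entry N P i = entry N T (i + 1) \<Longrightarrow> entry N P i \<notin> cuts ty n m P T"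
proof -
  have small: "D c \<le> 1" if pc: "regular_point ty n c" for c
  proof (rule ccontr)
    assume gt: "\<not> D c \<le> 1"
    obtain b where "b \<in> P" "2 \<le> D (point_before ty n b)" "2 - 1 \<le> D (point_after ty n b)"
      by (rule last_large_excess[OF pc, of 2]) (use gt in auto)
    then have "C.bad b" unfolding C.bad_def cut_slack_def by auto
    then show False using nb by blast
  qed
  have iP: "1 \<le> i" "i \<le> card P" and iT: "1 \<le> i + 1" "i + 1 \<le> card T" using i card_P card_T by auto
  have range: "entry N P i \<in> {1..N}" "entry N T (i + 1) \<in> {1..N}"
  proof -
    have "entry N P i \<le> N" "entry N T (i + 1) \<le> N"
      using entry_le_iff[OF P_sub, of i N] entry_le_iff[OF T_sub, of "i + 1" N] iP iT
        count_upto_full[OF P_sub] count_upto_full[OF T_sub] by auto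
    moreover have "\<not> entry N P i \<le> 0" "\<not> entry N T (i + 1) \<le> 0"
      using entry_le_iff[OF P_sub, of i 0] entry_le_iff[OF T_sub, of "i + 1" 0] iP iT by auto
    ultimately show "entry N P i \<in> {1..N}" "entry N T (i + 1) \<in> {1..N}" by auto
  qed
  \<comment> \<open>From t_(i+1) on, T has at least i + 1 elements; before p_i, P has at most i -
    1.\<close>
  have big: "2 \<le> D c" if "entry N T (i + 1) \<le> c" "c < entry N P i" for c
  proof -
    have "c \<le> N" using that range by auto
    then have "i + 1 \<le> count_upto T c" "\<not> i \<le> count_upto P c"
      using that entry_le_iff[OF P_sub, of i c] entry_le_iff[OF T_sub, of "i + 1" c] iP iT by auto
    then show ?thesis by (auto simp: excess_def)
  qed
  show "entry N P i \<le> entry N T (i + 1) \<or>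
      ty = Type_D \<and> entry N P i = n + 2 \<and> entry N T (i + 1) = n + 1"
  proof (rule ccontr)
    assume neg: "\<not> ?thesis"
    define c where "c = entry N T (i + 1)"
    define p where "p = entry N P i"
    have cp: "c < p" "\<not> (ty = Type_D \<and> p = n + 2 \<and> c = n + 1)" using neg by (auto simp: c_def p_def)
    have all_big: "\<And>x. c \<le> x \<Longrightarrow> x < p \<Longrightarrow> \<not> regular_point ty n x"
      using big small unfolding c_def p_def by fastforce
    have pN: "p \<le> N" using range by (simp add: p_def)
    \<comment> \<open>The only nonempty interval without regular points is {n + 1}; this is the
      exception that the relation permits in type D.\<close>
    have "ty = Type_D \<and> c = n + 1" using all_big[of c] cp pN by (auto simp: regular_point_def)
    moreover from this have "n + 2 < p" using cp by auto
    ultimately show False using all_big[of "n + 2"] pN by (auto simp: regular_point_def)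
  qed
  show "entry N P i \<notin> cuts ty n m P T" if eq: "entry N P i = entry N T (i + 1)"
  proof
    assume cut: "entry N P i \<in> cuts ty n m P T"
    define c where "c = entry N P i"
    have c: "1 \<le> c" "c \<le> N" using range by (auto simp: c_def)
    have "c \<in> P \<and> count_upto P c = i" "c \<in> T \<and> count_upto T c = i + 1"
      using entry_eq_iff[OF P_sub iP c] entry_eq_iff[OF T_sub iT c] eq by (auto simp: c_def)
    then have "C.bad c" using cut_slack_common[of c] cut by (auto simp: excess_def c_def)
    then show False using nb by blast
  qed
qed

section \<open>Invariance of cuts and equations under the moves\<close>

lemma exch_ordered: "C.exchangeable a b \<Longrightarrow> ordered_pair ty n m (exchange a b P) T"
  using C.exch_symbol C.exch_comb_le T_symbol by (simp add: ordered_pair_def symbol_pair_def ordered_pair_axioms_def)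

lemma refl_ordered: "C.reflectable x b \<Longrightarrow> ordered_pair ty n m (reflect N x b P) T"
  using C.refl_symbol C.refl_comb_le T_symbol by (simp add: ordered_pair_def symbol_pair_def ordered_pair_axioms_def)

text \<open>If a defect is lost, exactly one of c, N - c lies in the moved interval and loses one
  there; the other value is equal to the old one and at least 1, so it adds no zero. Without a
  defect, slack at a lowered point means excess 2 or an existing cut.\<close>

lemma exch_K:
  assumes ex: "C.exchangeable a b" and c: "regular_point ty n c"
  shows "symmetric_cut ty n (exchange a b P) T c \<longleftrightarrow> K c"
proof -
  have cN: "c \<le> N" "N - c \<le> N" using c by (auto simp: regular_point_def)
  have cc: "N - (N - c) = c" using cN by auto
  have ptE: "regular_point ty n (N - c)" using c by (auto simp: regular_point_def)
  let ?f' = "parity_defect ty n (exchange a b P) T c"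
  have f': "parity_defect ty n (exchange a b P) T (N - c) \<longleftrightarrow> ?f'"
    using symbol_pair.full_sym[of ty n m "exchange a b P" T c] exch_ordered[OF ex] cN
    by (auto simp: ordered_pair_def)
  define I J where "I = (a \<le> c \<and> c < b)" and "J = (a \<le> N - c \<and> N - c < b)"
  define d e where "d = D c" and "e = D (N - c)"
  note q = C.exch_basic(12)[OF ex, of c, folded I_def d_def] C.exch_basic(12)[OF ex, of "N - c", folded J_def e_def]
  have K: "K c \<longleftrightarrow> d - of_bool (full c) = 0 \<or> e - of_bool (full c) = 0"
    using full_sym[OF cN(1)] by (simp add: symmetric_cut_def reduced_excess_def d_def e_def)
  have K': "symmetric_cut ty n (exchange a b P) T c \<longleftrightarrow>
      d - of_bool I - of_bool ?f' = 0 \<or> e - of_bool J - of_bool ?f' = 0"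
    using q f' by (simp add: symmetric_cut_def reduced_excess_def)
  have AI: "cut_slack ty n P T c" if I using C.exch_A(1)[OF ex, of c] c that by (auto simp: I_def)
  have AJ: "cut_slack ty n P T (N - c)" if J using C.exch_A(1)[OF ex, of "N - c"] ptE that by (auto simp: J_def)
  show ?thesis
  proof (cases "full c")
    case f: True
    have de: "e = d" "1 \<le> d" using full_eq[OF f cN(1)] full_pos[OF f cN(1)] by (auto simp: d_def e_def)
    show ?thesis
    proof (cases ?f')
      case True
      then have "\<not> I" "\<not> J" using C.exch_full[OF ex cN(1) True] by (auto simp: I_def J_def)
      then show ?thesis using K K' f True by simp
    next
      case False
      have ty: "ty = Type_D" using f by (simp add: parity_defect_def)
      have "b \<le> n + 2" "a \<le> n" using ex[unfolded C.exchangeable_def] ty f cN by auto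
      then have "\<not> (I \<and> J)" using c ty by (auto simp: I_def J_def regular_point_def)
      moreover have "I \<or> J" using C.exch_full_conv[OF ex cN(1) f] False by (auto simp: I_def J_def)
      ultimately show ?thesis unfolding K K' using de f False by auto
    qed
  next
    case f: False
    then have f'': "\<not> ?f'" using C.exch_full[OF ex cN(1)] by auto
    have fE: "\<not> full (N - c)" using f full_sym[OF cN(1)] by simp
    have "2 \<le> d \<or> d = 1 \<and> e = 0" if I using AI[OF that] f c by (auto simp: cut_slack_def d_def e_def regular_point_def)
    moreover have "2 \<le> e \<or> e = 1 \<and> d = 0" if J
      using AJ[OF that] fE ptE cc by (auto simp: cut_slack_def d_def e_def regular_point_def)
    ultimately show ?thesis unfolding K K' using f f'' by (cases I; cases J) auto
  qed
qed

text \<open>Slack at x without a defect leaves excess 2 or the pair D x = 1, D (N - x) = 0, and the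
  latter contradicts D x \<le> D (N - x).\<close>

lemma refl_large:
  assumes re: "C.reflectable x b"
  shows "2 \<le> D x" "2 \<le> D (N - x)" "\<not> full x" "\<not> full (N - x)"
proof -
  have regular_point: "regular_point ty n x" and x: "x \<le> N" using C.refl_basic[OF re] by auto
  show f: "\<not> full x" using re by (simp add: C.reflectable_def)
  then show "\<not> full (N - x)" using full_sym[OF x] by simp
  have "D x \<le> D (N - x)" "cut_slack ty n P T x" using re by (auto simp: C.reflectable_def)
  then show "2 \<le> D x" "2 \<le> D (N - x)" using f regular_point by (auto simp: cut_slack_def regular_point_def)
qed

lemma refl_K:
  assumes re: "C.reflectable x b" and c: "regular_point ty n c"
  shows "symmetric_cut ty n (reflect N x b P) T c \<longleftrightarrow> K c"
proof -
  have regular_point: "regular_point ty n (N - c)" using c by (auto simp: regular_point_def)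
  have x: "x \<le> N" "c \<le> N" using C.refl_basic(8)[OF re] c by (auto simp: regular_point_def)
  note l = refl_large[OF re]
  note q = C.refl_exc[OF re c] C.refl_exc[OF re regular_point] C.refl_full[OF re]
  have sw: "N - c = x \<longleftrightarrow> c = N - x" "N - c = N - x \<longleftrightarrow> c = x" using x by auto
  show ?thesis
  proof (cases "c = x \<or> c = N - x")
    case True
    have "N - (N - x) = x" using x by simp
    then show ?thesis using True l q sw by (auto simp: symmetric_cut_def reduced_excess_def)
  next
    case False
    then show ?thesis using q sw by (simp add: symmetric_cut_def reduced_excess_def)
  qed
qed

text \<open>The same equation may have different causes for the two symbols: a star of P at a or b
  is replaced by a zero column or by a star of T, and a zero column newly created between a and b by
  a star of P in the mirror column.\<close>

lemma exch_linear_eqs_side: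
  assumes ex: "C.exchangeable a b" and c: "1 \<le> c" "c \<le> N" "\<not> central_column ty n c"
  shows "c \<in> linear_eqs ty n m (exchange a b P) T \<longleftrightarrow> c \<in> linear_eqs ty n m P T"
proof -
  define Q where "Q = exchange a b P"
  interpret Q: ordered_pair ty n m Q T unfolding Q_def by (rule exch_ordered[OF ex])
  note e = C.exch_basic[OF ex, folded Q_def]
  have side: "ty = Type_D \<Longrightarrow> x \<noteq> n + 1 \<and> x \<noteq> n + 2" if "\<not> central_column ty n x" for x
    using that by (auto simp: central_column_def)
  have bar_mid: "central_column ty n (N + 1 - x) \<longleftrightarrow> central_column ty n x" if "x \<le> N" for x
    using that by (cases ty) (auto simp: central_column_def)
  have ptx: "regular_point ty n x" "regular_point ty n (x - 1)" if "1 \<le> x" "x \<le> N" "\<not> central_column ty n x" for x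
    using that by (cases "ty = Type_D"; force simp: regular_point_def central_column_def)+
  have KQ: "Q.K x \<longleftrightarrow> K x" if "regular_point ty n x" for x
    using exch_K[OF ex that] by (simp add: Q_def)
  have L: "c \<in> linear_eqs ty n m P T \<longleftrightarrow> N + 1 - c \<in> T \<and> K (c - 1) \<or> N + 1 - c \<in> P \<and> K c \<or>
    c \<notin> P \<and> c \<notin> T \<and> D (c - 1) = 0 \<and> D c = 0"
    by (rule linear_eqs_iff) (use c side in auto)
  have LQ: "c \<in> linear_eqs ty n m Q T \<longleftrightarrow> N + 1 - c \<in> T \<and> Q.K (c - 1) \<or> N + 1 - c \<in> Q \<and> Q.K c \<or>
    c \<notin> Q \<and> c \<notin> T \<and> Q.D (c - 1) = 0 \<and> Q.D c = 0"
    by (rule Q.linear_eqs_iff) (use c side in auto)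
  have pc: "regular_point ty n c" "regular_point ty n (c - 1)" using ptx[OF c] .
  have Dpos: "1 \<le> D x" if "a \<le> x" "x < b" "regular_point ty n x" for x
    using C.exch_A(2)[OF ex that] .
  have slack: "full x \<or> 2 \<le> D x \<or> D x = 1 \<and> D (N - x) = 0" if "a \<le> x" "x < b" "regular_point ty n x" for x
    using C.exch_A(1)[OF ex that] that by (auto simp: cut_slack_def regular_point_def)
  have DQ: "Q.D x = D x" if "D x = 0" "regular_point ty n x" for x
    using e(12)[of x] Dpos[of x] that by auto
  have bar: "N + 1 - (N + 1 - c) = c" "N + 1 - (N + 1 - a) = a" "N + 1 - (N + 1 - b) = b" using c e by auto
  \<comment> \<open>A star appears at a. There is no defect at a - 1, as a is outside [P], so D c =
    0 or D (a - 1) = 0. In the first case c is a zero column of the old pair. In the second, a lies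
    in T and, if D (c - 1) is nonzero, slack makes a a cut, so T has a star there.\<close>
  have add: "c \<in> linear_eqs ty n m P T" if ca: "c = N + 1 - a" and k: "K c"
  proof -
    have amid: "\<not> central_column ty n a" using bar_mid[of a] c ca e by auto
    have aN: "a \<le> N" using e by auto
    have pa: "regular_point ty n a" "regular_point ty n (a - 1)" using ptx[OF e(1) aN amid] .
    have Da: "1 \<le> D a" using Dpos[of a] e pa by auto
    have sa: "full a \<or> 2 \<le> D a \<or> D a = 1 \<and> D (N - a) = 0" using slack[of a] e pa by auto
    have cN: "c = N - (a - 1)" "c - 1 = N - a" using ca e(1) aN by auto
    have "\<not> full (a - 1)"
    proof
      assume f: "full (a - 1)"
      then have ty: "ty = Type_D" by (simp add: parity_defect_def)
      have aN1: "a - 1 \<le> N" using aN by simp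
      have "a \<le> n" using ex[unfolded C.exchangeable_def] ty f aN1 by auto
      then have "a \<in> {min (a - 1) (2 * n + 2 - (a - 1)) + 1..n + 1}" using e(1) by auto
      then have "a \<in> sym_closure (2 * n + 2) P" using f unfolding parity_defect_def by blast
      then show False using e(5) ty by simp
    qed
    then have "D (a - 1) = 0 \<or> D c = 0"
      using k K_sym[of "a - 1"] full_sym[of "a - 1"] aN unfolding cN by (auto simp: symmetric_cut_def reduced_excess_def)
    moreover have Es: "D c = D (c - 1) + of_bool (c \<in> T)"
      using E_step[OF e(1) aN, folded cN ca] e(7)[folded ca] by simp
    ultimately consider "D c = 0" | "D (a - 1) = 0" "D c \<noteq> 0" by blast
    then show ?thesis
    proof cases
      case 1
      have "0 \<le> D (c - 1)" using D_nonneg[of "c - 1"] c by auto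
      then have "c \<notin> T" "D (c - 1) = 0" using Es 1 by (auto simp: of_bool_def split: if_splits)
      then show ?thesis using L 1 e(7) ca by auto
    next
      case 2
      then have "a \<in> T" "D a = 1" using D_step[OF e(1)] Da e(6) by (auto simp: of_bool_def split: if_splits)
      have "c \<notin> T" using T_bar[OF \<open>a \<in> T\<close>] ca by simp
      then have "D (c - 1) \<noteq> 0" using Es 2 by auto
      then have "full a" using sa \<open>D a = 1\<close> cN by auto
      then have "K a" using \<open>D a = 1\<close> by (simp add: symmetric_cut_def reduced_excess_def)
      then have "K (c - 1)" using K_sym[OF aN] cN by simp
      then show ?thesis using L \<open>a \<in> T\<close> ca bar by auto
    qed
  qed
  \<comment> \<open>The star at b disappears. Either a defect of excess 1 at b - 1 extends to b, and
    T contains b with its own star, or D c = 0 and c is a zero column of the new pair.\<close>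
  have del: "c \<in> linear_eqs ty n m Q T" if cb: "c = N + 1 - b" and k: "K c"
  proof -
    have bmid: "\<not> central_column ty n b" using bar_mid[of b] c cb e by auto
    have b1: "1 \<le> b" using e by auto
    have pb: "regular_point ty n b" "regular_point ty n (b - 1)" using ptx[OF b1 e(4) bmid] .
    have cN: "c = N - (b - 1)" "c - 1 = N - b" using cb e(4) b1 by auto
    have nb: "point_after ty n b = b" using bmid by (auto simp: point_after_def central_column_def)
    have Db: "1 \<le> D b" using ex[unfolded C.exchangeable_def] nb by auto
    have sb: "full (b - 1) \<or> 2 \<le> D (b - 1) \<or> D (b - 1) = 1 \<and> D c = 0" "1 \<le> D (b - 1)"
      using slack[of "b - 1"] Dpos[of "b - 1"] e(1,2) pb cN by auto
    have Es: "D c = D (c - 1) + of_bool (c \<in> T)"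
      using E_step[OF b1 e(4), folded cN cb] e(8)[folded cb] by simp
    have k': "reduced_excess ty n P T (b - 1) = 0 \<or> reduced_excess ty n P T c = 0"
      using k K_sym[of "b - 1"] e(4) unfolding cN by (auto simp: symmetric_cut_def)
    show ?thesis
    proof (cases "full (b - 1)")
      case True
      have "D c = D (b - 1)" using full_eq[OF True] e(4) cN by auto
      then have "D (b - 1) = 1" "D c = 1"
        using k' True full_sym[of "b - 1"] e(4) cN by (auto simp: reduced_excess_def)
      then have "b \<in> T" "D b = 1" using D_step[OF b1] Db e(3) by (auto simp: of_bool_def split: if_splits)
      have ty: "ty = Type_D" and N: "N = 2 * n + 2" using True by (auto simp: parity_defect_def)
      have bcl: "b \<in> clP \<inter> clT" "c \<in> clP \<inter> clT"
        using e(3) \<open>b \<in> T\<close> c cb bar by (auto simp: in_clP in_clT)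
      have "full b"
      proof (cases "b \<le> n")
        case bn: True
        show ?thesis by (rule full_mono[OF True ty]) (use bn N in auto)
      next
        case False
        then have b3: "n + 3 \<le> b" using bmid ty by (auto simp: central_column_def)
        have "{min b (2 * n + 2 - b) + 1..n + 1} = insert c {min (b - 1) (2 * n + 2 - (b - 1)) + 1..n + 1}"
          using b3 e(4) N cb by auto
        then show ?thesis using True b3 bcl ty unfolding parity_defect_def by auto
      qed
      then have "K b" using \<open>D b = 1\<close> by (simp add: symmetric_cut_def reduced_excess_def)
      then have "Q.K (c - 1)" using K_sym[OF e(4)] cN KQ[OF pc(2)] by simp
      then show ?thesis using LQ \<open>b \<in> T\<close> cb bar by auto
    next
      case False
      then have "D c = 0" using k' sb full_sym[of "b - 1"] e(4) cN by (auto simp: reduced_excess_def)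
      moreover have "0 \<le> D (c - 1)" using D_nonneg[of "c - 1"] c by auto
      ultimately have "c \<notin> T" "D (c - 1) = 0" using Es by (auto simp: of_bool_def split: if_splits)
      moreover have "c \<notin> Q" using e(8,9,13) cb by auto
      ultimately show ?thesis using LQ DQ[of c] DQ[of "c - 1"] pc \<open>D c = 0\<close> by auto
    qed
  qed
  have zero: "c \<in> linear_eqs ty n m P T" if z: "c \<notin> Q" "c \<notin> T" "Q.D (c - 1) = 0" "Q.D c = 0"
  proof -
    have ca: "c \<noteq> a" using z(1) e(13) by auto
    have cb: "c \<noteq> b"
    proof
      assume cb: "c = b"
      have "point_after ty n b = b" using c(3) cb by (auto simp: point_after_def central_column_def)
      then have "1 \<le> D b" using ex[unfolded C.exchangeable_def] by auto
      then show False using z(4) e(12)[of b] cb by auto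
    qed
    show ?thesis
    proof (cases "a < c \<and> c < b")
      case True
      then have "N + 1 - c \<in> P" using ex[unfolded C.exchangeable_def] c(3) by auto
      moreover have "K c"
      proof -
        have "\<not> Q.full c" using Q.full_pos[of c] z(4) c by auto
        then have "Q.K c" using z(4) by (simp add: symmetric_cut_def reduced_excess_def)
        then show ?thesis using KQ pc by simp
      qed
      ultimately show ?thesis using L by blast
    next
      case False
      then have "D c = 0" "D (c - 1) = 0" using z e(12)[of c] e(12)[of "c - 1"] ca cb by auto
      moreover have "c \<notin> P" using z(1) e(13) cb by auto
      ultimately show ?thesis using L z(2) by blast
    qed
  qed
  have "c \<in> linear_eqs ty n m P T" if cQ: "c \<in> linear_eqs ty n m Q T"
  proof -
    consider "N + 1 - c \<in> T" "K (c - 1)" | "N + 1 - c \<in> Q" "K c"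
      | "c \<notin> Q" "c \<notin> T" "Q.D (c - 1) = 0" "Q.D c = 0"
      using cQ unfolding LQ KQ[OF pc(1)] KQ[OF pc(2)] by blast
    then show ?thesis
    proof cases
      case 2
      show ?thesis
      proof (cases "N + 1 - c = a")
        case True
        then show ?thesis using add 2 bar by auto
      next
        case False
        then have "N + 1 - c \<in> P" using 2 e(13) by auto
        then show ?thesis using L 2 by blast
      qed
    qed (use L zero in blast)+
  qed
  moreover have "c \<in> linear_eqs ty n m Q T" if cP: "c \<in> linear_eqs ty n m P T"
  proof -
    consider "N + 1 - c \<in> T" "K (c - 1)" | "N + 1 - c \<in> P" "K c"
      | "c \<notin> P" "c \<notin> T" "D (c - 1) = 0" "D c = 0"
      using cP unfolding L by blast
    then show ?thesis
    proof cases
      case 1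
      then show ?thesis using LQ KQ[OF pc(2)] by blast
    next
      case 2
      show ?thesis
      proof (cases "N + 1 - c = b")
        case True
        then show ?thesis using del 2 bar by auto
      next
        case False
        then have "N + 1 - c \<in> Q" using 2 e(13) by auto
        then show ?thesis using LQ KQ[OF pc(1)] 2 by blast
      qed
    next
      case 3
      have "c \<noteq> a" using Dpos[of a] e(1,2) pc 3 by auto
      then have "c \<notin> Q" using 3 e(13) by auto
      then show ?thesis using LQ 3 DQ[of c] DQ[of "c - 1"] pc by auto
    qed
  qed
  ultimately show ?thesis unfolding Q_def by blast
qed

text \<open>Column n + 1 is its own mirror and lies in no symbol, so only the zero-column cause
  remains, and D n = D (n + 1).\<close>

lemma linear_eqs_mid_B:
  assumes "ty = Type_B"
  shows "n + 1 \<in> linear_eqs ty n m P T \<longleftrightarrow> K n"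
proof -
  have N: "N + 1 - (n + 1) = n + 1" "N - n = n + 1" "n + 1 - 1 = n" using assms by auto
  have "D (n + 1) = D n" using D_step[of "n + 1"] mid_notin[OF assms] by auto
  moreover have "\<not> full n" "\<not> full (n + 1)" using assms by (auto simp: parity_defect_def)
  ultimately have "K n \<longleftrightarrow> D n = 0" using N by (simp add: symmetric_cut_def reduced_excess_def)
  then show ?thesis
    using linear_eqs_iff[of "n + 1", unfolded N] mid_notin[OF assms] assms \<open>D (n + 1) = D n\<close> by auto
qed

text \<open>If b is central, excess at least 1 on both sides of the centre together with the cut
  forces a defect of excess 1, hence b in T. If a is central, D rises from 0 across the centre and
  the parity rule for a gives a in T. Either way the moved element is still counted in the union
  with T.\<close>

lemma exch_linear_eqs_center:
  assumes ex: "C.exchangeable a b" and ty: "ty = Type_D" and k: "K n" and c: "c = n + 1 \<or> c = n + 2"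
  shows "c \<in> T \<union> exchange a b P \<or> n + 1 \<notin> sym_closure N (exchange a b P) \<union> clT \<longleftrightarrow>
    c \<in> T \<union> P \<or> n + 1 \<notin> clP \<union> clT"
proof -
  have N: "N = 2 * n + 2" using ty by simp
  note e = C.exch_basic[OF ex]
  note st = center_steps[OF ty]
  have cl: "n + 1 \<in> clP \<longleftrightarrow> n + 1 \<in> P \<or> n + 2 \<in> P" "n + 1 \<in> clT \<longleftrightarrow> n + 1 \<in> T \<or> n + 2 \<in> T"
    unfolding in_clP in_clT using N by auto
  have clQ: "n + 1 \<in> sym_closure N (exchange a b P) \<longleftrightarrow> n + 1 \<in> exchange a b P \<or> n + 2 \<in> exchange a b P"
    using N by (auto simp: sym_closure_def)
  have fn: "full n \<longleftrightarrow> odd (D (n + 1)) \<and> n + 1 \<in> clP \<and> n + 1 \<in> clT"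
    using ty N by (auto simp: parity_defect_def atLeastAtMost_singleton')
  have f2: "full (n + 2) \<longleftrightarrow> full n" using full_sym[of n] N by simp
  have kn: "D n - of_bool (full n) = 0 \<or> D (n + 2) - of_bool (full n) = 0"
    using k N f2 by (simp add: symmetric_cut_def reduced_excess_def)
  have pts: "regular_point ty n n" "regular_point ty n (n + 2)" using N ty by (auto simp: regular_point_def)
  have side: "b \<le> n + 2 \<and> a \<le> n \<or> n + 3 \<le> b \<and> n + 1 \<le> a \<and> (\<forall>c\<le>N. \<not> full c)"
    and par: "n + 1 \<le> a \<Longrightarrow> a \<le> n + 2 \<Longrightarrow> n + 1 \<in> clT \<Longrightarrow> (a = n + 1 \<longleftrightarrow> odd (D (n + 1)))"
    using ex[unfolded C.exchangeable_def] ty by auto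
  have "n \<le> N" using N by simp
  then have side': "b \<le> n + 2 \<and> a \<le> n \<or> n + 3 \<le> b \<and> n + 1 \<le> a \<and> \<not> full n" using side by blast
  consider "b \<le> n" "a \<le> n" | "n + 3 \<le> b" "n + 3 \<le> a" | "b = n + 1 \<or> b = n + 2" "a \<le> n"
    | "n + 3 \<le> b" "a = n + 1 \<or> a = n + 2" "\<not> full n"
  proof -
    have "b \<le> n \<or> b = n + 1 \<or> b = n + 2 \<or> n + 3 \<le> b" "a \<le> n \<or> a = n + 1 \<or> a = n + 2 \<or> n + 3 \<le> a"
      by arith+
    then show thesis using that side' by fastforce
  qed
  then show ?thesis
  proof cases
    case 1
    then show ?thesis unfolding Un_iff clQ cl using c by (auto simp: e(13))
  next
    case 2
    then show ?thesis unfolding Un_iff clQ cl using c by (auto simp: e(13))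
  next
    case 3
    have D2: "1 \<le> D (n + 2)" "1 \<le> D n"
    proof -
      have "point_after ty n b = n + 2" using 3 ty by (auto simp: point_after_def)
      then show "1 \<le> D (n + 2)" using ex[unfolded C.exchangeable_def] by auto
      show "1 \<le> D n" using C.exch_A(2)[OF ex, of n] 3 pts by auto
    qed
    have f: "full n" using kn D2 by (cases "full n") auto
    then have "D n = D (n + 2)" using full_eq[of n] N by auto
    then have "D n = 1" "D (n + 2) = 1" using kn f by auto
    moreover have "odd (D (n + 1))" "n + 1 \<in> T \<or> n + 2 \<in> T" using f fn cl by auto
    ultimately have "b \<in> T"
      using st e(3) 3 by (cases "n + 1 \<in> P"; cases "n + 2 \<in> P"; cases "n + 1 \<in> T"; cases "n + 2 \<in> T") auto
    then show ?thesis unfolding Un_iff clQ cl using c 3 st e(3) by (auto simp: e(13))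
  next
    case 4
    have "1 \<le> D (n + 2)" using C.exch_A(2)[OF ex, of "n + 2"] 4 pts by auto
    then have "D n = 0" using kn 4 by auto
    have P: "n + 1 \<notin> P" "n + 2 \<notin> P" using e(5) 4(2) N unfolding in_clP by auto
    have "n + 1 \<in> T \<or> n + 2 \<in> T" "n + 1 \<in> T \<longleftrightarrow> odd (D (n + 1))"
      using st P \<open>D n = 0\<close> \<open>1 \<le> D (n + 2)\<close> by (auto simp: of_bool_def split: if_splits)
    then have "a \<in> T" using par 4 cl st(4) by auto
    then show ?thesis unfolding Un_iff clQ cl using c 4 st(4) P e(3) by (auto simp: e(13))
  qed
qed

lemma linear_eqs_range: "linear_eqs ty n m P T \<subseteq> {1..N}"
  by (auto simp: linear_eqs_def Let_def)

lemma exch_linear_eqs: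
  assumes ex: "C.exchangeable a b"
  shows "linear_eqs ty n m (exchange a b P) T = linear_eqs ty n m P T"
proof (rule Set.set_eqI)
  fix c
  interpret Q: ordered_pair ty n m "exchange a b P" T by (rule exch_ordered[OF ex])
  show "c \<in> linear_eqs ty n m (exchange a b P) T \<longleftrightarrow> c \<in> linear_eqs ty n m P T"
  proof (cases "1 \<le> c \<and> c \<le> N")
    case False
    then show ?thesis using linear_eqs_range Q.linear_eqs_range by auto
  next
    case cN: True
    show ?thesis
    proof (cases "central_column ty n c")
      case False
      then show ?thesis using exch_linear_eqs_side[OF ex] cN by blast
    next
      case True
      have "regular_point ty n n" by (cases ty) (auto simp: regular_point_def)
      then have KQ: "Q.K n \<longleftrightarrow> K n" by (rule exch_K[OF ex])
      show ?thesis
      proof (cases "ty = Type_B")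
        case True
        then show ?thesis
          using linear_eqs_mid_B Q.linear_eqs_mid_B KQ \<open>central_column ty n c\<close> by (auto simp: central_column_def)
      next
        case False
        then have ty: "ty = Type_D" and "c = n + 1 \<or> c = n + 2" using True by (auto simp: central_column_def)
        then show ?thesis
          unfolding linear_eqs_center[OF ty] Q.linear_eqs_center[OF ty] KQ
          using linear_eqs_center[OF ty] Q.linear_eqs_center[OF ty] KQ
            exch_linear_eqs_center[OF ex ty, of "n + 1"] exch_linear_eqs_center[OF ex ty, of "n + 2"]
          by (elim disjE) metis+
      qed
    qed
  qed
qed

text \<open>Excess at least 2 at x and N - x leaves at least 1 one step further, and defects are
  excluded there. So the points bordering the changed columns are no cuts, and the changes of
  membership are invisible to the equations.\<close>

lemma refl_not_K:
  assumes re: "C.reflectable x b"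
  shows "\<not> K x" "\<not> K (x - 1)" "\<not> central_column ty n b \<Longrightarrow> \<not> K b"
proof -
  note e = C.refl_basic[OF re] and l = refl_large[OF re]
  note r = re[unfolded C.reflectable_def]
  show "\<not> K x" using l by (auto simp: symmetric_cut_def reduced_excess_def)
  have "D x \<le> D (x - 1) + 1" using D_step[OF e(1)] by (auto simp: of_bool_def)
  then have "1 \<le> D (x - 1)" "1 \<le> D (N - (x - 1))" using l r by auto
  moreover have "\<not> full (x - 1)" "\<not> full (N - (x - 1))" using r full_sym[of "x - 1"] e(8) by auto
  ultimately show "\<not> K (x - 1)" by (auto simp: symmetric_cut_def reduced_excess_def)
  show "\<not> K b" if b: "\<not> central_column ty n b"
  proof -
    have nb: "point_after ty n b = b" using b by (auto simp: point_after_def central_column_def)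
    have fb: "\<not> full b" "1 \<le> D b" using r nb by auto
    have "b = x + 1 \<or> x = n \<and> b = n + 2 \<and> ty = Type_B"
      using r b by (cases ty) (auto simp: central_column_def)
    then have "2 \<le> D (N - (b - 1))"
    proof
      assume "x = n \<and> b = n + 2 \<and> ty = Type_B"
      then show ?thesis using l by auto
    qed (use l in auto)
    moreover have "D (N - (b - 1)) \<le> D (N - b) + 1"
      using E_step[of b] e(1,2,4) by (auto simp: of_bool_def)
    ultimately have "1 \<le> D (N - b)" by linarith
    then show ?thesis using fb full_sym[OF e(4)] by (auto simp: symmetric_cut_def reduced_excess_def)
  qed
qed

lemma refl_linear_eqs_side:
  assumes re: "C.reflectable x b" and c: "1 \<le> c" "c \<le> N" "\<not> central_column ty n c"
  shows "c \<in> linear_eqs ty n m (reflect N x b P) T \<longleftrightarrow> c \<in> linear_eqs ty n m P T"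
proof -
  define Q where "Q = reflect N x b P"
  interpret Q: ordered_pair ty n m Q T unfolding Q_def by (rule refl_ordered[OF re])
  note e = C.refl_basic[OF re, folded Q_def] and l = refl_large[OF re] and nK = refl_not_K[OF re]
  note r = re[unfolded C.reflectable_def]
  have side: "ty = Type_D \<Longrightarrow> c \<noteq> n + 1 \<and> c \<noteq> n + 2" using c by (auto simp: central_column_def)
  have pc: "regular_point ty n c" "regular_point ty n (c - 1)"
    using c by (cases "ty = Type_D"; force simp: regular_point_def central_column_def)+
  have bar_mid: "central_column ty n (N + 1 - z) \<longleftrightarrow> central_column ty n z" if "z \<le> N" for z
    using that by (cases ty) (auto simp: central_column_def)
  have KQ: "Q.K z \<longleftrightarrow> K z" if "regular_point ty n z" for z
    using refl_K[OF re that] by (simp add: Q_def)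
  have zQ: "Q.D z = 0 \<longleftrightarrow> D z = 0" if "regular_point ty n z" for z
    using C.refl_exc[OF re that] l by (auto simp: Q_def)
  have b1: "1 \<le> b" using e(1,2) by simp
  have adj: "b = x + 1 \<or> x = n \<and> b = n + 2 \<and> ty = Type_B" if "\<not> central_column ty n b"
    using r that by (cases ty) (auto simp: central_column_def)
  have Dprev: "2 \<le> D (b - 1)" "2 \<le> D (N - (b - 1))" "\<not> K (b - 1)" if "\<not> central_column ty n b"
  proof -
    have "b - 1 = x \<or> b - 1 = N - x \<and> N - (b - 1) = x"
      using adj[OF that] by auto
    then show "2 \<le> D (b - 1)" "2 \<le> D (N - (b - 1))" "\<not> K (b - 1)"
      using l nK(1) K_sym[OF e(8)] by auto
  qed
  have changed: "z \<in> {x, b, N + 1 - x, N + 1 - b}" if "(z \<in> Q) \<noteq> (z \<in> P)" for z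
    using that e(16)[of z] by auto
  have star: "\<not> K c" if "(N + 1 - c \<in> Q) \<noteq> (N + 1 - c \<in> P)"
  proof -
    define y where "y = N + 1 - c"
    have cy: "c = N + 1 - y" "1 \<le> y" "y \<le> N" using c by (auto simp: y_def)
    have "y \<in> {x, b, N + 1 - x, N + 1 - b}" using changed[of y] that by (simp add: y_def)
    then consider "y = x" | "y = b" | "y = N + 1 - x" | "y = N + 1 - b" by blast
    then show ?thesis
    proof cases
      case 1
      then have "c = N - (x - 1)" using cy e(1) by auto
      then show ?thesis using nK(2) K_sym[of "x - 1"] e(8) by auto
    next
      case 2
      then have "c = N - (b - 1)" "\<not> central_column ty n b" using cy b1 e(4) c(3) bar_mid[of b] by auto
      then show ?thesis using Dprev(3) K_sym[of "b - 1"] e(4) by auto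
    next
      case 3
      then have "c = x" using cy e(8) by auto
      then show ?thesis using nK by simp
    next
      case 4
      then have "c = b" using cy e(4) by auto
      then show ?thesis using nK c by simp
    qed
  qed
  have zero: "\<not> (D (c - 1) = 0 \<and> D c = 0)" if ch: "(c \<in> Q) \<noteq> (c \<in> P)"
  proof -
    consider "c = x" | "c = b" | "c = N + 1 - x" | "c = N + 1 - b" using changed[OF ch] by blast
    then show ?thesis
    proof cases
      case 1 then show ?thesis using l by auto
    next
      case 2 then show ?thesis using Dprev(1) c by auto
    next
      case 3
      then have "c - 1 = N - x" by auto
      then show ?thesis using l by auto
    next
      case 4
      then have "c = N - (b - 1)" "\<not> central_column ty n b" using b1 e(4) c bar_mid[of b] by auto
      then show ?thesis using Dprev(2) by auto
    qed
  qed
  have L: "c \<in> linear_eqs ty n m P T \<longleftrightarrow> N + 1 - c \<in> T \<and> K (c - 1) \<or> N + 1 - c \<in> P \<and> K c \<or>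
    c \<notin> P \<and> c \<notin> T \<and> D (c - 1) = 0 \<and> D c = 0"
    by (rule linear_eqs_iff) (use c side in auto)
  have LQ: "c \<in> linear_eqs ty n m Q T \<longleftrightarrow> N + 1 - c \<in> T \<and> Q.K (c - 1) \<or> N + 1 - c \<in> Q \<and> Q.K c \<or>
    c \<notin> Q \<and> c \<notin> T \<and> Q.D (c - 1) = 0 \<and> Q.D c = 0"
    by (rule Q.linear_eqs_iff) (use c side in auto)
  show ?thesis
    unfolding Q_def[symmetric] L LQ KQ[OF pc(1)] KQ[OF pc(2)] zQ[OF pc(1)] zQ[OF pc(2)]
    using star zero by blast
qed

lemma refl_linear_eqs:
  assumes re: "C.reflectable x b"
  shows "linear_eqs ty n m (reflect N x b P) T = linear_eqs ty n m P T"
proof (rule Set.set_eqI)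
  fix c
  interpret Q: ordered_pair ty n m "reflect N x b P" T by (rule refl_ordered[OF re])
  note e = C.refl_basic[OF re]
  show "c \<in> linear_eqs ty n m (reflect N x b P) T \<longleftrightarrow> c \<in> linear_eqs ty n m P T"
  proof (cases "1 \<le> c \<and> c \<le> N")
    case False
    then show ?thesis using linear_eqs_range Q.linear_eqs_range by auto
  next
    case cN: True
    show ?thesis
    proof (cases "central_column ty n c")
      case False
      then show ?thesis using refl_linear_eqs_side[OF re] cN by blast
    next
      case True
      have "regular_point ty n n" by (cases ty) (auto simp: regular_point_def)
      then have KQ: "Q.K n \<longleftrightarrow> K n" by (rule refl_K[OF re])
      show ?thesis
      proof (cases "ty = Type_B")
        case True
        then show ?thesis
          using linear_eqs_mid_B Q.linear_eqs_mid_B KQ \<open>central_column ty n c\<close> by (auto simp: central_column_def)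
      next
        case False
        then have ty: "ty = Type_D" and c: "c = n + 1 \<or> c = n + 2" using True by (auto simp: central_column_def)
        have N: "N = 2 * n + 2" using ty by simp
        \<comment> \<open>If n is a cut then x is not n, so the reflection takes place away from the
          centre.\<close>
        have same: "z \<in> reflect N x b P \<longleftrightarrow> z \<in> P" if "K n" "z = n + 1 \<or> z = n + 2" for z
        proof -
          have r: "\<not> central_column ty n x" "b = x + 1 \<or> x = n \<and> b = n + 2"
            using re[unfolded C.reflectable_def] by auto
          have "x \<noteq> n" using refl_not_K(1)[OF re] that by auto
          then have "x \<notin> {n, n + 1, n + 2}" "b = x + 1" using r ty by (auto simp: central_column_def)
          then show ?thesis unfolding e(16) using that(2) N e(4,8) by auto
        qed
        show ?thesis
          using c linear_eqs_center[OF ty] Q.linear_eqs_center[OF ty] KQ same[of "n + 1"] same[of "n + 2"]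
            C.refl_closure[OF re] by auto
      qed
    qed
  qed
qed

lemma quadratic_eqs_eq:
  assumes "ordered_pair ty n m Q T" "\<And>c. regular_point ty n c \<Longrightarrow> symmetric_cut ty n Q T c \<longleftrightarrow> K c"
  shows "quadratic_eqs ty n m Q T = quadratic_eqs ty n m P T"
proof -
  interpret Q: ordered_pair ty n m Q T by fact
  have "{0..n} \<inter> cuts ty n m Q T = {0..n} \<inter> cuts ty n m P T"
  proof -
    have "regular_point ty n c" if "c \<le> n" for c using that by (cases ty) (auto simp: regular_point_def)
    then show ?thesis using cuts_iff Q.cuts_iff assms(2) by auto
  qed
  then show ?thesis by (simp add: quadratic_eqs_def)
qed

lemma cut_step:
  assumes "C.bad b"
  shows "\<exists>Q. ordered_pair ty n m Q T \<and> lowers ty n m P Q \<and> \<Sum>Q < \<Sum>P \<and>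
    linear_eqs ty n m Q T = linear_eqs ty n m P T \<and> quadratic_eqs ty n m Q T = quadratic_eqs ty n m P T"
proof -
  obtain Q where Q: "lowers ty n m P Q" "\<Sum>Q < \<Sum>P"
    "(\<exists>a b. C.exchangeable a b \<and> Q = exchange a b P) \<or> (\<exists>x b. C.reflectable x b \<and> Q = reflect N x b P)"
    using C.move_down[OF assms] by blast
  from Q(3) show ?thesis
  proof (elim disjE exE conjE)
    fix a b assume ab: "C.exchangeable a b" "Q = exchange a b P"
    then show ?thesis
      using Q(1,2) exch_ordered[OF ab(1)] exch_linear_eqs[OF ab(1)]
        quadratic_eqs_eq[OF exch_ordered[OF ab(1)] exch_K[OF ab(1)]] by blast
  next
    fix x b assume ab: "C.reflectable x b" "Q = reflect N x b P"
    then show ?thesis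
      using Q(1,2) refl_ordered[OF ab(1)] refl_linear_eqs[OF ab(1)]
        quadratic_eqs_eq[OF refl_ordered[OF ab(1)] refl_K[OF ab(1)]] by blast
  qed
qed

lemma cut_step_or_arrow:
  shows "(\<exists>Q. ordered_pair ty n m Q T \<and> lowers ty n m P Q \<and> \<Sum>Q < \<Sum>P \<and>
    linear_eqs ty n m Q T = linear_eqs ty n m P T \<and> quadratic_eqs ty n m Q T = quadratic_eqs ty n m P T) \<or>
    (\<forall>i\<in>{1..m - 1}. entry N P i \<le> entry N T (i + 1) \<or>
      (ty = Type_D \<and> entry N P i = n + 2 \<and> entry N T (i + 1) = n + 1)) \<and>
    (\<forall>i\<in>{1..m - 1}. entry N P i = entry N T (i + 1) \<longrightarrow> entry N P i \<notin> cuts ty n m P T)"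
  using cut_step arrow_if_not_bad by blast

end

section \<open>Descent on the sum of the elements of P\<close>

lemma lowering_chain:
  assumes "ordered_pair ty n m P T"
  shows "(lowers ty n m)\<^sup>*\<^sup>* P T"
  using assms
proof (induction "\<Sum>P" arbitrary: P rule: less_induct)
  case less
  interpret ordered_pair ty n m P T by fact
  show ?case
  proof (cases "P = T")
    case False
    then obtain Q where Q: "Q \<in> schubert_symbols N m" "lowers ty n m P Q" "comb_le ty n T Q" "\<Sum>Q < \<Sum>P"
      using order_step by blast
    then have "ordered_pair ty n m Q T"
      using T_symbol by (simp add: ordered_pair_def symbol_pair_def ordered_pair_axioms_def)
    then show ?thesis using less.hyps Q by (meson converse_rtranclp_into_rtranclp)
  qed simp
qed

lemma lowering_to_arrow:
  assumes "ordered_pair ty n m P T"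
  shows "\<exists>Q. ordered_pair ty n m Q T \<and> (lowers ty n m)\<^sup>*\<^sup>* P Q \<and>
    linear_eqs ty n m Q T = linear_eqs ty n m P T \<and> quadratic_eqs ty n m Q T = quadratic_eqs ty n m P T \<and>
    (\<forall>i\<in>{1..m - 1}. entry (ambient_dim ty n) Q i \<le> entry (ambient_dim ty n) T (i + 1) \<or>
      (ty = Type_D \<and> entry (ambient_dim ty n) Q i = n + 2 \<and> entry (ambient_dim ty n) T (i + 1) = n + 1)) \<and>
    (\<forall>i\<in>{1..m - 1}. entry (ambient_dim ty n) Q i = entry (ambient_dim ty n) T (i + 1) \<longrightarrow>
      entry (ambient_dim ty n) Q i \<notin> cuts ty n m Q T)"
  using assms
proof (induction "\<Sum>P" arbitrary: P rule: less_induct)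
  case less
  interpret ordered_pair ty n m P T by fact
  from cut_step_or_arrow show ?case
  proof (elim disjE exE conjE)
    fix Q assume Q: "ordered_pair ty n m Q T" "lowers ty n m P Q" "\<Sum>Q < \<Sum>P"
      "linear_eqs ty n m Q T = linear_eqs ty n m P T" "quadratic_eqs ty n m Q T = quadratic_eqs ty n m P T"
    show ?thesis
      using less.hyps[OF Q(3,1)] unfolding Q(4,5)
      using converse_rtranclp_into_rtranclp[of "lowers ty n m", OF Q(2)] by blast
  next
    assume "\<forall>i\<in>{1..m - 1}. entry N P i \<le> entry N T (i + 1) \<or>
      (ty = Type_D \<and> entry N P i = n + 2 \<and> entry N T (i + 1) = n + 1)"
      "\<forall>i\<in>{1..m - 1}. entry N P i = entry N T (i + 1) \<longrightarrow> entry N P i \<notin> cuts ty n m P T"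
    then show ?thesis using less.prems by blast
  qed
qed

section \<open>Coordinates and flags\<close>

lemma underdetermined_system:
  fixes M :: "'b \<Rightarrow> 'a \<Rightarrow> 'f :: field"
  assumes "finite B" "finite A" "card B < card A"
  shows "\<exists>a. (\<exists>p\<in>A. a p \<noteq> 0) \<and> (\<forall>t\<in>B. (\<Sum>p\<in>A. a p * M t p) = 0)"
  using assms
proof (induction B arbitrary: A M rule: finite_induct)
  case empty
  then obtain p where "p \<in> A" by fastforce
  then show ?case by (intro exI[of _ "\<lambda>_. 1"]) auto
next
  case (insert t B)
  show ?case
  proof (cases "\<forall>p\<in>A. M t p = 0")
    case True
    obtain a where "\<exists>p\<in>A. a p \<noteq> 0" "\<forall>t\<in>B. (\<Sum>p\<in>A. a p * M t p) = 0"
      using insert.IH[of A M] insert.prems insert.hyps by auto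
    then show ?thesis using True by (intro exI[of _ a]) auto
  next
    case False
    then obtain p0 where p0: "p0 \<in> A" "M t p0 \<noteq> 0" by blast
    define A' where "A' = A - {p0}"
    have A': "finite A'" "A = insert p0 A'" "p0 \<notin> A'" using insert.prems p0 by (auto simp: A'_def)
    have "card B < card A'" using insert A' by simp
    then obtain a where a: "\<exists>p\<in>A'. a p \<noteq> 0"
      "\<forall>s\<in>B. (\<Sum>p\<in>A'. a p * (M s p - M s p0 * M t p / M t p0)) = 0"
      using insert.IH[of A' "\<lambda>s p. M s p - M s p0 * M t p / M t p0"] A'(1) by blast
    define c where "c = - (\<Sum>p\<in>A'. a p * M t p) / M t p0"
    define a' where "a' = a(p0 := c)"
    have split: "(\<Sum>p\<in>A. a' p * M s p) = c * M s p0 + (\<Sum>p\<in>A'. a p * M s p)" for s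
    proof -
      have "(\<Sum>p\<in>A'. a' p * M s p) = (\<Sum>p\<in>A'. a p * M s p)"
        using A'(3) by (intro sum.cong) (auto simp: a'_def)
      then show ?thesis unfolding A'(2) using A'(1,3) by (simp add: a'_def)
    qed
    have "(\<Sum>p\<in>A. a' p * M s p) = 0" if "s \<in> B" for s
    proof -
      have "c * M s p0 + (\<Sum>p\<in>A'. a p * M s p) = (\<Sum>p\<in>A'. a p * (M s p - M s p0 * M t p / M t p0))"
        by (simp add: c_def sum_subtractf right_diff_distrib sum_distrib_left sum_divide_distrib
            sum_negf mult_ac)
      then show ?thesis using split a(2) that by auto
    qed
    moreover have "(\<Sum>p\<in>A. a' p * M t p) = 0" using split p0(2) by (simp add: c_def)
    moreover have "\<exists>p\<in>A. a' p \<noteq> 0" using a(1) A' by (auto simp: a'_def)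
    ultimately show ?thesis by (intro exI[of _ a']) auto
  qed
qed

text \<open>Transposition gives det M = (-1)^k det M, so a complex skew-symmetric matrix of odd size
  is singular.\<close>

lemma odd_skew_kernel:
  fixes S :: "'a :: linorder \<Rightarrow> 'a \<Rightarrow> complex"
  assumes "finite A" "odd (card A)" and skew: "\<And>p q. p \<in> A \<Longrightarrow> q \<in> A \<Longrightarrow> S p q = - S q p"
  shows "\<exists>a. (\<exists>q\<in>A. a q \<noteq> 0) \<and> (\<forall>p\<in>A. (\<Sum>q\<in>A. a q * S p q) = 0)"
proof -
  define k where "k = card A"
  define f where "f i = sorted_list_of_set A ! i" for i
  have bij: "bij_betw f {0..<k} A"
    using bij_betw_nth[of "sorted_list_of_set A" "{0..<k}" A] assms(1)
    by (simp add: f_def[abs_def] k_def atLeast0LessThan)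
  then have fA: "f i \<in> A" if "i < k" for i using that by (auto simp: bij_betw_def)
  define M where "M = Matrix.mat k k (\<lambda>(i, j). S (f i) (f j))"
  have M: "M \<in> carrier_mat k k" by (simp add: M_def)
  have "transpose_mat M = (-1) \<cdot>\<^sub>m M"
    by (rule eq_matI) (auto simp: M_def intro: skew fA)
  then have "Determinant.det M = (-1) ^ k * Determinant.det M"
    using det_transpose[OF M] det_smult[of "-1" M] M by auto
  then have "Determinant.det M = 0" using assms(2) by (simp add: k_def)
  then obtain v where v: "v \<in> carrier_vec k" "v \<noteq> 0\<^sub>v k" "M *\<^sub>v v = 0\<^sub>v k"
    using det_0_iff_vec_prod_zero[OF M] by blast
  define g where "g = the_inv_into {0..<k} f"
  have g: "g (f i) = i" if "i < k" for i
    unfolding g_def using bij that by (intro the_inv_into_f_f) (auto simp: bij_betw_def)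
  define a where "a q = vec_index v (g q)" for q
  obtain i where "i < k" "vec_index v i \<noteq> 0" using v(1,2) by (metis carrier_vecD eq_vecI index_zero_vec(1) index_zero_vec(2))
  then have "\<exists>q\<in>A. a q \<noteq> 0" using fA g by (auto simp: a_def intro!: bexI[of _ "f i"])
  moreover have "(\<Sum>q\<in>A. a q * S p q) = 0" if pA: "p \<in> A" for p
  proof -
    obtain i where i: "i < k" "f i = p" using bij pA by (force simp: bij_betw_def)
    have "(\<Sum>q\<in>A. a q * S p q) = (\<Sum>j\<in>{0..<k}. a (f j) * S p (f j))"
      using sum.reindex_bij_betw[OF bij, of "\<lambda>q. a q * S p q"] by simp
    also have "\<dots> = (\<Sum>j\<in>{0..<k}. M $$ (i, j) * vec_index v j)"
      by (rule sum.cong) (use i g in \<open>auto simp: a_def M_def\<close>)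
    also have "\<dots> = vec_index (M *\<^sub>v v) i"
      using i v(1) M by (auto simp: scalar_prod_def intro!: sum.cong)
    finally show ?thesis using v(3) i by simp
  qed
  ultimately show ?thesis by blast
qed

section \<open>Coordinates, echelon families and jump sets\<close>

context isotropic_setting
begin

abbreviation "N \<equiv> ambient_dim ty n"
abbreviation "X \<equiv> basis_coord N e"
abbreviation flag :: "nat \<Rightarrow> (complex ^ 'n) set" where "flag c \<equiv> vec.span (e ` {1..c})"

lemma coord_add: "X c (u + v) = X c u + X c v"
  unfolding basis_coord_def using vec.representation_add[OF basis_independent] basis_span by simp

lemma coord_scale: "X c (a *s v) = a * X c v"
  unfolding basis_coord_def using vec.representation_scale[OF basis_independent] basis_span by simp

lemma coord_zero: "X c 0 = 0"
  unfolding basis_coord_def by (simp add: vec.representation_zero)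

lemma coord_sum: "X c (\<Sum>i\<in>I. f i) = (\<Sum>i\<in>I. X c (f i))"
  by (induction I rule: infinite_finite_induct) (auto simp: coord_add coord_zero)

lemma coord_diff: "X c (u - v) = X c u - X c v"
  using coord_add[of c u "(-1) *s v"] coord_scale[of c "-1" v] by simp

lemma coord_basis: "i \<in> {1..N} \<Longrightarrow> c \<in> {1..N} \<Longrightarrow> X c (e i) = of_bool (c = i)"
  unfolding basis_coord_def using vec.representation_basis[OF basis_independent] basis_inj
  by (auto simp: inj_on_eq_iff)

lemma coord_expand: "(\<Sum>i\<in>{1..N}. X i v *s e i) = v"
proof -
  have "(\<Sum>b\<in>e ` {1..N}. vec.representation (e ` {1..N}) v b *s b) = v"
    by (rule vec.sum_representation_eq[OF basis_independent]) (use basis_span in auto)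
  then show ?thesis unfolding sum.reindex[OF basis_inj] by (simp add: basis_coord_def o_def)
qed

lemma mem_flag_iff:
  assumes "c \<le> N"
  shows "v \<in> flag c \<longleftrightarrow> (\<forall>i\<in>{1..N}. c < i \<longrightarrow> X i v = 0)"
proof
  assume "v \<in> flag c"
  moreover have "flag c \<subseteq> {v. \<forall>i\<in>{1..N}. c < i \<longrightarrow> X i v = 0}"
  proof (rule vec.span_minimal)
    show "e ` {1..c} \<subseteq> {v. \<forall>i\<in>{1..N}. c < i \<longrightarrow> X i v = 0}"
      using assms by (auto simp: coord_basis)
    show "vec.subspace {v. \<forall>i\<in>{1..N}. c < i \<longrightarrow> X i v = 0}"
      by (auto simp: vec.subspace_def coord_add coord_scale coord_zero)
  qed
  ultimately show "\<forall>i\<in>{1..N}. c < i \<longrightarrow> X i v = 0" by blast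
next
  assume z: "\<forall>i\<in>{1..N}. c < i \<longrightarrow> X i v = 0"
  have "X i v *s e i \<in> flag c" if "i \<in> {1..N}" for i
  proof (cases "i \<le> c")
    case True
    then show ?thesis using that by (intro vec.span_scale vec.span_base) auto
  next
    case False
    then show ?thesis using z that by (auto simp: vec.span_zero)
  qed
  then show "v \<in> flag c" using vec.span_sum[of "{1..N}" "\<lambda>i. X i v *s e i"] coord_expand[of v] by simp
qed

lemma flag_mono: "c \<le> d \<Longrightarrow> flag c \<subseteq> flag d"
  by (intro vec.span_mono image_mono) auto

lemma mem_flag_prev:
  assumes "1 \<le> c" "c \<le> N"
  shows "v \<in> flag (c - 1) \<longleftrightarrow> v \<in> flag c \<and> X c v = 0"
proof
  assume v: "v \<in> flag (c - 1)"
  have "\<forall>i\<in>{1..N}. c - 1 < i \<longrightarrow> X i v = 0" using v mem_flag_iff[of "c - 1" v] assms by simp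
  then have "X c v = 0" using assms by simp
  then show "v \<in> flag c \<and> X c v = 0" using v flag_mono[of "c - 1" c] by auto
next
  assume "v \<in> flag c \<and> X c v = 0"
  then have z: "\<forall>i\<in>{1..N}. c < i \<longrightarrow> X i v = 0" "X c v = 0" using mem_flag_iff[OF assms(2)] by blast+
  have "X i v = 0" if "i \<in> {1..N}" "c - 1 < i" for i
    using z that by (cases "i = c") auto
  then show "v \<in> flag (c - 1)" using mem_flag_iff[of "c - 1" v] assms by simp
qed

lemma mem_jump_set_iff:
  assumes "vec.subspace S"
  shows "c \<in> jump_set N e S \<longleftrightarrow> c \<in> {1..N} \<and> (\<exists>v\<in>S. v \<in> flag c \<and> X c v \<noteq> 0)"
proof (cases "c \<in> {1..N}")
  case True
  have "S \<inter> flag (c - 1) \<subset> S \<inter> flag c \<longleftrightarrow> (\<exists>v\<in>S. v \<in> flag c \<and> v \<notin> flag (c - 1))"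
    using flag_mono[OF diff_le_self[of c 1]] by blast
  then show ?thesis using True mem_flag_prev[of c] by (auto simp: jump_set_def)
qed (auto simp: jump_set_def)

text \<open>The leading positions are distinct, so the largest one among the terms with nonzero
  coefficient cannot be cancelled.\<close>

lemma echelon_leading:
  assumes "finite J" and lead: "\<And>p. p \<in> J \<Longrightarrow> \<sigma> p \<in> {1..N} \<and> w p \<in> flag (\<sigma> p) \<and> X (\<sigma> p) (w p) \<noteq> 0"
    and inj: "inj_on \<sigma> J" and nz: "\<exists>p\<in>J. a p \<noteq> 0"
  obtains p where "p \<in> J" "a p \<noteq> 0" "(\<Sum>q\<in>J. a q *s w q) \<in> flag (\<sigma> p)"
    "X (\<sigma> p) (\<Sum>q\<in>J. a q *s w q) \<noteq> 0"
proof -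
  define J' where "J' = {p \<in> J. a p \<noteq> 0}"
  have J': "finite J'" "J' \<noteq> {}" using assms by (auto simp: J'_def)
  have "Max (\<sigma> ` J') \<in> \<sigma> ` J'" by (rule Max_in) (use J' in auto)
  then obtain p where p: "p \<in> J'" "\<sigma> p = Max (\<sigma> ` J')" by auto
  have pJ: "p \<in> J" "a p \<noteq> 0" using p by (auto simp: J'_def)
  have max: "\<sigma> q < \<sigma> p" if "q \<in> J'" "q \<noteq> p" for q
  proof -
    have "\<sigma> q \<le> \<sigma> p" using p J' that by simp
    moreover have "\<sigma> q \<noteq> \<sigma> p" using inj that p(1) unfolding J'_def inj_on_def by blast
    ultimately show ?thesis by simp
  qed
  have other: "a q * X i (w q) = 0" if "q \<in> J" "q \<noteq> p" "i \<in> {1..N}" "\<sigma> p \<le> i" for q i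
  proof (cases "a q = 0")
    case False
    then have "\<sigma> q < i" using max[of q] that by (auto simp: J'_def)
    then show ?thesis using lead[OF that(1)] mem_flag_iff[of "\<sigma> q" "w q"] that(3) by auto
  qed simp
  have coord: "X i (\<Sum>q\<in>J. a q *s w q) = a p * X i (w p)" if "i \<in> {1..N}" "\<sigma> p \<le> i" for i
  proof -
    have "X i (\<Sum>q\<in>J. a q *s w q) = (\<Sum>q\<in>J. a q * X i (w q))" by (simp add: coord_sum coord_scale)
    also have "\<dots> = a p * X i (w p) + (\<Sum>q\<in>J - {p}. a q * X i (w q))"
      using assms(1) pJ by (simp add: sum.remove)
    also have "(\<Sum>q\<in>J - {p}. a q * X i (w q)) = 0" using other that by (intro sum.neutral) auto
    finally show ?thesis by simp
  qed
  note lp = lead[OF pJ(1)]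
  have "(\<Sum>q\<in>J. a q *s w q) \<in> flag (\<sigma> p)"
    using lp coord mem_flag_iff[of "\<sigma> p"] by (auto simp: mem_flag_iff)
  moreover have "X (\<sigma> p) (\<Sum>q\<in>J. a q *s w q) \<noteq> 0" using coord[of "\<sigma> p"] lp pJ by auto
  ultimately show thesis using that pJ by blast
qed

lemma span_image_sum:
  assumes "finite J" "v \<in> vec.span (w ` J)"
  obtains a where "v = (\<Sum>p\<in>J. a p *s w p)"
proof -
  have "vec.span (w ` J) \<subseteq> range (\<lambda>a. \<Sum>p\<in>J. a p *s w p)"
  proof (rule vec.span_minimal)
    show "w ` J \<subseteq> range (\<lambda>a. \<Sum>p\<in>J. a p *s w p)"
    proof
      fix x assume "x \<in> w ` J"
      then obtain p where p: "p \<in> J" "x = w p" by blast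
      have "(\<Sum>q\<in>J. of_bool (q = p) *s w q) = (\<Sum>q\<in>J. if q = p then w q else 0)"
        by (rule sum.cong) auto
      also have "\<dots> = x" using assms(1) p by simp
      finally show "x \<in> range (\<lambda>a. \<Sum>p\<in>J. a p *s w p)" by (intro image_eqI[of _ _ "\<lambda>q. of_bool (q = p)"]) auto
    qed
    show "vec.subspace (range (\<lambda>a. \<Sum>p\<in>J. a p *s w p))"
      unfolding vec.subspace_def
    proof (intro conjI ballI allI)
      show "0 \<in> range (\<lambda>a. \<Sum>p\<in>J. a p *s w p)" by (intro image_eqI[of _ _ "\<lambda>_. 0"]) auto
      fix x y c assume "x \<in> range (\<lambda>a. \<Sum>p\<in>J. a p *s w p)"
      then obtain a where a: "x = (\<Sum>p\<in>J. a p *s w p)" by blast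
      show "c *s x \<in> range (\<lambda>a. \<Sum>p\<in>J. a p *s w p)"
        unfolding a by (intro image_eqI[of _ _ "\<lambda>p. c * a p"]) (auto simp: vec.scale_sum_right)
      assume "y \<in> range (\<lambda>a. \<Sum>p\<in>J. a p *s w p)"
      then obtain b where b: "y = (\<Sum>p\<in>J. b p *s w p)" by blast
      show "x + y \<in> range (\<lambda>a. \<Sum>p\<in>J. a p *s w p)"
        unfolding a b
        by (intro image_eqI[of _ _ "\<lambda>p. a p + b p"]) (auto simp: sum.distrib vec.scale_left_distrib)
    qed
  qed
  then show thesis using that assms(2) by blast
qed

lemma echelon:
  assumes fin: "finite J" and lead: "\<And>p. p \<in> J \<Longrightarrow> \<sigma> p \<in> {1..N} \<and> w p \<in> flag (\<sigma> p) \<and> X (\<sigma> p) (w p) \<noteq> 0"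
    and inj: "inj_on \<sigma> J"
  shows "inj_on w J" "vec.independent (w ` J)" "jump_set N e (vec.span (w ` J)) = \<sigma> ` J"
proof -
  have indep: "\<forall>p\<in>J. a p = 0" if "(\<Sum>p\<in>J. a p *s w p) = 0" for a
  proof (rule ccontr)
    assume "\<not> ?thesis"
    then have nz: "\<exists>p\<in>J. a p \<noteq> 0" by blast
    obtain p where "X (\<sigma> p) (\<Sum>q\<in>J. a q *s w q) \<noteq> 0"
      by (rule echelon_leading[OF fin lead inj nz])
    then show False using that by (simp add: coord_zero)
  qed
  show inj_w: "inj_on w J"
  proof (rule inj_onI, rule ccontr)
    fix p q assume pq: "p \<in> J" "q \<in> J" "w p = w q" "p \<noteq> q"
    define a :: "_ \<Rightarrow> complex" where "a r = of_bool (r = p) - of_bool (r = q)" for r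
    have "(\<Sum>r\<in>J. a r *s w r) = (\<Sum>r\<in>J. (if r = p then w r else 0) - (if r = q then w r else 0))"
      by (rule sum.cong) (auto simp: a_def)
    also have "\<dots> = 0" using pq fin by (simp add: sum_subtractf)
    finally show False using indep[of a] pq by (auto simp: a_def)
  qed
  show "vec.independent (w ` J)"
  proof -
    have "\<forall>v\<in>w ` J. u v = 0" if "(\<Sum>v\<in>w ` J. u v *s v) = 0" for u
      using indep[of "u \<circ> w"] that by (auto simp: sum.reindex[OF inj_w])
    then show ?thesis using vec.dependent_finite[of "w ` J"] fin by blast
  qed
  show "jump_set N e (vec.span (w ` J)) = \<sigma> ` J"
  proof (rule Set.set_eqI)
    fix c
    show "c \<in> jump_set N e (vec.span (w ` J)) \<longleftrightarrow> c \<in> \<sigma> ` J"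
    proof
      assume "c \<in> jump_set N e (vec.span (w ` J))"
      then obtain v where v: "v \<in> vec.span (w ` J)" "v \<in> flag c" "X c v \<noteq> 0" "c \<in> {1..N}"
        using mem_jump_set_iff[OF vec.subspace_span] by blast
      obtain a where a: "v = (\<Sum>p\<in>J. a p *s w p)" using span_image_sum[OF fin v(1)] .
      have nz: "\<exists>p\<in>J. a p \<noteq> 0"
      proof (rule ccontr)
        assume "\<not> ?thesis"
        then have "v = 0" by (simp add: a)
        then show False using v(3) by (simp add: coord_zero)
      qed
      obtain p where p: "p \<in> J" "v \<in> flag (\<sigma> p)" "X (\<sigma> p) v \<noteq> 0"
        unfolding a by (rule echelon_leading[OF fin lead inj nz])
      have "\<not> c < \<sigma> p" using v p lead[OF p(1)] mem_flag_iff[of c v] by auto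
      moreover have "\<not> \<sigma> p < c" using v p lead[OF p(1)] mem_flag_iff[of "\<sigma> p" v] by auto
      ultimately show "c \<in> \<sigma> ` J" using p by auto
    next
      assume "c \<in> \<sigma> ` J"
      then obtain p where p: "p \<in> J" "c = \<sigma> p" by blast
      then have "w p \<in> vec.span (w ` J)" by (intro vec.span_base imageI)
      then show "c \<in> jump_set N e (vec.span (w ` J))"
        unfolding mem_jump_set_iff[OF vec.subspace_span] using lead[OF p(1)] p by blast
    qed
  qed
qed

lemma jump_vectors:
  assumes S: "vec.subspace S"
  obtains v where "\<And>p. p \<in> jump_set N e S \<Longrightarrow> v p \<in> S \<and> v p \<in> flag p \<and> X p (v p) = 1"
proof -
  have "\<exists>v. v \<in> S \<and> v \<in> flag p \<and> X p v = 1" if pJ: "p \<in> jump_set N e S" for p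
  proof -
    obtain v where v: "v \<in> S" "v \<in> flag p" "X p v \<noteq> 0" using pJ[unfolded mem_jump_set_iff[OF S]] by blast
    have "inverse (X p v) *s v \<in> S" using S v(1) by (rule vec.subspace_scale)
    moreover have "inverse (X p v) *s v \<in> flag p" using v(2) by (rule vec.span_scale)
    moreover have "X p (inverse (X p v) *s v) = 1" using v(3) by (simp add: coord_scale)
    ultimately show ?thesis by blast
  qed
  then show thesis using that by metis
qed

text \<open>Elimination from the top: subtracting a multiple of the vector with the same leading
  position moves u one step down the flag.\<close>

lemma jump_vectors_span:
  assumes S: "vec.subspace S"
    and v: "\<And>p. p \<in> jump_set N e S \<Longrightarrow> v p \<in> S \<and> v p \<in> flag p \<and> X p (v p) \<noteq> 0"
  shows "vec.span (v ` jump_set N e S) = S"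
proof
  show "vec.span (v ` jump_set N e S) \<subseteq> S" using v S by (intro vec.span_minimal) auto
  have "u \<in> vec.span (v ` jump_set N e S)" if "u \<in> S" "u \<in> flag c" "c \<le> N" for u c
    using that
  proof (induction c arbitrary: u)
    case 0
    then show ?case by (simp add: vec.span_zero)
  next
    case (Suc c)
    define u' where "u' = u - (X (Suc c) u / X (Suc c) (v (Suc c))) *s v (Suc c)"
    show ?case
    proof (cases "X (Suc c) u = 0")
      case True
      then show ?thesis using Suc mem_flag_prev[of "Suc c"] by auto
    next
      case False
      then have J: "Suc c \<in> jump_set N e S" using Suc.prems by (auto simp: mem_jump_set_iff[OF S])
      note vj = v[OF J]
      have "u' \<in> S" using vj Suc.prems S by (auto simp: u'_def intro: vec.subspace_diff vec.subspace_scale)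
      moreover have "u' \<in> flag (Suc c)" using vj Suc.prems by (auto simp: u'_def intro: vec.span_diff vec.span_scale)
      moreover have "X (Suc c) u' = 0" using vj by (simp add: u'_def coord_diff coord_scale)
      ultimately have "u' \<in> vec.span (v ` jump_set N e S)"
        using Suc.IH[of u'] Suc.prems mem_flag_prev[of "Suc c" u'] by auto
      moreover have "v (Suc c) \<in> vec.span (v ` jump_set N e S)" using J by (intro vec.span_base) auto
      ultimately have "u' + (X (Suc c) u / X (Suc c) (v (Suc c))) *s v (Suc c) \<in> vec.span (v ` jump_set N e S)"
        by (intro vec.span_add vec.span_scale)
      then show ?thesis by (simp add: u'_def)
    qed
  qed
  then show "S \<subseteq> vec.span (v ` jump_set N e S)" using basis_span by blast
qed

lemma form_add_left: "\<omega> (x + y) z = \<omega> x z + \<omega> y z"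
  and form_scale_left: "\<omega> (a *s x) z = a * \<omega> x z"
  and form_add_right: "\<omega> z (x + y) = \<omega> z x + \<omega> z y"
  and form_scale_right: "\<omega> z (a *s x) = a * \<omega> z x"
  using linear_left[of z] linear_right[of z] unfolding Vector_Spaces.linear_iff by auto

lemma form_zero: "\<omega> 0 z = 0" "\<omega> z 0 = 0"
  using form_scale_left[of 0 0 z] form_scale_right[of z 0 0] by auto

lemma form_diff_left: "\<omega> (x - y) z = \<omega> x z - \<omega> y z"
  and form_diff_right: "\<omega> z (x - y) = \<omega> z x - \<omega> z y"
  using form_add_left[of x "(-1) *s y" z] form_scale_left[of "-1" y z]
    form_add_right[of z x "(-1) *s y"] form_scale_right[of z "-1" y] by simp_all

lemma form_sum_left: "\<omega> (\<Sum>i\<in>I. f i) z = (\<Sum>i\<in>I. \<omega> (f i) z)"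
  by (induction I rule: infinite_finite_induct) (auto simp: form_add_left form_zero)

lemma form_sum_right: "\<omega> z (\<Sum>i\<in>I. f i) = (\<Sum>i\<in>I. \<omega> z (f i))"
  by (induction I rule: infinite_finite_induct) (auto simp: form_add_right form_zero)

lemma form_basis_zero: "i \<in> {1..N} \<Longrightarrow> j \<in> {1..N} \<Longrightarrow> i + j \<noteq> N + 1 \<Longrightarrow> \<omega> (e i) (e j) = 0"
  using form_basis[of i j] form_basis[of j i] symmetry[of "e j" "e i"] by (cases "i \<le> j") (auto split: if_splits)

lemma form_basis_nonzero: "i \<in> {1..N} \<Longrightarrow> \<omega> (e i) (e (N + 1 - i)) \<noteq> 0"
proof -
  assume i: "i \<in> {1..N}"
  let ?j = "N + 1 - i"
  have j: "?j \<in> {1..N}" "i + ?j = N + 1" using i by auto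
  show ?thesis
  proof (cases "i \<le> ?j")
    case True
    then show ?thesis using form_basis[of i ?j] i j by auto
  next
    case False
    then show ?thesis using form_basis[of ?j i] symmetry[of "e ?j" "e i"] i j by (auto split: if_splits)
  qed
qed

lemma form_basis_left:
  assumes "j \<in> {1..N}"
  shows "\<omega> (e j) v = X (N + 1 - j) v * \<omega> (e j) (e (N + 1 - j))"
proof -
  have "\<omega> (e j) v = \<omega> (e j) (\<Sum>i\<in>{1..N}. X i v *s e i)" by (simp only: coord_expand)
  also have "\<dots> = (\<Sum>i\<in>{1..N}. X i v * \<omega> (e j) (e i))" by (simp add: form_sum_right form_scale_right)
  also have "\<dots> = (\<Sum>i\<in>{N + 1 - j}. X i v * \<omega> (e j) (e i))"
    by (rule sum.mono_neutral_right) (use assms form_basis_zero in auto)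
  finally show ?thesis by simp
qed

lemma form_expand: "\<omega> u v = (\<Sum>i\<in>{1..N}. X i u * X (N + 1 - i) v * \<omega> (e i) (e (N + 1 - i)))"
proof -
  have "\<omega> u v = \<omega> (\<Sum>i\<in>{1..N}. X i u *s e i) v" by (simp only: coord_expand)
  also have "\<dots> = (\<Sum>i\<in>{1..N}. X i u * \<omega> (e i) v)" by (simp add: form_sum_left form_scale_left)
  also have "\<dots> = (\<Sum>i\<in>{1..N}. X i u * X (N + 1 - i) v * \<omega> (e i) (e (N + 1 - i)))"
  proof (rule sum.cong[OF refl])
    fix i assume "i \<in> {1..N}"
    then have "\<omega> (e i) v = X (N + 1 - i) v * \<omega> (e i) (e (N + 1 - i))" by (rule form_basis_left)
    then show "X i u * \<omega> (e i) v = X i u * X (N + 1 - i) v * \<omega> (e i) (e (N + 1 - i))"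
      by (simp only: mult.assoc)
  qed
  finally show ?thesis .
qed

end

section \<open>Bases adapted to a point of a cell\<close>

context isotropic_setting
begin

text \<open>Bases with the same Gram matrix and the same flags as e: its orbit under the Borel
  subgroup of the isometry group.\<close>

definition same_flags :: "(nat \<Rightarrow> complex ^ 'n) \<Rightarrow> bool" where
  "same_flags e' \<longleftrightarrow> isotropic_setting ty n \<omega> e' \<and> (\<forall>c\<le>N. vec.span (e' ` {1..c}) = flag c)"

lemma same_flags_refl: "same_flags e"
  by (simp add: same_flags_def isotropic_setting_axioms)

lemma same_flags_jump_set:
  assumes "same_flags e'"
  shows "jump_set N e' S = jump_set N e S"
proof -
  have eq: "vec.span (e' ` {1..c}) = flag c" if "c \<le> N" for c using assms that by (simp add: same_flags_def)
  show ?thesis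
    unfolding jump_set_def
  proof (intro Collect_cong conj_cong refl)
    fix c assume c: "c \<in> {1..N}"
    then have "c - 1 \<le> N" "c \<le> N" by auto
    then show "(S \<inter> vec.span (e' ` {1..c - 1}) \<subset> S \<inter> vec.span (e' ` {1..c})) =
        (S \<inter> flag (c - 1) \<subset> S \<inter> flag c)"
      by (simp only: eq)
  qed
qed

lemma flag_dim:
  assumes "c \<le> N"
  shows "vec.dim (flag c) = c"
proof -
  have sub: "{1..c} \<subseteq> {1..N}" using assms by auto
  have "vec.independent (e ` {1..c})"
    by (rule vec.independent_mono[OF basis_independent image_mono[OF sub]])
  moreover have "inj_on e {1..c}" by (rule inj_on_subset[OF basis_inj sub])
  ultimately show ?thesis using vec.dim_span_eq_card_independent[of "e ` {1..c}"] by (simp add: card_image)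
qed

lemma triangular_flags:
  assumes lead: "\<And>i. i \<in> {1..N} \<Longrightarrow> e' i \<in> flag i \<and> X i (e' i) \<noteq> 0" and c: "c \<le> N"
  shows "inj_on e' {1..c}" "vec.independent (e' ` {1..c})" "vec.span (e' ` {1..c}) = flag c"
proof -
  show inj: "inj_on e' {1..c}" and ind: "vec.independent (e' ` {1..c})"
    using echelon(1,2)[of "{1..c}" id e'] lead c by auto
  show "vec.span (e' ` {1..c}) = flag c"
  proof (rule vec.subspace_dim_equal)
    show "vec.span (e' ` {1..c}) \<subseteq> flag c"
    proof (rule vec.span_minimal)
      show "e' ` {1..c} \<subseteq> flag c" using lead c flag_mono by fastforce
    qed simp
    show "vec.dim (flag c) \<le> vec.dim (vec.span (e' ` {1..c}))"
      using flag_dim[OF c] vec.dim_span_eq_card_independent[OF ind] inj by (simp add: card_image)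
  qed simp_all
qed

text \<open>All basis vectors other than \<open>e q\<close> and its dual are made orthogonal to \<open>v\<close> by subtracting multiples
  of the dual vector \<open>e (N + 1 - q)\<close>; this keeps the basis triangular because \<open>v \<in> F\<^sub>q\<close>.\<close>

lemma replace_basis_vector:
  assumes q: "q \<in> {1..N}" "q \<noteq> N + 1 - q" and v: "v \<in> flag q" "X q v = 1" "\<omega> v v = 0"
  obtains e' where "same_flags e'" "e' q = v"
    "\<And>p. p \<in> {1..N} \<Longrightarrow> p \<noteq> q \<Longrightarrow> p \<noteq> N + 1 - q \<Longrightarrow> \<omega> (e p) v = 0 \<Longrightarrow> e' p = e p"
proof -
  define r where "r = N + 1 - q"
  have r: "r \<in> {1..N}" "q + r = N + 1" "N + 1 - r = q" "r \<noteq> q" using q by (auto simp: r_def)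
  define k where "k i = \<omega> (e i) v / \<omega> (e r) v" for i
  define e' where "e' i = (if i = q then v else if i = r then e r else e i - k i *s e r)" for i
  have rv: "\<omega> (e r) v = \<omega> (e r) (e q)" using form_basis_left[OF r(1), of v] v r by simp
  have rv0: "\<omega> (e r) v \<noteq> 0" using rv form_basis_nonzero[OF r(1)] r by simp
  have vr: "\<omega> v (e r) = \<omega> (e q) (e r)" using rv symmetry[of v "e r"] symmetry[of "e q" "e r"] by simp
  have vq: "\<omega> v v = \<omega> (e q) (e q)" using v(3) form_basis_zero[OF q(1) q(1)] q by auto
  have rr: "\<omega> (e r) (e r) = 0" using form_basis_zero[OF r(1) r(1)] r q by auto
  have lead: "e' i \<in> flag i \<and> X i (e' i) \<noteq> 0" if i: "i \<in> {1..N}" for i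
  proof -
    have ei: "e i \<in> flag i" "X i (e i) = 1" using i coord_basis[OF i i] by (auto intro: vec.span_base)
    consider "i = q" | "i = r" | "i \<noteq> q" "i \<noteq> r" by blast
    then show ?thesis
    proof cases
      case 1
      then show ?thesis using v by (simp add: e'_def)
    next
      case 2
      then show ?thesis using ei r by (simp add: e'_def)
    next
      case 3
      then have "X i (e' i) = 1" using ei coord_basis[OF r(1) i] by (simp add: e'_def coord_diff coord_scale)
      moreover have "e' i \<in> flag i"
      proof (cases "k i = 0")
        case True
        then show ?thesis using 3 ei by (simp add: e'_def)
      next
        case False
        then have "X (N + 1 - i) v \<noteq> 0" using form_basis_left[OF i, of v] by (auto simp: k_def)
        moreover have "\<forall>j\<in>{1..N}. q < j \<longrightarrow> X j v = 0" using v(1) mem_flag_iff[of q v] q(1) by auto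
        moreover have "N + 1 - i \<in> {1..N}" using i by auto
        ultimately have "N + 1 - i \<le> q" using not_le by blast
        then have "r \<le> i" using r i by auto
        then have "e r \<in> flag i" using r(1) by (intro vec.span_base) auto
        then show ?thesis using 3 ei by (auto simp: e'_def intro!: vec.span_diff vec.span_scale)
      qed
      ultimately show ?thesis by simp
    qed
  qed
  have orth_v: "\<omega> (e' i) v = 0" if "i \<in> {1..N}" "i \<noteq> q" "i \<noteq> r" for i
    using that rv0 by (simp add: e'_def form_diff_left form_scale_left k_def)
  have orth_r: "\<omega> (e' i) (e r) = \<omega> (e i) (e r)" if "i \<in> {1..N}" "i \<noteq> q" "i \<noteq> r" for i
    using that rr by (simp add: e'_def form_diff_left form_scale_left)
  have ir: "\<omega> (e i) (e r) = 0" "\<omega> (e r) (e i) = 0" "\<omega> (e i) (e q) = 0" "\<omega> (e q) (e i) = 0"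
    if "i \<in> {1..N}" "i \<noteq> q" "i \<noteq> r" for i
    using form_basis_zero that r q(1) by auto
  have form': "\<omega> (e' i) (e' j) = \<omega> (e i) (e j)" if ij: "i \<in> {1..N}" "j \<in> {1..N}" for i j
  proof -
    have sym0: "\<omega> y x = 0" if "\<omega> x y = 0" for x y using symmetry[where x = x and y = y] that by simp
    have eq: "e' q = v" "e' r = e r" using r by (auto simp: e'_def)
    consider "i = q \<or> i = r" "j = q \<or> j = r" | "i \<noteq> q" "i \<noteq> r" "j = q \<or> j = r"
      | "i = q \<or> i = r" "j \<noteq> q" "j \<noteq> r" | "i \<noteq> q" "i \<noteq> r" "j \<noteq> q" "j \<noteq> r" by blast
    then show ?thesis
    proof cases
      case 1
      then show ?thesis using eq vq vr rv by auto
    next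
      case 2
      then show ?thesis using eq orth_v[of i] orth_r[of i] ir[of i] ij by auto
    next
      case 3
      have "\<omega> (e' i) (e' j) = 0"
        by (rule sym0) (use 3 eq orth_v[of j] orth_r[of j] ir[of j] ij in auto)
      then show ?thesis using 3 ir[of j] ij by auto
    next
      case 4
      then have "\<omega> (e' i) (e' j) = \<omega> (e i - k i *s e r) (e j - k j *s e r)" by (simp add: e'_def)
      then show ?thesis using rr ir(1)[OF ij(1)] ir(2)[OF ij(2)] 4
        by (simp add: form_diff_left form_diff_right form_scale_left form_scale_right)
    qed
  qed
  have tri: "inj_on e' {1..c}" "vec.independent (e' ` {1..c})" "vec.span (e' ` {1..c}) = flag c" if "c \<le> N" for c
    using triangular_flags[of e' c] lead that by auto
  have "isotropic_setting ty n \<omega> e'"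
  proof (rule isotropic_setting.intro)
    show "\<omega> (e' i) (e' j) = (if i + j = N + 1 then 1 else 0)" if "1 \<le> i" "i \<le> j" "j \<le> N" for i j
      using form'[of i j] form_basis[of i j] that by auto
    show "vec.span (e' ` {1..N}) = UNIV" using tri(3)[of N] basis_span by simp
    show "inj_on e' {1..N}" "vec.independent (e' ` {1..N})" using tri by auto
  qed (fact ambient_dim_ge_2 card_index linear_left linear_right symmetry nondegenerate)+
  then have "same_flags e'" using tri(3) by (simp add: same_flags_def)
  moreover have "e' q = v" by (simp add: e'_def)
  moreover have "e' p = e p" if "p \<in> {1..N}" "p \<noteq> q" "p \<noteq> N + 1 - q" "\<omega> (e p) v = 0" for p
    using that by (auto simp: e'_def k_def r_def)
  ultimately show thesis using that by blast
qed

text \<open>This is the transitivity of the Borel subgroup on a cell. The basis vectors indexed by P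
  are moved into S one at a time; those already in S are orthogonal to the new vector because S is
  isotropic, and so the replacement does not touch them.\<close>

lemma adapted_basis:
  assumes S: "S \<in> isotropic_grassmannian m \<omega>" and P: "jump_set N e S = P" "P \<in> schubert_symbols N m"
  obtains e' where "same_flags e'" "vec.span (e' ` P) = S"
proof -
  have sub: "vec.subspace S" and iso: "\<And>u v. u \<in> S \<Longrightarrow> v \<in> S \<Longrightarrow> \<omega> u v = 0"
    using S by (auto simp: isotropic_grassmannian_def)
  have PN: "P \<subseteq> {1..N}" and Pn: "\<And>c d. c \<in> P \<Longrightarrow> d \<in> P \<Longrightarrow> c + d \<noteq> N + 1"
    using P(2) by (auto simp: schubert_symbols_def)
  have finP: "finite P" using PN finite_subset by blast
  have "\<exists>e'. same_flags e' \<and> (\<forall>p\<in>A. e' p \<in> S)" if "finite A" "A \<subseteq> P" for A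
    using that
  proof (induction A rule: finite_induct)
    case empty
    then show ?case using same_flags_refl by auto
  next
    case (insert q A)
    then obtain e1 where e1: "same_flags e1" "\<forall>p\<in>A. e1 p \<in> S" by auto
    interpret E: isotropic_setting ty n \<omega> e1 using e1(1) by (simp add: same_flags_def)
    have q: "q \<in> P" "q \<in> {1..N}" using insert PN by auto
    have "q \<in> jump_set N e1 S" using same_flags_jump_set[OF e1(1)] P(1) q by simp
    then obtain v where v: "v \<in> S" "v \<in> E.flag q" "E.X q v = 1" using E.jump_vectors[OF sub] by metis
    have "q \<noteq> N + 1 - q" using Pn[OF q(1) q(1)] q(2) by auto
    then obtain e2 where e2: "E.same_flags e2" "e2 q = v"
      "\<And>p. p \<in> {1..N} \<Longrightarrow> p \<noteq> q \<Longrightarrow> p \<noteq> N + 1 - q \<Longrightarrow> \<omega> (e1 p) v = 0 \<Longrightarrow> e2 p = e1 p"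
      using E.replace_basis_vector[OF q(2) _ v(2,3) iso[OF v(1) v(1)]] by metis
    have "same_flags e2" using e1(1) e2(1) by (simp add: same_flags_def E.same_flags_def)
    moreover have "e2 p \<in> S" if "p \<in> insert q A" for p
    proof (cases "p = q")
      case True
      then show ?thesis using e2(2) v by simp
    next
      case False
      then have p: "p \<in> A" "p \<in> P" "p \<in> {1..N}" using that insert PN by auto
      have "p \<noteq> N + 1 - q" using Pn[OF p(2) q(1)] q(2) by auto
      then have "e2 p = e1 p" using e2(3)[OF p(3) False] iso e1(2) p(1) v(1) by blast
      then show ?thesis using e1(2) p by simp
    qed
    ultimately show ?case by blast
  qed
  then obtain e' where e': "same_flags e'" "\<forall>p\<in>P. e' p \<in> S" using finP by blast
  interpret E: isotropic_setting ty n \<omega> e' using e'(1) by (simp add: same_flags_def)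
  have J: "jump_set N e' S = P" using same_flags_jump_set[OF e'(1)] P(1) by simp
  have "vec.span (e' ` jump_set N e' S) = S"
    by (rule E.jump_vectors_span[OF sub])
      (use J PN e'(2) E.coord_basis in \<open>auto intro!: vec.span_base\<close>)
  then show thesis using that e' J by simp
qed

end

section \<open>Degenerations of isotropic subspaces\<close>

lemma hom_poly_fun_scale:
  assumes "hom_poly_fun A d F" "\<And>i. i \<in> A \<Longrightarrow> z' i = c * z i"
  shows "F z' = c ^ d * F z"
  using assms by (induction rule: hom_poly_fun.induct) (auto simp: algebra_simps power_add)

lemma hom_poly_fun_tendsto:
  assumes "hom_poly_fun A d F" "\<And>i. i \<in> A \<Longrightarrow> ((\<lambda>t. z t i) \<longlongrightarrow> z0 i) G"
  shows "((\<lambda>t. F (z t)) \<longlongrightarrow> F z0) G"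
  using assms by (induction rule: hom_poly_fun.induct) (auto intro: tendsto_add tendsto_mult)

context isotropic_setting
begin

lemma pluecker_tendsto:
  assumes "\<And>j c. j < m \<Longrightarrow> c \<in> {1..N} \<Longrightarrow> ((\<lambda>t. X c (b t j)) \<longlongrightarrow> X c (b0 j)) G"
    and I: "I \<subseteq> {1..N}" "card I = m"
  shows "((\<lambda>t. pluecker N m e (b t) I) \<longlongrightarrow> pluecker N m e b0 I) G"
proof -
  have fin: "finite I" using I finite_subset by blast
  have nth: "sorted_list_of_set I ! i \<in> {1..N}" if "i < m" for i
  proof -
    have "sorted_list_of_set I ! i \<in> set (sorted_list_of_set I)" using that I by (intro nth_mem) simp
    then show ?thesis using fin I by auto
  qed
  have eq: "pluecker N m e b' I = (\<Sum>p\<in>{p. p permutes {0..<m}}. signof p *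
      (\<Prod>i = 0..<m. X (sorted_list_of_set I ! i) (b' (p i))))" for b'
  proof -
    have "(\<Prod>i = 0..<m. Matrix.mat m m (\<lambda>(i, j). X (sorted_list_of_set I ! i) (b' j)) $$ (i, p i)) =
      (\<Prod>i = 0..<m. X (sorted_list_of_set I ! i) (b' (p i)))" if "p permutes {0..<m}" for p
    proof (rule prod.cong)
      fix i assume "i \<in> {0..<m}"
      then show "Matrix.mat m m (\<lambda>(i, j). X (sorted_list_of_set I ! i) (b' j)) $$ (i, p i) =
          X (sorted_list_of_set I ! i) (b' (p i))"
        using permutes_in_image[OF that, of i] by simp
    qed simp
    then show ?thesis unfolding pluecker_def by (subst det_def'[of _ m]) auto
  qed
  show ?thesis
    unfolding eq
  proof (intro tendsto_sum tendsto_mult tendsto_prod tendsto_const)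
    fix p i assume "p \<in> {p. p permutes {0..<m}}" "i \<in> {0..<m}"
    then have "p i < m" "i < m" using permutes_in_image[of p "{0..<m}" i] by auto
    then show "((\<lambda>t. X (sorted_list_of_set I ! i) (b t (p i))) \<longlongrightarrow> X (sorted_list_of_set I ! i) (b0 (p i))) G"
      using assms(1) nth by blast
  qed
qed

lemma pluecker_frame_change:
  assumes "is_frame m b S" "is_frame m b' S"
  shows "\<exists>c. \<forall>I. pluecker N m e b' I = c * pluecker N m e b I"
proof -
  have "\<exists>g. b' j = (\<Sum>k<m. g k *s b k)" if "j < m" for j
  proof -
    have "b' j \<in> vec.span (b' ` {..<m})" using that by (intro vec.span_base) auto
    then have "b' j \<in> vec.span (b ` {..<m})" using assms by (simp add: is_frame_def)
    then obtain g where "b' j = (\<Sum>k<m. g k *s b k)" by (rule span_image_sum[rotated]) auto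
    then show ?thesis by blast
  qed
  then obtain g where g: "\<And>j. j < m \<Longrightarrow> b' j = (\<Sum>k<m. g j k *s b k)" by metis
  define G where "G = Matrix.mat m m (\<lambda>(k, j). g j k)"
  have "pluecker N m e b' I = Determinant.det G * pluecker N m e b I" for I
  proof -
    let ?M = "Matrix.mat m m (\<lambda>(i, j). X (sorted_list_of_set I ! i) (b j))"
    have "Matrix.mat m m (\<lambda>(i, j). X (sorted_list_of_set I ! i) (b' j)) = ?M * G"
      by (rule eq_matI)
        (auto simp: G_def scalar_prod_def g coord_sum coord_scale atLeast0LessThan mult.commute intro!: sum.cong)
    then show ?thesis unfolding pluecker_def by (simp add: det_mult[of _ m] G_def)
  qed
  then show ?thesis by blast
qed

text \<open>The Pluecker coordinates depend continuously on \<open>t\<close>, and Zariski-open conditions are nonvanishing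
  conditions on continuous functions of them.\<close>

lemma curve_in_schubert_variety:
  fixes b :: "complex \<Rightarrow> nat \<Rightarrow> complex ^ 'n"
  assumes S0: "S0 \<in> isotropic_grassmannian m \<omega>" "is_frame m (b 0) S0"
    and S: "\<And>t. t \<noteq> 0 \<Longrightarrow> S t \<in> isotropic_grassmannian m \<omega> \<and> jump_set N e (S t) = P \<and> is_frame m (b t) (S t)"
    and lim: "\<And>j c. j < m \<Longrightarrow> c \<in> {1..N} \<Longrightarrow> ((\<lambda>t. X c (b t j)) \<longlongrightarrow> X c (b 0 j)) (at 0)"
  shows "S0 \<in> schubert_variety N m \<omega> e P"
proof -
  let ?I = "{I. I \<subseteq> {1..N} \<and> card I = m}"
  let ?G = "{{\<Sigma> \<in> isotropic_grassmannian m \<omega>. \<exists>b. is_frame m b \<Sigma> \<and> F (pluecker N m e b) \<noteq> 0} | F d.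
        hom_poly_fun ?I d F}"
  have top: "S0 \<in> topspace (zariski_topology N m \<omega> e)"
  proof -
    \<comment> \<open>The constant polynomial 1 gives a basic open set containing every isotropic
      subspace that has a frame.\<close>
    let ?A = "{\<Sigma> \<in> isotropic_grassmannian m \<omega>. \<exists>b. is_frame m b \<Sigma> \<and> (\<lambda>_. 1) (pluecker N m e b) \<noteq> (0 :: complex)}"
    have "?A \<in> ?G"
      by (rule CollectI) (intro exI[of _ "\<lambda>_. 1"] exI[of _ 0] conjI refl hom_poly_fun.const)
    moreover have "S0 \<in> ?A" using S0 by auto
    ultimately have "S0 \<in> \<Union>?G" by (rule UnionI)
    then show ?thesis unfolding zariski_topology_def topology_generated_by_topspace .
  qed
  have near: "S0 \<in> U \<Longrightarrow> \<forall>\<^sub>F t in at 0. S t \<in> U" if "generate_topology_on ?G U" for U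
    using that
  proof (induction U rule: generate_topology_on.induct)
    case (Int A B)
    then show ?case by (auto intro: eventually_conj)
  next
    case (UN K)
    then obtain A where "A \<in> K" "S0 \<in> A" by blast
    then have "\<forall>\<^sub>F t in at 0. S t \<in> A" using UN by blast
    then show ?case by (rule eventually_mono) (use \<open>A \<in> K\<close> in auto)
  next
    case (Basis A)
    then obtain F d where F: "hom_poly_fun ?I d F"
      "A = {\<Sigma> \<in> isotropic_grassmannian m \<omega>. \<exists>b. is_frame m b \<Sigma> \<and> F (pluecker N m e b) \<noteq> 0}" by blast
    then obtain b' where b': "is_frame m b' S0" "F (pluecker N m e b') \<noteq> 0" using Basis by blast
    obtain c where c: "\<forall>I. pluecker N m e b' I = c * pluecker N m e (b 0) I"
      using pluecker_frame_change[OF S0(2) b'(1)] by blast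
    have "F (pluecker N m e b') = c ^ d * F (pluecker N m e (b 0))"
      by (rule hom_poly_fun_scale[OF F(1)]) (use c in blast)
    then have nz: "F (pluecker N m e (b 0)) \<noteq> 0" using b'(2) by auto
    have "((\<lambda>t. F (pluecker N m e (b t))) \<longlongrightarrow> F (pluecker N m e (b 0))) (at 0)"
      by (rule hom_poly_fun_tendsto[OF F(1)]) (use pluecker_tendsto[OF lim] in auto)
    then have "\<forall>\<^sub>F t in at 0. F (pluecker N m e (b t)) \<noteq> 0" using nz by (rule tendsto_imp_eventually_ne)
    moreover have "\<forall>\<^sub>F t in at (0 :: complex). t \<noteq> 0" by (simp add: eventually_at_filter)
    ultimately show ?case
      by eventually_elim (use S F(2) in blast)
  qed auto
  show ?thesis
    unfolding schubert_variety_def in_closure_of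
  proof (intro conjI allI impI top)
    fix U assume U: "S0 \<in> U \<and> openin (zariski_topology N m \<omega> e) U"
    then have "generate_topology_on ?G U"
      unfolding zariski_topology_def openin_topology_generated_by_iff by blast
    then have "\<forall>\<^sub>F t in at 0. S t \<in> U" using near U by blast
    moreover have "\<forall>\<^sub>F t in at (0 :: complex). t \<noteq> 0" by (simp add: eventually_at_filter)
    ultimately have "\<forall>\<^sub>F t in at (0 :: complex). S t \<in> U \<and> t \<noteq> 0" by (rule eventually_conj)
    then obtain t where "S t \<in> U" "t \<noteq> 0" using eventually_happens'[of "at (0 :: complex)"] by auto
    then show "\<exists>y. y \<in> {\<Sigma> \<in> isotropic_grassmannian m \<omega>. jump_set N e \<Sigma> = P} \<and> y \<in> U"
      using S by blast
  qed
qed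

lemma isotropic_spanI:
  assumes "finite J" "card J = m" "inj_on w J" "vec.independent (w ` J)"
    and "\<And>p q. p \<in> J \<Longrightarrow> q \<in> J \<Longrightarrow> \<omega> (w p) (w q) = 0"
  shows "vec.span (w ` J) \<in> isotropic_grassmannian m \<omega>"
proof -
  have "\<omega> u v = 0" if uv: "u \<in> vec.span (w ` J)" "v \<in> vec.span (w ` J)" for u v
  proof -
    obtain a where a: "u = (\<Sum>p\<in>J. a p *s w p)" using span_image_sum[OF assms(1) uv(1)] .
    obtain b where b: "v = (\<Sum>p\<in>J. b p *s w p)" using span_image_sum[OF assms(1) uv(2)] .
    have r: "\<omega> x v = (\<Sum>q\<in>J. b q * \<omega> x (w q))" for x
      unfolding b by (simp add: form_sum_right form_scale_right)
    have "\<omega> u v = (\<Sum>p\<in>J. a p * (\<Sum>q\<in>J. b q * \<omega> (w p) (w q)))"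
      unfolding a by (simp only: form_sum_left form_scale_left, simp only: r)
    also have "\<dots> = 0" using assms(5) by (intro sum.neutral) auto
    finally show ?thesis .
  qed
  then show ?thesis
    using vec.dim_span_eq_card_independent[OF assms(4)] assms(2,3)
    by (auto simp: isotropic_grassmannian_def card_image)
qed

text \<open>At t = 0 the family is the coordinate subspace of Q; for t \<noteq> 0 the leading
  position of the vector p becomes \<sigma> p, which puts the span into the cell of P. The term in t
  * t is for the flip in type B.\<close>

lemma deformation:
  assumes e': "same_flags e'" and Q: "Q \<subseteq> {1..N}" "card Q = m"
    and w0: "w 0 = e'" and w: "\<And>t p. w t p = e' p + t *s u p + (t * t) *s u' p"
    and lead: "\<And>t p. t \<noteq> 0 \<Longrightarrow> p \<in> Q \<Longrightarrow> \<sigma> p \<in> {1..N} \<and> w t p \<in> flag (\<sigma> p) \<and>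
      basis_coord N e' (\<sigma> p) (w t p) \<noteq> 0"
    and \<sigma>: "inj_on \<sigma> Q" "\<sigma> ` Q = P"
    and iso: "\<And>t p q. p \<in> Q \<Longrightarrow> q \<in> Q \<Longrightarrow> \<omega> (w t p) (w t q) = 0"
  shows "vec.span (e' ` Q) \<in> schubert_variety N m \<omega> e P"
proof -
  interpret E: isotropic_setting ty n \<omega> e' using e' by (simp add: same_flags_def)
  have fl: "E.flag c = flag c" if "c \<le> N" for c using e' that by (simp add: same_flags_def)
  have finQ: "finite Q" using Q finite_subset by blast
  define b where "b t j = w t (sorted_list_of_set Q ! j)" for t j
  have bij: "bij_betw (\<lambda>j. sorted_list_of_set Q ! j) {..<m} Q"
    using bij_betw_nth[of "sorted_list_of_set Q" "{..<m}" Q] finQ Q(2) by simp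
  have img: "b t ` {..<m} = w t ` Q" for t
    using bij unfolding b_def bij_betw_def by (metis image_image)
  have frame: "is_frame m (b t) (vec.span (w t ` Q))" if "inj_on (w t) Q" "vec.independent (w t ` Q)" for t
  proof -
    have "inj_on (b t) {..<m}"
      using comp_inj_on[of "\<lambda>j. sorted_list_of_set Q ! j" "{..<m}" "w t"] bij that(1)
      by (simp add: bij_betw_def b_def[abs_def] comp_def)
    then show ?thesis using that(2) by (simp add: is_frame_def img)
  qed
  have l0: "id p \<in> {1..N} \<and> w 0 p \<in> E.flag (id p) \<and> E.X (id p) (w 0 p) \<noteq> 0" if "p \<in> Q" for p
  proof -
    have p: "p \<in> {1..N}" using that Q by blast
    have "e' p \<in> E.flag p" by (rule vec.span_base) (use p in auto)
    then show ?thesis using p E.coord_basis[OF p p] w0 by simp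
  qed
  have ech0: "inj_on (w 0) Q" "vec.independent (w 0 ` Q)"
    using E.echelon(1,2)[OF finQ l0 inj_on_id] by blast+
  have ech: "inj_on (w t) Q" "vec.independent (w t ` Q)" "jump_set N e' (vec.span (w t ` Q)) = P" if "t \<noteq> 0" for t
  proof -
    have l: "\<sigma> p \<in> {1..N} \<and> w t p \<in> E.flag (\<sigma> p) \<and> E.X (\<sigma> p) (w t p) \<noteq> 0" if "p \<in> Q" for p
      using lead[OF \<open>t \<noteq> 0\<close> that] fl[of "\<sigma> p"] by auto
    show "inj_on (w t) Q" "vec.independent (w t ` Q)" "jump_set N e' (vec.span (w t ` Q)) = P"
      using E.echelon[OF finQ l \<sigma>(1)] \<sigma>(2) by auto
  qed
  have "vec.span (w 0 ` Q) \<in> schubert_variety N m \<omega> e P"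
  proof (rule curve_in_schubert_variety[where b = b and S = "\<lambda>t. vec.span (w t ` Q)"])
    show "vec.span (w 0 ` Q) \<in> isotropic_grassmannian m \<omega>"
      by (rule isotropic_spanI[OF finQ Q(2) ech0]) (use iso in auto)
    show "is_frame m (b 0) (vec.span (w 0 ` Q))" by (rule frame[OF ech0])
    fix t :: complex assume t: "t \<noteq> 0"
    have "vec.span (w t ` Q) \<in> isotropic_grassmannian m \<omega>"
      by (rule isotropic_spanI[OF finQ Q(2) ech(1,2)[OF t]]) (use iso in auto)
    then show "vec.span (w t ` Q) \<in> isotropic_grassmannian m \<omega> \<and>
        jump_set N e (vec.span (w t ` Q)) = P \<and> is_frame m (b t) (vec.span (w t ` Q))"
      using frame[OF ech(1,2)[OF t]] ech(3)[OF t] same_flags_jump_set[OF e'] by simp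
  next
    fix j c
    show "((\<lambda>t. X c (b t j)) \<longlongrightarrow> X c (b 0 j)) (at 0)"
      unfolding b_def w coord_add coord_scale by (intro tendsto_eq_intros | simp)+
  qed
  then show ?thesis using w0 by simp
qed

end

section \<open>Curves that realise the lowering moves\<close>

context isotropic_setting
begin

lemma symbol_props:
  assumes "P \<in> schubert_symbols N m"
  shows "P \<subseteq> {1..N}" "card P = m" "finite P" "c \<in> P \<Longrightarrow> d \<in> P \<Longrightarrow> c + d \<noteq> N + 1"
  using assms finite_subset[of P "{1..N}"] by (auto simp: schubert_symbols_def)

lemma basis_leading:
  assumes "same_flags e'" "i \<in> {1..N}" "j \<in> {1..N}" "i \<le> j"
  shows "e' i \<in> flag j" "basis_coord N e' j (e' i) = of_bool (j = i)"
proof -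
  interpret E: isotropic_setting ty n \<omega> e' using assms(1) by (simp add: same_flags_def)
  have "e' i \<in> E.flag j" by (rule vec.span_base) (use assms in auto)
  then show "e' i \<in> flag j" using assms by (simp add: same_flags_def)
  show "basis_coord N e' j (e' i) = of_bool (j = i)" using E.coord_basis[of i j] assms by simp
qed

text \<open>The curve replaces e_a by e_a + t e_b. Since a is outside [P] and not self-dual, all
  vectors indexed by P and a are mutually orthogonal.\<close>

lemma exchange_deformation:
  assumes e': "same_flags e'" and P: "P \<in> schubert_symbols N m" and Q: "exchange a b P \<in> schubert_symbols N m"
    and ab: "1 \<le> a" "a < b" "b \<in> P" "a \<notin> sym_closure N P" "a \<noteq> N + 1 - a"
  shows "vec.span (e' ` exchange a b P) \<in> schubert_variety N m \<omega> e P"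
proof -
  interpret E: isotropic_setting ty n \<omega> e' using e' by (simp add: same_flags_def)
  note p = symbol_props[OF P] and q = symbol_props[OF Q]
  have b: "b \<in> {1..N}" "a \<in> {1..N}" "a \<notin> P" "a + a \<noteq> N + 1" using ab p by (auto simp: sym_closure_def)
  have ab1: "a + c \<noteq> N + 1" if "c \<in> P" for c
  proof
    assume "a + c = N + 1"
    then have "c = N + 1 - a" by simp
    then show False using ab(4) b(2) that by (auto simp: sym_closure_def)
  qed
  have orth: "\<omega> (e' c) (e' d) = 0" if "c \<in> insert a P" "d \<in> insert a P" for c d
    using that p(4)[of c d] ab1[of c] ab1[of d] b(4) p(1) b(2)
    by (intro E.form_basis_zero) (auto simp: add.commute)
  define u where "u c = (if c = a then e' b else 0)" for c
  define \<sigma> where "\<sigma> c = (if c = a then b else c)" for c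
  have mem: "c \<in> exchange a b P \<longleftrightarrow> c = a \<or> c \<in> P \<and> c \<noteq> b" for c using ab(2) by (auto simp: exchange_def)
  show ?thesis
  proof (rule deformation[where w = "\<lambda>t c. e' c + t *s u c" and u = u and u' = "\<lambda>_. 0" and \<sigma> = \<sigma>])
    show "same_flags e'" "exchange a b P \<subseteq> {1..N}" "card (exchange a b P) = m" using e' q by auto
    show "inj_on \<sigma> (exchange a b P)" by (rule inj_onI) (auto simp: \<sigma>_def mem split: if_splits)
    have "\<sigma> ` (P - {b}) = P - {b}" using b(3) by (auto simp: \<sigma>_def image_iff)
    then show "\<sigma> ` exchange a b P = P" using ab by (auto simp: \<sigma>_def exchange_def)
    show "\<omega> (e' c + t *s u c) (e' d + t *s u d) = 0" if "c \<in> exchange a b P" "d \<in> exchange a b P" for t c d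
      using that orth ab(3)
      by (auto simp: u_def mem E.form_add_left E.form_add_right E.form_scale_left E.form_scale_right E.form_zero)
    show "\<sigma> c \<in> {1..N} \<and> e' c + t *s u c \<in> flag (\<sigma> c) \<and> E.X (\<sigma> c) (e' c + t *s u c) \<noteq> 0"
      if t: "t \<noteq> 0" and c: "c \<in> exchange a b P" for t c
    proof (cases "c = a")
      case True
      have "e' a + t *s e' b \<in> flag b"
        using basis_leading(1)[OF e', of a b] basis_leading(1)[OF e', of b b] b ab
        by (auto intro!: vec.span_add vec.span_scale)
      moreover have "E.X b (e' a + t *s e' b) = t"
        using basis_leading(2)[OF e', of a b] basis_leading(2)[OF e', of b b] b ab
        by (simp add: E.coord_add E.coord_scale)
      ultimately show ?thesis using True b t by (simp add: \<sigma>_def u_def)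
    next
      case False
      then have "c \<in> {1..N}" using c p(1) by (auto simp: mem)
      then show ?thesis using False basis_leading[OF e', of c c] by (simp add: \<sigma>_def u_def)
    qed
  qed (auto simp: u_def)
qed

lemma reflect_deformation:
  assumes e': "same_flags e'" and P: "P \<in> schubert_symbols N m" and Q: "reflect N x b P \<in> schubert_symbols N m"
    and xb: "1 \<le> x" "x < b" "b \<in> P" "x \<notin> P" "N + 1 - x \<in> P" "x \<noteq> N + 1 - b"
  shows "vec.span (e' ` reflect N x b P) \<in> schubert_variety N m \<omega> e P"
proof -
  interpret E: isotropic_setting ty n \<omega> e' using e' by (simp add: same_flags_def)
  note p = symbol_props[OF P] and q = symbol_props[OF Q]
  define bx bb where "bx = N + 1 - x" and "bb = N + 1 - b"
  have b: "b \<in> {1..N}" using xb p by auto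
  have x: "x \<in> {1..N}" using xb b by auto
  have bar: "bx \<in> {1..N}" "bb \<in> {1..N}" "x + bx = N + 1" "b + bb = N + 1" "bb < bx" "x \<noteq> bb" "bx \<in> P"
    using x b xb by (auto simp: bx_def bb_def)
  have nP: "bb \<notin> P" using p(4)[OF xb(3)] bar by auto
  have neq: "x \<noteq> bx" "b \<noteq> bb" "b \<noteq> bx" "x \<noteq> b" "bb \<noteq> bx" using xb bar nP by auto
  have mem: "c \<in> reflect N x b P \<longleftrightarrow> c = x \<or> c = bb \<or> c \<in> P \<and> c \<noteq> b \<and> c \<noteq> bx" for c
    unfolding reflect_def bx_def[symmetric] bb_def[symmetric] using xb nP neq by auto
  \<comment> \<open>Isotropy forces the mirror vector to move along: e_x + t e_b and e_bb + t k e_bx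
    pair to t times k \<omega>(e_x, e_bx) + \<omega>(e_b, e_bb), and k makes this vanish.\<close>
  define k where "k = - \<omega> (e' b) (e' bb) / \<omega> (e' x) (e' bx)"
  have nz: "\<omega> (e' x) (e' bx) \<noteq> 0" using E.form_basis_nonzero[OF x] by (simp add: bx_def)
  define u where "u c = (if c = x then e' b else if c = bb then k *s e' bx else 0)" for c
  define \<sigma> where "\<sigma> c = (if c = x then b else if c = bb then bx else c)" for c
  have z: "\<omega> (e' c) (e' d) = 0" if "c \<in> {1..N}" "d \<in> {1..N}" "c + d \<noteq> N + 1" for c d
    using E.form_basis_zero that by blast
  have sum_ne: "x + x \<noteq> N + 1" "x + b \<noteq> N + 1" "b + b \<noteq> N + 1" "x + bb \<noteq> N + 1" "b + bx \<noteq> N + 1"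
    "bb + bb \<noteq> N + 1" "bb + bx \<noteq> N + 1" "bx + bx \<noteq> N + 1" "b + x \<noteq> N + 1" "bx + bb \<noteq> N + 1"
  proof -
    show "x + x \<noteq> N + 1" using bar(3) neq(1) by linarith
    show "x + b \<noteq> N + 1" using bar(4) bar(6) by linarith
    then show "b + x \<noteq> N + 1" by linarith
    show "b + b \<noteq> N + 1" using bar(4) neq(2) by linarith
    show "x + bb \<noteq> N + 1" using bar(4) neq(4) by linarith
    show "b + bx \<noteq> N + 1" using bar(3) neq(4) by linarith
    show "bb + bb \<noteq> N + 1" using bar(4) neq(2) by linarith
    show "bb + bx \<noteq> N + 1" using bar(4) neq(3) by linarith
    then show "bx + bb \<noteq> N + 1" by linarith
    show "bx + bx \<noteq> N + 1" using bar(3) neq(1) by linarith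
  qed
  have k: "k * \<omega> (e' x) (e' bx) + \<omega> (e' b) (e' bb) = 0" using nz by (simp add: k_def)
  have sym0: "\<omega> y z = 0" if "\<omega> z y = 0" for y z using symmetry[where x = z and y = y] that by simp
  have other: "c + x \<noteq> N + 1 \<and> c + b \<noteq> N + 1 \<and> c + bb \<noteq> N + 1 \<and> c + bx \<noteq> N + 1" if "c \<in> P" "c \<noteq> b" "c \<noteq> bx" for c
    using that p(4)[OF that(1) xb(3)] p(4)[OF that(1) bar(7)] bar by auto
  show ?thesis
  proof (rule deformation[where w = "\<lambda>t c. e' c + t *s u c" and u = u and u' = "\<lambda>_. 0" and \<sigma> = \<sigma>])
    show "same_flags e'" "reflect N x b P \<subseteq> {1..N}" "card (reflect N x b P) = m" using e' q by auto
    show "inj_on \<sigma> (reflect N x b P)"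
    proof (rule inj_onI)
      fix c d assume cd: "c \<in> reflect N x b P" "d \<in> reflect N x b P" "\<sigma> c = \<sigma> d"
      have val: "c = x \<and> \<sigma> c = b \<or> c = bb \<and> \<sigma> c = bx \<or> \<sigma> c = c \<and> c \<noteq> b \<and> c \<noteq> bx"
        if "c \<in> reflect N x b P" for c
        using that bar(6) unfolding mem \<sigma>_def by auto
      show "c = d" using val[OF cd(1)] val[OF cd(2)] cd(3) neq(3) by auto
    qed
    show "\<sigma> ` reflect N x b P = P"
    proof (rule Set.set_eqI)
      fix c
      show "c \<in> \<sigma> ` reflect N x b P \<longleftrightarrow> c \<in> P"
      proof
        assume "c \<in> \<sigma> ` reflect N x b P"
        then show "c \<in> P" using xb bar by (auto simp: \<sigma>_def mem split: if_splits)
      next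
        assume c: "c \<in> P"
        consider "c = b" | "c = bx" | "c \<noteq> b" "c \<noteq> bx" by blast
        then show "c \<in> \<sigma> ` reflect N x b P"
        proof cases
          case 1 then show ?thesis by (intro image_eqI[of _ _ x]) (auto simp: \<sigma>_def mem)
        next
          case 2 then show ?thesis using bar by (intro image_eqI[of _ _ bb]) (auto simp: \<sigma>_def mem)
        next
          case 3 then show ?thesis using c xb nP by (intro image_eqI[of _ _ c]) (auto simp: \<sigma>_def mem)
        qed
      qed
    qed
    have ux: "u x = e' b" and ub: "u bb = k *s e' bx" using bar by (auto simp: u_def)
    have uo: "u c = 0" if "c \<noteq> x" "c \<noteq> bb" for c using that by (auto simp: u_def)
    note lin = E.form_add_left E.form_add_right E.form_scale_left E.form_scale_right
    have zf: "\<omega> (e' x) (e' x) = 0" "\<omega> (e' x) (e' b) = 0" "\<omega> (e' b) (e' x) = 0" "\<omega> (e' b) (e' b) = 0"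
      "\<omega> (e' bb) (e' bb) = 0" "\<omega> (e' bb) (e' bx) = 0" "\<omega> (e' bx) (e' bb) = 0" "\<omega> (e' bx) (e' bx) = 0"
      "\<omega> (e' x) (e' bb) = 0" "\<omega> (e' b) (e' bx) = 0"
      by (rule z; use x b bar(1,2) sum_ne in blast)+
    have xx: "\<omega> (e' x + t *s e' b) (e' x + t *s e' b) = 0" for t
      by (simp add: lin zf)
    have bbbb: "\<omega> (e' bb + (t * k) *s e' bx) (e' bb + (t * k) *s e' bx) = 0" for t
      by (simp add: lin zf)
    have xbb: "\<omega> (e' x + t *s e' b) (e' bb + (t * k) *s e' bx) = 0" for t
    proof -
      have "\<omega> (e' x + t *s e' b) (e' bb + (t * k) *s e' bx) = t * (k * \<omega> (e' x) (e' bx) + \<omega> (e' b) (e' bb))"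
        by (simp add: lin zf algebra_simps)
      then show ?thesis using k by simp
    qed
    have ox: "\<omega> (e' c) (e' x + t *s e' b) = 0" "\<omega> (e' c) (e' bb + (t * k) *s e' bx) = 0"
      if "c \<in> P" "c \<noteq> b" "c \<noteq> bx" for c t
    proof -
      have c: "c \<in> {1..N}" using that p(1) by blast
      have "\<omega> (e' c) (e' x) = 0" "\<omega> (e' c) (e' b) = 0" "\<omega> (e' c) (e' bb) = 0" "\<omega> (e' c) (e' bx) = 0"
        by (rule z; use c x b bar(1,2) other[OF that] in blast)+
      then show "\<omega> (e' c) (e' x + t *s e' b) = 0" "\<omega> (e' c) (e' bb + (t * k) *s e' bx) = 0"
        by (simp_all add: lin)
    qed
    show "\<omega> (e' c + t *s u c) (e' d + t *s u d) = 0" if cd: "c \<in> reflect N x b P" "d \<in> reflect N x b P" for t c d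
    proof -
      consider "c = x" "d = x" | "c = x" "d = bb" | "c = bb" "d = x" | "c = bb" "d = bb"
        | "c = x \<or> c = bb" "d \<in> P" "d \<noteq> b" "d \<noteq> bx" | "c \<in> P" "c \<noteq> b" "c \<noteq> bx" "d = x \<or> d = bb"
        | "c \<in> P" "c \<noteq> b" "c \<noteq> bx" "d \<in> P" "d \<noteq> b" "d \<noteq> bx"
        using cd unfolding mem by blast
      then show ?thesis
      proof cases
        case 1 then show ?thesis using xx by (simp add: ux)
      next
        case 2 then show ?thesis using xbb by (simp add: ux ub)
      next
        case 3 then show ?thesis using sym0[OF xbb] by (simp add: ux ub)
      next
        case 4 then show ?thesis using bbbb by (simp add: ub)
      next
        case 5
        then have "d \<noteq> x" "d \<noteq> bb" using xb nP by auto
        then show ?thesis using 5(1) sym0[OF ox(1)[OF 5(2-4)]] sym0[OF ox(2)[OF 5(2-4)]] by (auto simp: ux ub uo)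
      next
        case 6
        then have "c \<noteq> x" "c \<noteq> bb" using xb nP by auto
        then show ?thesis using 6(4) ox(1)[OF 6(1-3)] ox(2)[OF 6(1-3)] by (auto simp: ux ub uo)
      next
        case 7
        then have "c \<noteq> x" "c \<noteq> bb" "d \<noteq> x" "d \<noteq> bb" using xb nP by auto
        moreover have "\<omega> (e' c) (e' d) = 0" by (rule z) (use 7 p in auto)
        ultimately show ?thesis by (simp add: uo)
      qed
    qed
    show "\<sigma> c \<in> {1..N} \<and> e' c + t *s u c \<in> flag (\<sigma> c) \<and> E.X (\<sigma> c) (e' c + t *s u c) \<noteq> 0"
      if t: "t \<noteq> 0" and c: "c \<in> reflect N x b P" for t c
    proof -
      have two: "\<sigma>' \<in> {1..N} \<and> e' c' + s *s e' \<sigma>' \<in> flag \<sigma>' \<and> E.X \<sigma>' (e' c' + s *s e' \<sigma>') \<noteq> 0"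
        if "s \<noteq> 0" "c' < \<sigma>'" "c' \<in> {1..N}" "\<sigma>' \<in> {1..N}" for s c' \<sigma>'
      proof -
        have "e' c' + s *s e' \<sigma>' \<in> flag \<sigma>'"
          using basis_leading(1)[OF e', of c' \<sigma>'] basis_leading(1)[OF e', of \<sigma>' \<sigma>'] that
          by (auto intro!: vec.span_add vec.span_scale)
        moreover have "E.X \<sigma>' (e' c' + s *s e' \<sigma>') = s"
          using basis_leading(2)[OF e', of c' \<sigma>'] basis_leading(2)[OF e', of \<sigma>' \<sigma>'] that
          by (simp add: E.coord_add E.coord_scale)
        ultimately show ?thesis using that by simp
      qed
      have "k \<noteq> 0" using E.form_basis_nonzero[OF b] nz by (simp add: k_def bb_def)
      consider "c = x" | "c = bb" | "c \<in> P" "c \<noteq> x" "c \<noteq> bb" using c xb nP unfolding mem by blast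
      then show ?thesis
      proof cases
        case 1
        then show ?thesis using two[of t x b] t xb x b by (simp add: \<sigma>_def ux)
      next
        case 2
        then show ?thesis using two[of "t * k" bb bx] t \<open>k \<noteq> 0\<close> bar by (simp add: \<sigma>_def ub)
      next
        case 3
        then have "c \<in> {1..N}" using p(1) by auto
        then show ?thesis using 3 basis_leading[OF e', of c c] by (simp add: \<sigma>_def uo)
      qed
    qed
  qed (auto simp: u_def)
qed

lemma flip_deformation:
  assumes e': "same_flags e'" and P: "P \<in> schubert_symbols N m" and Q: "exchange x b P \<in> schubert_symbols N m"
    and xb: "1 \<le> x" "x < b" "b \<in> P" "x = N + 1 - b" "ty \<noteq> Type_D"
  shows "vec.span (e' ` exchange x b P) \<in> schubert_variety N m \<omega> e P"
proof -
  interpret E: isotropic_setting ty n \<omega> e' using e' by (simp add: same_flags_def)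
  note p = symbol_props[OF P] and q = symbol_props[OF Q]
  have b: "b \<in> {1..N}" using xb p by auto
  have x: "x \<in> {1..N}" "x + b = N + 1" using xb b by auto
  have xP: "x \<notin> P" using p(4)[of x b] x xb by blast
  have mem: "c \<in> exchange x b P \<longleftrightarrow> c = x \<or> c \<in> P \<and> c \<noteq> b" for c using xb(2) by (auto simp: exchange_def)
  \<comment> \<open>In type B the vector e_x + t e_(n+1) + h t^2 e_b has square t^2 (1 + 2 h), hence
    h = -1/2. In type C every vector is isotropic and e_x + t e_b suffices.\<close>
  define h :: complex where "h = - (1 / 2)"
  have h: "1 + (h + h) = 0" "h \<noteq> 0" by (simp_all add: h_def)
  define u where "u c = (if c = x then if ty = Type_B then e' (n + 1) else e' b else 0)" for c
  define u' where "u' c = (if c = x \<and> ty = Type_B then h *s e' b else 0)" for c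
  define \<sigma> where "\<sigma> c = (if c = x then b else c)" for c
  have z: "\<omega> (e' c) (e' d) = 0" if "c \<in> {1..N}" "d \<in> {1..N}" "c + d \<noteq> N + 1" for c d
    using E.form_basis_zero that by blast
  have mid: "n + 1 \<in> {1..N}" "x < n + 1" "n + 1 < b" "n + 1 \<notin> P" if "ty = Type_B"
    using that xb x p(4)[of "n + 1" "n + 1"] by auto
  note lin = E.form_add_left E.form_add_right E.form_scale_left E.form_scale_right E.form_zero
    E.form_diff_left E.form_diff_right
  have xx: "\<omega> (e' x + t *s u x + (t * t) *s u' x) (e' x + t *s u x + (t * t) *s u' x) = 0" for t
  proof (cases "ty = Type_B")
    case True
    have "\<omega> (e' x) (e' b) = 1" "\<omega> (e' (n + 1)) (e' (n + 1)) = 1"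
      using E.form_basis[of x b] E.form_basis[of "n + 1" "n + 1"] x b xb True by auto
    moreover have "\<omega> (e' b) (e' x) = 1" using symmetry[of "e' b" "e' x"] True \<open>\<omega> (e' x) (e' b) = 1\<close> by simp
    moreover have "\<omega> (e' x) (e' x) = 0" "\<omega> (e' b) (e' b) = 0" "\<omega> (e' x) (e' (n + 1)) = 0"
      "\<omega> (e' (n + 1)) (e' x) = 0" "\<omega> (e' b) (e' (n + 1)) = 0" "\<omega> (e' (n + 1)) (e' b) = 0"
      using mid[OF True] x b xb by (auto intro!: z)
    ultimately have "\<omega> (e' x + t *s u x + (t * t) *s u' x) (e' x + t *s u x + (t * t) *s u' x) =
        t * t * (1 + (h + h))"
      using True by (simp add: u_def u'_def lin algebra_simps)
    then show ?thesis using h(1) by simp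
  next
    case False
    then have "ty = Type_C" using xb(5) by (cases ty) auto
    then have "\<omega> v v = 0" for v using symmetry[of v v] by (simp add: eq_neg_iff_add_eq_0)
    then show ?thesis by blast
  qed
  have uo: "u c = 0" "u' c = 0" if "c \<noteq> x" for c using that by (auto simp: u_def u'_def)
  have ox: "\<omega> (e' c) (e' x + t *s u x + (t * t) *s u' x) = 0" if "c \<in> P" "c \<noteq> b" for c t
  proof -
    have c: "c \<in> {1..N}" "c + x \<noteq> N + 1" "c + b \<noteq> N + 1" using that p(1) p(4)[OF that(1) xb(3)] x by auto
    have "ty = Type_B \<Longrightarrow> c + (n + 1) \<noteq> N + 1" using mid(4) that by auto
    then show ?thesis
      using z[of c x] z[of c b] z[of c "n + 1"] c x(1) b mid(1) by (auto simp: u_def u'_def lin)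
  qed
  have sym0: "\<omega> y z = 0" if "\<omega> z y = 0" for y z using symmetry[where x = z and y = y] that by simp
  show ?thesis
  proof (rule deformation[where w = "\<lambda>t c. e' c + t *s u c + (t * t) *s u' c" and u = u and u' = u' and \<sigma> = \<sigma>])
    show "same_flags e'" "exchange x b P \<subseteq> {1..N}" "card (exchange x b P) = m" using e' q by auto
    show "inj_on \<sigma> (exchange x b P)" by (rule inj_onI) (auto simp: \<sigma>_def mem split: if_splits)
    have "\<sigma> ` (P - {b}) = P - {b}" using xP by (auto simp: \<sigma>_def image_iff)
    then show "\<sigma> ` exchange x b P = P" using xb by (auto simp: \<sigma>_def exchange_def)
    show "\<omega> (e' c + t *s u c + (t * t) *s u' c) (e' d + t *s u d + (t * t) *s u' d) = 0"
      if cd: "c \<in> exchange x b P" "d \<in> exchange x b P" for t c d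
    proof -
      consider "c = x" "d = x" | "c = x" "d \<in> P" "d \<noteq> b" | "c \<in> P" "c \<noteq> b" "d = x"
        | "c \<in> P" "c \<noteq> b" "d \<in> P" "d \<noteq> b"
        using cd unfolding mem by blast
      then show ?thesis
      proof cases
        case 1 then show ?thesis using xx by simp
      next
        case 2
        then have "d \<noteq> x" using xP by auto
        then show ?thesis using 2(1) sym0[OF ox[OF 2(2,3)]] by (simp add: uo)
      next
        case 3
        then have "c \<noteq> x" using xP by auto
        then show ?thesis using 3(3) ox[OF 3(1,2)] by (simp add: uo)
      next
        case 4
        then have "c \<noteq> x" "d \<noteq> x" using xP by auto
        moreover have "\<omega> (e' c) (e' d) = 0" by (rule z) (use 4 p in auto)
        ultimately show ?thesis by (simp add: uo)
      qed
    qed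
    show "\<sigma> c \<in> {1..N} \<and> e' c + t *s u c + (t * t) *s u' c \<in> flag (\<sigma> c) \<and>
        E.X (\<sigma> c) (e' c + t *s u c + (t * t) *s u' c) \<noteq> 0"
      if t: "t \<noteq> 0" and c: "c \<in> exchange x b P" for t c
    proof (cases "c = x")
      case True
      have fx: "e' x \<in> flag b" "e' b \<in> flag b" "E.X b (e' x) = 0" "E.X b (e' b) = 1"
        using basis_leading[OF e', of x b] basis_leading[OF e', of b b] b x(1) xb by auto
      have fm: "e' (n + 1) \<in> flag b" "E.X b (e' (n + 1)) = 0" if "ty = Type_B"
        using basis_leading[OF e', of "n + 1" b] mid[OF that] b by auto
      have "u x \<in> flag b" "u' x \<in> flag b" using fx fm by (auto simp: u_def u'_def intro: vec.span_scale vec.span_zero)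
      then have "e' x + t *s u x + (t * t) *s u' x \<in> flag b" using fx by (intro vec.span_add vec.span_scale)
      moreover have "E.X b (e' x + t *s u x + (t * t) *s u' x) = (if ty = Type_B then t * t * h else t)"
      proof (cases "ty = Type_B")
        case True
        have "u x = e' (n + 1)" "u' x = h *s e' b" using True by (auto simp: u_def u'_def)
        then have "E.X b (e' x + t *s u x + (t * t) *s u' x) = t * t * h"
          using fx(3,4) fm(2)[OF True] by (simp only: E.coord_add E.coord_scale) simp
        then show ?thesis by (simp only: True simp_thms if_True)
      next
        case False
        have "u x = e' b" "u' x = 0" using False by (auto simp: u_def u'_def)
        then show ?thesis using fx(3,4) False by (simp add: E.coord_add E.coord_scale E.coord_zero)
      qed
      ultimately show ?thesis using True b t h(2) by (simp add: \<sigma>_def)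
    next
      case False
      then have "c \<in> {1..N}" using c p(1) by (auto simp: mem)
      then show ?thesis using False uo[of c] basis_leading[OF e', of c c] by (simp add: \<sigma>_def)
    qed
  qed (auto simp: u_def u'_def)
qed

lemma lowers_bruhat_le:
  assumes "lowers ty n m P Q"
  shows "bruhat_le N m \<omega> e Q P"
proof -
  have P: "P \<in> schubert_symbols N m" and Q: "Q \<in> schubert_symbols N m"
    using assms by (auto simp: lowers_def Let_def)
  have "{\<Sigma> \<in> isotropic_grassmannian m \<omega>. jump_set N e \<Sigma> = Q} \<subseteq> schubert_variety N m \<omega> e P"
  proof
    fix S assume "S \<in> {\<Sigma> \<in> isotropic_grassmannian m \<omega>. jump_set N e \<Sigma> = Q}"
    then obtain e' where e': "same_flags e'" "vec.span (e' ` Q) = S" using adapted_basis[of S m Q] Q by auto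
    consider (ex) a b where "1 \<le> a" "a < b" "b \<in> P" "a \<notin> sym_closure N P" "a \<noteq> N + 1 - a" "Q = exchange a b P"
      | (re) x b where "1 \<le> x" "x < b" "b \<in> P" "x \<notin> P" "N + 1 - x \<in> P" "x = N + 1 - b \<longrightarrow> ty \<noteq> Type_D"
        "Q = reflect N x b P"
      using assms unfolding lowers_def Let_def by blast
    then show "S \<in> schubert_variety N m \<omega> e P"
    proof cases
      case ex
      then show ?thesis using exchange_deformation[OF e'(1) P, of a b] Q e'(2) by simp
    next
      case re
      show ?thesis
      proof (cases "x = N + 1 - b")
        case True
        have "b \<le> N" using re(3) symbol_props(1)[OF P] by auto
        then have "Q = exchange x b P" using re True by (auto simp: reflect_def exchange_def)
        then show ?thesis using flip_deformation[OF e'(1) P, of x b] re True Q e'(2) by simp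
      next
        case False
        then show ?thesis using reflect_deformation[OF e'(1) P, of x b] re Q e'(2) by simp
      qed
    qed
  qed
  then show ?thesis
    unfolding bruhat_le_def schubert_variety_def[of N m \<omega> e Q]
    by (rule closure_of_minimal) (simp add: schubert_variety_def)
qed

lemma lowers_chain_bruhat_le:
  assumes "(lowers ty n m)\<^sup>*\<^sup>* P Q"
  shows "bruhat_le N m \<omega> e Q P"
  using assms
proof (induction rule: rtranclp_induct)
  case (step Q R)
  then show ?case using lowers_bruhat_le[OF step(2)] by (auto simp: bruhat_le_def)
qed (simp add: bruhat_le_def)

section \<open>From the geometric order to the combinatorial one\<close>

lemma reduced_jump_vectors:
  assumes S: "vec.subspace S" and P: "jump_set N e S = P"
  shows "\<exists>v. \<forall>q\<in>P. v q \<in> S \<and> v q \<in> flag q \<and> (\<forall>p\<in>P. X p (v q) = of_bool (p = q))"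
proof -
  have PN: "P \<subseteq> {1..N}" using P by (auto simp: jump_set_def)
  have finP: "finite P" using PN finite_subset by blast
  obtain w where w: "\<And>p. p \<in> P \<Longrightarrow> w p \<in> S \<and> w p \<in> flag p \<and> X p (w p) = 1"
    using jump_vectors[OF S] P by metis
  have "\<exists>v. v \<in> S \<and> v \<in> flag q \<and> (\<forall>p\<in>P. X p v = of_bool (p = q))" if q: "q \<in> P" for q
  proof -
    have "card (P - {q}) < card P" by (rule card_Diff1_less[OF finP q])
    \<comment> \<open>One equation fewer than unknowns: some combination vanishes at all positions
      of P except q. Its leading position is in P, hence equal to q.\<close>
    then obtain a where a: "\<exists>p\<in>P. a p \<noteq> 0" "\<forall>t\<in>P - {q}. (\<Sum>p\<in>P. a p * X t (w p)) = 0"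
      using underdetermined_system[of "P - {q}" P "\<lambda>t p. X t (w p)"] finP by auto
    define v where "v = (\<Sum>p\<in>P. a p *s w p)"
    have z: "X t v = 0" if "t \<in> P" "t \<noteq> q" for t
      using a(2) that by (simp add: v_def coord_sum coord_scale)
    have lead: "id p \<in> {1..N} \<and> w p \<in> flag (id p) \<and> X (id p) (w p) \<noteq> 0" if "p \<in> P" for p
      using w[OF that] that PN by auto
    obtain p where p: "p \<in> P" "v \<in> flag p" "X p v \<noteq> 0"
      using echelon_leading[OF finP lead inj_on_id a(1)] unfolding v_def by auto
    then have "p = q" using z by blast
    have "v \<in> S" unfolding v_def using w S by (intro vec.subspace_sum vec.subspace_scale) auto
    then show ?thesis
      using p z S \<open>p = q\<close> by (intro exI[of _ "inverse (X q v) *s v"])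
        (auto simp: coord_scale intro: vec.subspace_scale vec.span_scale)
  qed
  then show ?thesis by metis
qed

text \<open>The hypothesis on \<open>S\<close> says that its Pluecker coordinate \<open>p\<^sub>T\<close> does not vanish. In type D, two charts of
  a maximal isotropic subspace differ by a skew-symmetric minor, which vanishes in odd size.\<close>

lemma nonzero_coordinates_imp_comb_le:
  assumes S: "S \<in> isotropic_grassmannian m \<omega>" "jump_set N e S = P"
    and P: "P \<in> schubert_symbols N m" and T: "T \<in> schubert_symbols N m"
    and inj: "\<And>v. v \<in> S \<Longrightarrow> \<forall>t\<in>T. X t v = 0 \<Longrightarrow> v = 0"
  shows "comb_le ty n T P"
proof -
  interpret PT: symbol_pair ty n m P T using P T by unfold_locales
  have sub: "vec.subspace S" and iso: "\<And>u v. u \<in> S \<Longrightarrow> v \<in> S \<Longrightarrow> \<omega> u v = 0"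
    using S(1) by (auto simp: isotropic_grassmannian_def)
  note p = symbol_props[OF P] and t = symbol_props[OF T]
  obtain v where v': "\<forall>q\<in>P. v q \<in> S \<and> v q \<in> flag q \<and> (\<forall>p\<in>P. X p (v q) = of_bool (p = q))"
    using reduced_jump_vectors[OF sub S(2)] by blast
  have v: "v p \<in> S \<and> v p \<in> flag p" if "p \<in> P" for p using v' that by blast
  have dual: "X p (v q) = of_bool (p = q)" if "p \<in> P" "q \<in> P" for p q using v' that by blast
  have high: "X i (v q) = 0" if "q \<in> P" "i \<in> {1..N}" "q < i" for q i
    using v[OF that(1)] mem_flag_iff[of q "v q"] that p(1) by auto
  have coordP: "X i (\<Sum>q\<in>A. a q *s v q) = (if i \<in> A then a i else 0)" if "A \<subseteq> P" "i \<in> P" for A a i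
  proof -
    have "X i (\<Sum>q\<in>A. a q *s v q) = (\<Sum>q\<in>A. if q = i then a q else 0)"
      unfolding coord_sum coord_scale by (rule sum.cong) (use dual that in auto)
    then show ?thesis using finite_subset[OF that(1) p(3)] by simp
  qed
  have memS: "(\<Sum>q\<in>A. a q *s v q) \<in> S" if "A \<subseteq> P" for A a
    using v sub that by (intro vec.subspace_sum vec.subspace_scale) auto
  have nonneg: "0 \<le> excess P T c" if c: "c \<le> N" for c
  proof (rule ccontr)
    assume "\<not> 0 \<le> excess P T c"
    then have lt: "card (T \<inter> {1..c}) < card (P \<inter> {1..c})" by (simp add: excess_def count_upto_def)
    have fin: "finite (T \<inter> {1..c})" "finite (P \<inter> {1..c})" by auto
    \<comment> \<open>S meets F_c in a space of dimension #(P \<inter> [1, c]); with fewer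
      coordinates of T there, some nonzero vector of it has all its T-coordinates equal to
      zero.\<close>
    obtain a where a: "\<exists>q\<in>P \<inter> {1..c}. a q \<noteq> 0" "\<forall>s\<in>T \<inter> {1..c}. (\<Sum>q\<in>P \<inter> {1..c}. a q * X s (v q)) = 0"
      using underdetermined_system[OF fin lt, of "\<lambda>s q. X s (v q)"] by blast
    define u where "u = (\<Sum>q\<in>P \<inter> {1..c}. a q *s v q)"
    have "X s u = 0" if s: "s \<in> T" for s
    proof (cases "s \<le> c")
      case True
      then show ?thesis using a(2) s t(1) by (auto simp: u_def coord_sum coord_scale)
    next
      case False
      then show ?thesis unfolding u_def coord_sum coord_scale
        using s t(1) by (intro sum.neutral) (auto intro!: high)
    qed
    moreover have "u \<in> S" unfolding u_def by (rule memS) auto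
    ultimately have "u = 0" using inj by blast
    obtain q where q: "q \<in> P \<inter> {1..c}" "a q \<noteq> 0" using a(1) by blast
    then have "X q u = a q" using coordP[of "P \<inter> {1..c}" q a] by (simp add: u_def)
    then show False using q \<open>u = 0\<close> by (simp add: coord_zero)
  qed
  have pos_half: "excess P T c \<noteq> 0" if f: "parity_defect ty n P T c" and cn: "c \<le> n" for c
  proof
    assume z: "excess P T c = 0"
    have ty: "ty = Type_D" using f by (simp add: parity_defect_def)
    have N: "N = 2 * n + 2" using ty by simp
    have odd: "odd (excess P T (n + 1))" using f by (simp add: parity_defect_def)
    \<comment> \<open>The defect says that every mirror pair strictly between c and N + 1 - c meets
      both P and T.\<close>
    have inP: "i \<in> P \<or> N + 1 - i \<in> P" and inT: "i \<in> T \<or> N + 1 - i \<in> T" if i: "c < i" "i \<le> N - c" for i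
    proof -
      have half: "j \<in> PT.clP \<and> j \<in> PT.clT" if "c < j" "j \<le> n + 1" for j
      proof -
        have "j \<in> {min c (2 * n + 2 - c) + 1..n + 1}" using that cn by auto
        then show ?thesis using f N unfolding parity_defect_def by auto
      qed
      have "(i \<in> P \<or> N + 1 - i \<in> P) \<and> (i \<in> T \<or> N + 1 - i \<in> T)"
      proof (cases "i \<le> n + 1")
        case True
        then show ?thesis using half[of i] i unfolding PT.in_clP PT.in_clT by blast
      next
        case False
        then have "N + 1 - (N + 1 - i) = i" "c < N + 1 - i" "N + 1 - i \<le> n + 1" using i N by auto
        then show ?thesis using half[of "N + 1 - i"] unfolding PT.in_clP PT.in_clT by auto
      qed
      then show "i \<in> P \<or> N + 1 - i \<in> P" "i \<in> T \<or> N + 1 - i \<in> T" by auto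
    qed
    \<comment> \<open>The positions of the middle range where P and T take opposite members of a
      mirror pair. Each such pair changes the excess by an odd amount, so card A has the parity of D
      (n + 1) - D c.\<close>
    define A where "A = {q \<in> P. c < q \<and> q \<le> N - c \<and> q \<notin> T}"
    have AP: "A \<subseteq> P" and finA: "finite A" using p(3) by (auto simp: A_def)
    have oddA: "odd (card A)"
    proof -
      define f where "f i = (of_bool (i \<in> T) - of_bool (i \<in> P) :: int)" for i
      have tel: "excess P T (c + k) = (\<Sum>i\<in>{c + 1..c + k}. f i)" for k
      proof (induction k)
        case (Suc k)
        then show ?case using excess_step[of "c + Suc k" P T] by (simp add: f_def)
      qed (use z in simp)
      have half: "excess P T (n + 1) = (\<Sum>i\<in>{c + 1..n + 1}. f i)" using tel[of "n + 1 - c"] cn by simp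
      define g where "g i = (of_bool (i \<in> A) + of_bool (N + 1 - i \<in> A) :: int)" for i
      have par: "even (f i + g i)" if i: "i \<in> {c + 1..n + 1}" for i
      proof -
        have r: "c < i" "i \<le> N - c" "c < N + 1 - i" "N + 1 - i \<le> N - c" using i cn N by auto
        have ex: "\<not> (i \<in> P \<and> N + 1 - i \<in> P)" "\<not> (i \<in> T \<and> N + 1 - i \<in> T)"
          using PT.P_bar PT.T_bar by auto
        show ?thesis using inP[OF r(1,2)] inT[OF r(1,2)] ex r by (auto simp: f_def g_def A_def)
      qed
      have "even (\<Sum>i\<in>{c + 1..n + 1}. f i + g i)" by (rule dvd_sum) (use par in auto)
      then have "odd (\<Sum>i\<in>{c + 1..n + 1}. g i)" using odd half by (simp add: sum.distrib)
      moreover have "(\<Sum>i\<in>{c + 1..n + 1}. g i) = int (card A)"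
      proof -
        have A2: "A = {i \<in> {c + 1..n + 1}. i \<in> A} \<union> (\<lambda>i. N + 1 - i) ` {i \<in> {c + 1..n + 1}. N + 1 - i \<in> A}"
        proof (intro equalityI subsetI)
          fix q assume q: "q \<in> A"
          then have q': "c < q" "q \<le> N - c" by (auto simp: A_def)
          show "q \<in> {i \<in> {c + 1..n + 1}. i \<in> A} \<union> (\<lambda>i. N + 1 - i) ` {i \<in> {c + 1..n + 1}. N + 1 - i \<in> A}"
          proof (cases "q \<le> n + 1")
            case False
            then have "q = N + 1 - (N + 1 - q)" "N + 1 - q \<in> {c + 1..n + 1}" using q' N by auto
            then show ?thesis using q by (intro UnI2 image_eqI[of _ _ "N + 1 - q"]) auto
          qed (use q q' in auto)
        qed auto
        have "card A = card {i \<in> {c + 1..n + 1}. i \<in> A} + card ((\<lambda>i. N + 1 - i) ` {i \<in> {c + 1..n + 1}. N + 1 - i \<in> A})"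
          by (subst A2, rule card_Un_disjoint) (use N in auto)
        also have "card ((\<lambda>i. N + 1 - i) ` {i \<in> {c + 1..n + 1}. N + 1 - i \<in> A}) = card {i \<in> {c + 1..n + 1}. N + 1 - i \<in> A}"
          by (rule card_image) (use N in \<open>auto simp: inj_on_def\<close>)
        finally have cardA: "int (card A) = int (card {i \<in> {c + 1..n + 1}. i \<in> A}) +
            int (card {i \<in> {c + 1..n + 1}. N + 1 - i \<in> A})" by simp
        have sb: "(\<Sum>i\<in>{c + 1..n + 1}. of_bool (Q i)) = int (card {i \<in> {c + 1..n + 1}. Q i})" for Q
          by (subst sum_of_bool_eq) (simp_all add: Int_def)
        show ?thesis unfolding g_def sum.distrib sb by (rule cardA[symmetric])
      qed
      ultimately show ?thesis by simp
    qed
    \<comment> \<open>Expand 0 = \<omega> (v r) (v q). Outside the middle range one factor of each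
      product vanishes by the flag condition, inside it by the reduced form, except in the terms i =
      r and i = N + 1 - q.\<close>
    have skew: "X (N + 1 - r) (v q) = - X (N + 1 - q) (v r)" if rq: "r \<in> A" "q \<in> A" for r q
    proof -
      have r: "r \<in> P" "q \<in> P" "c < r" "r \<le> N - c" "c < q" "q \<le> N - c" using rq by (auto simp: A_def)
      have one: "\<omega> (e i) (e (N + 1 - i)) = 1" if "i \<in> {1..N}" for i
        using form_basis[of i "N + 1 - i"] form_basis[of "N + 1 - i" i] symmetry[of "e (N + 1 - i)" "e i"] ty that
        by (cases "i \<le> N + 1 - i") auto
      define h where "h i = X i (v r) * X (N + 1 - i) (v q)" for i
      have "0 = \<omega> (v r) (v q)" using iso v r by simp
      also have "\<dots> = (\<Sum>i\<in>{1..N}. h i)"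
        unfolding h_def by (subst form_expand, rule sum.cong) (use one in auto)
      also have "\<dots> = (\<Sum>i\<in>{r, N + 1 - q}. h i)"
      proof (rule sum.mono_neutral_right)
        show "{r, N + 1 - q} \<subseteq> {1..N}" using r p(1) by auto
        show "\<forall>i\<in>{1..N} - {r, N + 1 - q}. h i = 0"
        proof
          fix i assume i: "i \<in> {1..N} - {r, N + 1 - q}"
          show "h i = 0"
          proof (cases "c < i \<and> i \<le> N - c")
            case False
            then have "r < i \<or> q < N + 1 - i" using i r by auto
            moreover have "N + 1 - i \<in> {1..N}" "i \<in> {1..N}" using i by auto
            ultimately show ?thesis
              using high[of r i] high[of q "N + 1 - i"] r(1,2) unfolding h_def by auto
          next
            case True
            then consider "i \<in> P" | "N + 1 - i \<in> P" using inP by blast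
            then show ?thesis
            proof cases
              case 1
              then show ?thesis using dual[of i r] r i by (auto simp: h_def)
            next
              case 2
              moreover have "N + 1 - i \<noteq> q" using i by auto
              ultimately show ?thesis using dual[of "N + 1 - i" q] r by (auto simp: h_def)
            qed
          qed
        qed
      qed simp
      also have "\<dots> = h r + h (N + 1 - q)"
      proof -
        have "r \<noteq> N + 1 - q" using p(4)[OF r(1,2)] r(2) p(1) by auto
        then show ?thesis by simp
      qed
      also have "\<dots> = X (N + 1 - r) (v q) + X (N + 1 - q) (v r)"
      proof -
        have "N + 1 - (N + 1 - q) = q" using r p(1) by auto
        then show ?thesis using dual[of r r] dual[of q q] r by (simp add: h_def)
      qed
      finally show ?thesis by (simp add: eq_neg_iff_add_eq_0)
    qed
    obtain a where a: "\<exists>q\<in>A. a q \<noteq> 0" "\<forall>r\<in>A. (\<Sum>q\<in>A. a q * X (N + 1 - r) (v q)) = 0"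
      using odd_skew_kernel[OF finA oddA, of "\<lambda>r q. X (N + 1 - r) (v q)"] skew by blast
    define w where "w = (\<Sum>q\<in>A. a q *s v q)"
    have wS: "w \<in> S" unfolding w_def by (rule memS[OF AP])
    \<comment> \<open>Beyond N - c all vectors vanish; at positions of P the reduced form applies,
      since A avoids T; the remaining positions of T are mirrors of elements of A, where the kernel
      equations hold.\<close>
    have wT: "X s w = 0" if s: "s \<in> T" "c < s" for s
    proof -
      have sN: "s \<in> {1..N}" using s t(1) by auto
      consider "N - c < s" | "s \<le> N - c" "s \<in> P" | "s \<le> N - c" "N + 1 - s \<in> P" using inP[of s] s by force
      then show ?thesis
      proof cases
        case 1
        then show ?thesis unfolding w_def coord_sum coord_scale
          using sN AP by (intro sum.neutral) (auto simp: A_def intro!: high)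
      next
        case 2
        then show ?thesis using coordP[OF AP, of s a] s by (auto simp: w_def A_def)
      next
        case 3
        then have "N + 1 - s \<in> A" using PT.T_bar[OF s(1)] s sN by (auto simp: A_def)
        then have "(\<Sum>q\<in>A. a q * X (N + 1 - (N + 1 - s)) (v q)) = 0" using a(2) by blast
        moreover have "N + 1 - (N + 1 - s) = s" using sN by auto
        ultimately show ?thesis by (simp add: w_def coord_sum coord_scale)
      qed
    qed
    define P0 where "P0 = P \<inter> {1..c}"
    \<comment> \<open>The index 0, which lies in no symbol, stands for w. As D c = 0, the vectors
      v_q with q \<le> c are exactly as many as the coordinates of T up to c, and w is the one
      unknown too many.\<close>
    define v0 where "v0 q = (if q = 0 then w else v q)" for q
    have P0: "finite P0" "0 \<notin> P0" "P0 \<subseteq> P" by (auto simp: P0_def)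
    have "card (T \<inter> {1..c}) < card (insert 0 P0)"
      using z P0 by (simp add: excess_def count_upto_def P0_def)
    then obtain d where d: "\<exists>q\<in>insert 0 P0. d q \<noteq> 0"
      "\<forall>s\<in>T \<inter> {1..c}. (\<Sum>q\<in>insert 0 P0. d q * X s (v0 q)) = 0"
      using underdetermined_system[of "T \<inter> {1..c}" "insert 0 P0" "\<lambda>s q. X s (v0 q)"] P0(1) by auto
    define u where "u = d 0 *s w + (\<Sum>q\<in>P0. d q *s v q)"
    have u_coord: "X s u = (\<Sum>q\<in>insert 0 P0. d q * X s (v0 q))" for s
    proof -
      have "(\<Sum>q\<in>P0. d q * X s (v0 q)) = (\<Sum>q\<in>P0. d q * X s (v q))"
        by (rule sum.cong) (use P0 in \<open>auto simp: v0_def\<close>)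
      then show ?thesis using P0 by (simp add: u_def coord_add coord_sum coord_scale v0_def)
    qed
    have "X s u = 0" if s: "s \<in> T" for s
    proof (cases "s \<le> c")
      case True
      then show ?thesis using d(2) s t(1) u_coord by auto
    next
      case False
      have "(\<Sum>q\<in>P0. d q * X s (v q)) = 0"
        using s t(1) False by (intro sum.neutral) (auto simp: P0_def intro!: high)
      then show ?thesis using wT[OF s] False by (simp add: u_def coord_add coord_sum coord_scale)
    qed
    moreover have "u \<in> S"
      unfolding u_def using wS memS[OF P0(3)] sub by (intro vec.subspace_add vec.subspace_scale)
    ultimately have u0: "u = 0" using inj by blast
    obtain q where q: "q \<in> A" "a q \<noteq> 0" using a(1) by blast
    have "q \<in> P" "q \<notin> P0" using q by (auto simp: A_def P0_def)
    \<comment> \<open>At q in A only w contributes. So u = 0 kills the coefficient of w, and then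
      all the others.\<close>
    then have "X q u = d 0 * a q"
      using coordP[OF AP, of q a] coordP[OF P0(3), of q d] q by (simp add: u_def coord_add coord_scale w_def)
    then have d0: "d 0 = 0" using u0 q by (simp add: coord_zero)
    have "d i = 0" if i: "i \<in> P0" for i
    proof -
      have "X i u = d i" using coordP[OF P0(3), of i d] i P0 d0 by (auto simp: u_def coord_add coord_scale)
      then show ?thesis using u0 by (simp add: coord_zero)
    qed
    then show False using d(1) d0 by auto
  qed
  show ?thesis
    unfolding comb_le_def
  proof (intro allI impI)
    fix c assume "regular_point ty n c"
    then have c: "c \<le> N" by (simp add: regular_point_def)
    have "1 \<le> excess P T c" if f: "parity_defect ty n P T c"
    proof -
      have ty: "ty = Type_D" "c \<noteq> n + 1" using f by (auto simp: parity_defect_def)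
      have "excess P T c \<noteq> 0"
      proof (cases "c \<le> n")
        case True
        then show ?thesis using pos_half f by blast
      next
        case False
        then have "N - c \<le> n" using ty by auto
        then show ?thesis using pos_half[of "N - c"] f PT.full_sym[OF c] PT.full_eq[OF f c] by auto
      qed
      then show ?thesis using nonneg[OF c] by linarith
    qed
    then show "0 \<le> reduced_excess ty n P T c" using nonneg[OF c] by (auto simp: reduced_excess_def)
  qed
qed

lemma bruhat_le_imp_comb_le:
  assumes P: "P \<in> schubert_symbols N m" and T: "T \<in> schubert_symbols N m"
    and le: "bruhat_le N m \<omega> e T P"
  shows "comb_le ty n T P"
proof -
  note t = symbol_props[OF T]
  let ?S0 = "vec.span (e ` T)"
  have lead: "id p \<in> {1..N} \<and> e p \<in> flag (id p) \<and> X (id p) (e p) \<noteq> 0" if "p \<in> T" for p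
    using that t(1) basis_leading[OF same_flags_refl, of p p] by auto
  have "?S0 \<in> schubert_variety N m \<omega> e T"
  \<comment> \<open>A constant curve places the coordinate subspace of T in its own Schubert
    variety.\<close>
  proof (rule deformation[where w = "\<lambda>_. e" and u = "\<lambda>_. 0" and u' = "\<lambda>_. 0" and \<sigma> = id])
    show "\<omega> (e p) (e q) = 0" if "p \<in> T" "q \<in> T" for p q
      by (rule form_basis_zero) (use that t in auto)
  qed (use same_flags_refl t lead in auto)
  then have S0: "?S0 \<in> schubert_variety N m \<omega> e P" using le by (auto simp: bruhat_le_def)
  let ?I = "{I. I \<subseteq> {1..N} \<and> card I = m}"
  let ?U = "{\<Sigma> \<in> isotropic_grassmannian m \<omega>. \<exists>b. is_frame m b \<Sigma> \<and> (\<lambda>z. z T) (pluecker N m e b) \<noteq> 0}"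
  have U: "openin (zariski_topology N m \<omega> e) ?U"
    unfolding zariski_topology_def
    by (rule topology_generated_by_Basis, rule CollectI)
      (intro exI[of _ "\<lambda>z. z T"] exI[of _ 1] conjI refl hom_poly_fun.var, use t in auto)
  define f where "f j = sorted_list_of_set T ! j" for j
  have bij: "bij_betw f {..<m} T"
    using bij_betw_nth[of "sorted_list_of_set T" "{..<m}" T] t by (simp add: f_def[abs_def])
  have fT: "f j \<in> {1..N}" if "j < m" for j using bij that t(1) by (auto simp: bij_betw_def)
  have f_eq: "f i = f j \<longleftrightarrow> i = j" if "i < m" "j < m" for i j
    using bij that by (auto simp: bij_betw_def inj_on_eq_iff)
  have "?S0 \<in> ?U"
  proof -
    have iso: "?S0 \<in> isotropic_grassmannian m \<omega>"
      by (rule isotropic_spanI)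
        (use t echelon(1,2)[OF t(3) lead inj_on_id] form_basis_zero in \<open>auto intro!: form_basis_zero\<close>)
    have "is_frame m (\<lambda>j. e (f j)) ?S0"
    proof -
      have img: "(\<lambda>j. e (f j)) ` {..<m} = e ` T" using bij by (auto simp: bij_betw_def image_image[symmetric])
      have "inj_on (\<lambda>j. e (f j)) {..<m}"
        using comp_inj_on[of f "{..<m}" e] bij echelon(1)[OF t(3) lead inj_on_id] by (simp add: bij_betw_def comp_def)
      then show ?thesis using img echelon(2)[OF t(3) lead inj_on_id] by (simp add: is_frame_def)
    qed
    moreover have "pluecker N m e (\<lambda>j. e (f j)) T = 1"
    proof -
      have one: "X (sorted_list_of_set T ! i) (e (f j)) = of_bool (i = j)" if "i < m" "j < m" for i j
        using coord_basis[OF fT[OF that(2)] fT[OF that(1)]] f_eq[OF that] by (simp add: f_def)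
      have "Matrix.mat m m (\<lambda>(i, j). X (sorted_list_of_set T ! i) (e (f j))) = 1\<^sub>m m"
        by (rule eq_matI) (simp_all add: one)
      then show ?thesis by (simp add: pluecker_def)
    qed
    ultimately show ?thesis using iso by force
  qed
  then have "\<exists>S. S \<in> {\<Sigma> \<in> isotropic_grassmannian m \<omega>. jump_set N e \<Sigma> = P} \<and> S \<in> ?U"
    using S0[unfolded schubert_variety_def in_closure_of, THEN conjunct2, rule_format, of ?U] U by simp
  then obtain S where S: "S \<in> isotropic_grassmannian m \<omega>" "jump_set N e S = P" "S \<in> ?U" by blast
  then obtain b where b: "is_frame m b S" "pluecker N m e b T \<noteq> 0" by blast
  show ?thesis
  proof (rule nonzero_coordinates_imp_comb_le[OF S(1,2) P T])
    fix v assume v: "v \<in> S" "\<forall>t\<in>T. X t v = 0"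
    have "v \<in> vec.span (b ` {..<m})" using v b by (simp add: is_frame_def)
    then obtain a where a: "v = (\<Sum>j<m. a j *s b j)" by (rule span_image_sum[rotated]) auto
    \<comment> \<open>The columns of this matrix are the T-coordinates of a frame of S, so a vector
      of S whose T-coordinates vanish has its coefficients in the kernel, which is zero.\<close>
    let ?M = "Matrix.mat m m (\<lambda>(i, j). X (f i) (b j))"
    have det: "Determinant.det ?M \<noteq> 0" using b(2) by (simp add: pluecker_def f_def)
    have "?M *\<^sub>v Matrix.vec m a = 0\<^sub>v m"
    proof (rule eq_vecI)
      fix i assume i: "i < dim_vec (0\<^sub>v m :: complex Matrix.vec)"
      then have "f i \<in> T" using bij by (auto simp: bij_betw_def)
      then have "0 = (\<Sum>j<m. a j * X (f i) (b j))" using v(2) by (simp add: a coord_sum coord_scale)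
      then show "vec_index (?M *\<^sub>v Matrix.vec m a) i = vec_index (0\<^sub>v m) i"
        using i by (simp add: scalar_prod_def atLeast0LessThan mult.commute)
    qed simp
    then have "Matrix.vec m a = 0\<^sub>v m"
      using det det_0_iff_vec_prod_zero[of ?M m] vec_carrier[of m a] mat_carrier by blast
    then have "a j = 0" if "j < m" for j using that by (metis index_vec index_zero_vec(1))
    then show "v = 0" by (simp add: a)
  qed
qed

end

theorem proposition6p2:
  fixes \<omega> :: "complex ^ 'n \<Rightarrow> complex ^ 'n \<Rightarrow> complex"
    and e :: "nat \<Rightarrow> complex ^ 'n"
    and ty :: grass_type and n m :: nat and P T :: "nat set"
  assumes "isotropic_setting ty n \<omega> e"
    and "1 \<le> m" and "2 * m \<le> ambient_dim ty n"
    and "P \<in> schubert_symbols (ambient_dim ty n) m"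
    and "T \<in> schubert_symbols (ambient_dim ty n) m"
    and "bruhat_le (ambient_dim ty n) m \<omega> e T P"
  shows "\<exists>P' \<in> schubert_symbols (ambient_dim ty n) m.
           bruhat_le (ambient_dim ty n) m \<omega> e T P' \<and>
           bruhat_le (ambient_dim ty n) m \<omega> e P' P \<and>
           Z_variety ty n m e P' T = Z_variety ty n m e P T \<and>
           arrow ty n m \<omega> e P' T"
proof -
  interpret isotropic_setting ty n \<omega> e by fact
  have "ordered_pair ty n m P T"
    using assms(4,5) bruhat_le_imp_comb_le[OF assms(4-6)]
    by (simp add: ordered_pair_def symbol_pair_def ordered_pair_axioms_def)
  then obtain Q where Q: "ordered_pair ty n m Q T" "(lowers ty n m)\<^sup>*\<^sup>* P Q"
    "linear_eqs ty n m Q T = linear_eqs ty n m P T" "quadratic_eqs ty n m Q T = quadratic_eqs ty n m P T"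
    "\<forall>i\<in>{1..m - 1}. entry N Q i \<le> entry N T (i + 1) \<or>
      (ty = Type_D \<and> entry N Q i = n + 2 \<and> entry N T (i + 1) = n + 1)"
    "\<forall>i\<in>{1..m - 1}. entry N Q i = entry N T (i + 1) \<longrightarrow> entry N Q i \<notin> cuts ty n m Q T"
    using lowering_to_arrow[of ty n m P T] by blast
  \<comment> \<open>The descent keeps Q above T only combinatorially; a second chain of moves, from
    Q down to T, turns this into an inclusion of Schubert varieties.\<close>
  have TQ: "bruhat_le N m \<omega> e T Q" by (rule lowers_chain_bruhat_le[OF lowering_chain[OF Q(1)]])
  moreover have "bruhat_le N m \<omega> e Q P" by (rule lowers_chain_bruhat_le[OF Q(2)])
  moreover have "Z_variety ty n m e Q T = Z_variety ty n m e P T"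
    using Q(3,4) by (simp add: Z_variety_def)
  moreover have "arrow ty n m \<omega> e Q T"
    using TQ Q(5,6) by (simp add: arrow_def Let_def)
  moreover have "Q \<in> schubert_symbols N m"
    using Q(1) by (simp add: ordered_pair_def symbol_pair_def)
  ultimately show ?thesis by blast
qed

end
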